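(* Let $G\in\mathcal{G}$, let $k,d$ be integers with $0\le d\le k$, let $\omega^u$ be an MCP upper-bound function, and let $G'=\mathrm{truss}(G,k,d,\omega^u)$ be the output of the peeling procedure described in the context. Let $n=|V(G)|$, $m=|E(G)|$, let $w$ be the amortized time for one computation of $\omega^u$, and let $w_s$ be the space used for one computation of $\omega^u$. Then: (1) If $\omega^u$ is increasing, then $G'$ is the $(k,d,\omega^u)$-truss of $G$. (2) Assuming space complexity $\mathcal{O}(n+m+w_s)$: - if $d>0$ or $\omega^u$ is edge-sensitive, then the running time is $\mathcal{O}\left(n+(\sqrt m+w)\,m^{\frac{d+4}{2}}\right)$; - if $d=0$ and $\omega^u$ is not edge-sensitive, then the running time is $\mathcal{O}\left(n+(\sqrt m+w)\,m^{\frac32}\right)$. (3) Assuming space complexity $\mathcal{O}(n+m^{\frac{d+3}{2}}+w_s)$: - if $d>0$ or $\omega^u$ is edge-sensitive, then the running time is $\mathcal{O}\left(n+w\,m^{\frac{d+4}{2}}\right)$; - if $d=0$ and $\omega^u$ is not edge-sensitive, then the running time is $\mathcal{O}\left(n+w\,m^{\frac32}\right)$.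
   Context: $\mathcal{G}$ is the class of all finite, simple, undirected graphs, and $\mathbb{N}_0=\{0,1,2,\dots\}$. Vertices are labeled by distinct natural numbers and ordered by label; $N_G(v)$ is the neighborhood of $v$ and $N_G^+(v)=\{u\in N_G(v): v<u\}$. $G[S]$ is the induced subgraph, $H\subseteq G$ means subgraph, $\overline{uv}$ is the edge joining $u,v$, $G\setminus\overline{uv}$ is edge deletion, and $\omega(G)$ is the clique number. $\omega^u:\mathcal{G}\to\mathbb{N}_0$ is an MCP upper-bound function if $\omega(G)\le\omega^u(G)\le|V(G)|$ for all $G\in\mathcal{G}$; it is increasing if $G\subseteq G'$ implies $\omega^u(G)\le\omega^u(G')$; it is edge-sensitive if $\omega^u(G)\ne\omega^u(G\setminus\overline{uv})$ for some $G\in\mathcal{G}$ and some edge $\overline{uv}$ of $G$. For a clique $K$ of $G$ put $W_G(K):=\bigcap_{x\in K}N_G(x)$. For an edge $\overline{uv}$ of $G$, the condition $C_{G,k,d,\omega^u}(u,v)$ holds if there is a $(d+2)$-clique $K=\{u,v,w_1,\dots,w_d\}$ of $G$ with $\omega^u(G[W_G(K)])\ge k-d$. A $(k,d,\omega^u)$-truss of $G=(V,E)$ is a largest (maximum number of edges) spanning subgraph $G'=(V,E')$, $E'\subseteq E$, such that $C_{G',k,d,\omega^u}(u,v)$ holds for every $\overline{uv}\in E'$; it is unique when $\omega^u$ is increasing. Procedure $\mathrm{cond}(v_1,v_2,G)$: let $S=N_G(v_1)\cap N_G(v_2)$ and return $\text{c-rec}(\emptyset,S,S)$, where $\text{c-rec}(R,W,B)$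 is defined recursively: if $|R|=d$, return the truth value of $\omega^u(G[W])\ge k-d$; otherwise return $\bigvee_{v\in B}\text{c-rec}\big(R\cup\{v\},\,W\cap N_G(v),\,B\cap N_G^+(v)\big)$. Procedure $\mathrm{truss}(G,k,d,\omega^u)$: set $Q_E\leftarrow E(G)$. While $Q_E\ne\emptyset$: pick and remove an (arbitrary) edge $\overline{v_1v_2}$ from $Q_E$; if $\mathrm{cond}(v_1,v_2,G)$ is false for the current graph $G$, then let $S=N_G(v_1)\cap N_G(v_2)$; add to $Q_E$ all edges $\overline{wv_1},\overline{wv_2}$ with $w\in S$; if $d>0$ or $\omega^u$ is edge-sensitive, also add to $Q_E$ all edges $\overline{w_1w_2}$ with $w_1\in S$, $w_2\in S\cap N_G(w_1)$; then set $G\leftarrow G\setminus\overline{v_1v_2}$. When $Q_E=\emptyset$, return the current $G$. Running-time conventions: picking and removing an element of a set, and testing membership in a neighborhood, take $\mathcal{O}(1)$ time; one computation of $\omega^u$ costs at least one elementary step ($w=\Omega(1)$); isolated vertices are detected and ignored in $\mathcal{O}(n+m)$ time; hidden constants may depend on $d$. "Assuming space complexity $X$" means that the procedure is implemented so as to use $X$ space. In the $\mathcal{O}(n+m+w_s)$ implementation common neighborhoods are recomputed when needed; in the $\mathcal{O}(n+m^{(d+3)/2}+w_s)$ implementation the sets $W_G(K)$ for all $(d+2)$-cliques $K$ are precomputed, stored in a dictionary indexed by $K$ with $\mathcal{O}(1)$ lookup, and maintained under edge deletions. *)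

theory Defs
  imports Complex_Main "HOL-Library.Monad_Syntax"
begin

section \<open>Graphs and trusses\<close>

datatype graph = Graph (verts: "nat set") (edges: "nat set set")

definition simple_graph :: "graph \<Rightarrow> bool" where
  "simple_graph G \<longleftrightarrow>
     finite (verts G) \<and> (\<forall>e\<in>edges G. \<exists>u\<in>verts G. \<exists>v\<in>verts G. u \<noteq> v \<and> e = {u, v})"

definition subgraph :: "graph \<Rightarrow> graph \<Rightarrow> bool" where
  "subgraph H G \<longleftrightarrow> verts H \<subseteq> verts G \<and> edges H \<subseteq> edges G"

definition nbrs :: "graph \<Rightarrow> nat \<Rightarrow> nat set" where
  "nbrs G v = {u. {u, v} \<in> edges G}"

definition nbrs_above :: "graph \<Rightarrow> nat \<Rightarrow> nat set" where
  "nbrs_above G v = {u \<in> nbrs G v. v < u}"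

definition induced :: "graph \<Rightarrow> nat set \<Rightarrow> graph" where
  "induced G S = Graph (verts G \<inter> S) {e \<in> edges G. e \<subseteq> S}"

definition delete_edge :: "graph \<Rightarrow> nat \<Rightarrow> nat \<Rightarrow> graph" where
  "delete_edge G u v = Graph (verts G) (edges G - {{u, v}})"

definition clique :: "graph \<Rightarrow> nat set \<Rightarrow> bool" where
  "clique G K \<longleftrightarrow> K \<subseteq> verts G \<and> (\<forall>u\<in>K. \<forall>v\<in>K. u \<noteq> v \<longrightarrow> {u, v} \<in> edges G)"

definition clique_number :: "graph \<Rightarrow> nat" where
  "clique_number G = Max {card K |K. clique G K}"

definition MCP_upper_bound :: "(graph \<Rightarrow> nat) \<Rightarrow> bool" where
  "MCP_upper_bound \<omega>u \<longleftrightarrow>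
     (\<forall>G. simple_graph G \<longrightarrow> clique_number G \<le> \<omega>u G \<and> \<omega>u G \<le> card (verts G))"

definition increasing :: "(graph \<Rightarrow> nat) \<Rightarrow> bool" where
  "increasing \<omega>u \<longleftrightarrow>
     (\<forall>G G'. simple_graph G \<longrightarrow> simple_graph G' \<longrightarrow> subgraph G G' \<longrightarrow> \<omega>u G \<le> \<omega>u G')"

definition edge_sensitive :: "(graph \<Rightarrow> nat) \<Rightarrow> bool" where
  "edge_sensitive \<omega>u \<longleftrightarrow>
     (\<exists>G u v. simple_graph G \<and> {u, v} \<in> edges G \<and> \<omega>u G \<noteq> \<omega>u (delete_edge G u v))"

definition W :: "graph \<Rightarrow> nat set \<Rightarrow> nat set" where
  "W G K = (\<Inter>x\<in>K. nbrs G x)"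

definition truss_condition ::
    "nat \<Rightarrow> nat \<Rightarrow> (graph \<Rightarrow> nat) \<Rightarrow> graph \<Rightarrow> nat \<Rightarrow> nat \<Rightarrow> bool" where
  "truss_condition k d \<omega>u G u v \<longleftrightarrow>
     (\<exists>K. clique G K \<and> card K = d + 2 \<and> u \<in> K \<and> v \<in> K \<and> k - d \<le> \<omega>u (induced G (W G K)))"

definition truss_candidate ::
    "nat \<Rightarrow> nat \<Rightarrow> (graph \<Rightarrow> nat) \<Rightarrow> graph \<Rightarrow> graph \<Rightarrow> bool" where
  "truss_candidate k d \<omega>u G H \<longleftrightarrow>
     verts H = verts G \<and> edges H \<subseteq> edges G \<and>
     (\<forall>u v. {u, v} \<in> edges H \<longrightarrow> truss_condition k d \<omega>u H u v)"

definition is_truss :: "nat \<Rightarrow> nat \<Rightarrow> (graph \<Rightarrow> nat) \<Rightarrow> graph \<Rightarrow> graph \<Rightarrow> bool" where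
  "is_truss k d \<omega>u G H \<longleftrightarrow>
     truss_candidate k d \<omega>u G H \<and>
     (\<forall>H'. truss_candidate k d \<omega>u G H' \<longrightarrow> card (edges H') \<le> card (edges H))"


section \<open>The peeling procedure\<close>

text \<open>
  The truth value returned by c-rec. Its recursion terminates on finite graphs, so the least
  fixed point is the result of evaluating it.
\<close>

inductive c_rec :: "nat \<Rightarrow> nat \<Rightarrow> (graph \<Rightarrow> nat) \<Rightarrow> graph \<Rightarrow> nat set \<Rightarrow> nat set \<Rightarrow> nat set \<Rightarrow> bool"
  for k d \<omega>u G where
  leaf: "card R = d \<Longrightarrow> k - d \<le> \<omega>u (induced G U) \<Longrightarrow> c_rec k d \<omega>u G R U B"
| branch: "card R \<noteq> d \<Longrightarrow> v \<in> B \<Longrightarrow>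
    c_rec k d \<omega>u G (R \<union> {v}) (U \<inter> nbrs G v) (B \<inter> nbrs_above G v) \<Longrightarrow> c_rec k d \<omega>u G R U B"

definition cond :: "nat \<Rightarrow> nat \<Rightarrow> (graph \<Rightarrow> nat) \<Rightarrow> nat \<Rightarrow> nat \<Rightarrow> graph \<Rightarrow> bool" where
  "cond k d \<omega>u v1 v2 G =
     (let S = nbrs G v1 \<inter> nbrs G v2 in c_rec k d \<omega>u G {} S S)"

definition requeued ::
    "nat \<Rightarrow> (graph \<Rightarrow> nat) \<Rightarrow> graph \<Rightarrow> nat \<Rightarrow> nat \<Rightarrow> nat set set" where
  "requeued d \<omega>u G v1 v2 =
     (let S = nbrs G v1 \<inter> nbrs G v2 in
       {{w, v1} |w. w \<in> S} \<union> {{w, v2} |w. w \<in> S} \<union>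
       (if 0 < d \<or> edge_sensitive \<omega>u
        then {{w1, w2} |w1 w2. w1 \<in> S \<and> w2 \<in> S \<inter> nbrs G w1} else {}))"

text \<open>One iteration of the loop; a state is the current graph together with the queue.\<close>

inductive truss_step ::
    "nat \<Rightarrow> nat \<Rightarrow> (graph \<Rightarrow> nat) \<Rightarrow> graph \<times> nat set set \<Rightarrow> graph \<times> nat set set \<Rightarrow> bool"
  for k d \<omega>u where
  keep: "{v1, v2} \<in> Q \<Longrightarrow> cond k d \<omega>u v1 v2 G \<Longrightarrow>
    truss_step k d \<omega>u (G, Q) (G, Q - {{v1, v2}})"
| peel: "{v1, v2} \<in> Q \<Longrightarrow> \<not> cond k d \<omega>u v1 v2 G \<Longrightarrow>
    truss_step k d \<omega>u (G, Q)
      (delete_edge G v1 v2, (Q - {{v1, v2}}) \<union> requeued d \<omega>u G v1 v2)"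

definition truss_output :: "nat \<Rightarrow> nat \<Rightarrow> (graph \<Rightarrow> nat) \<Rightarrow> graph \<Rightarrow> graph \<Rightarrow> bool" where
  "truss_output k d \<omega>u G G' \<longleftrightarrow> (truss_step k d \<omega>u)\<^sup>*\<^sup>* (G, edges G) (G', {})"

text \<open>
  Every execution from the given state reaches a final state: there is neither an infinite
  execution nor one that gets stuck.
\<close>

inductive terminates :: "('s \<Rightarrow> 's \<Rightarrow> bool) \<Rightarrow> ('s \<Rightarrow> bool) \<Rightarrow> 's \<Rightarrow> bool"
  for step final where
  "(\<not> final s \<Longrightarrow> \<exists>s'. step s s') \<Longrightarrow>
   (\<And>s'. \<not> final s \<Longrightarrow> step s s' \<Longrightarrow> terminates step final s') \<Longrightarrow> terminates step final s"


section \<open>A nondeterministic language with time and space accounting\<close>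

text \<open>
  A program is the set of its possible executions, each consisting of a result and the list of
  resource events that occurred. \<open>Step\<close> is one elementary operation. \<open>Call t s\<close> is one
  computation of the upper-bound function, including the construction of its argument; it takes
  \<open>t\<close> steps and \<open>s\<close> cells of working memory that are released on return. Memory is
  counted in cells, where a cell holds a vertex, an edge or a reference.
\<close>

datatype event = Step | Call nat nat | Alloc nat | Free nat

datatype 'a prog = Prog (outcomes: "('a \<times> event list) set")

fun event_time :: "event \<Rightarrow> nat" where
  "event_time Step = 1"
| "event_time (Call t s) = t"
| "event_time (Alloc n) = 0"
| "event_time (Free n) = 0"

definition time :: "event list \<Rightarrow> nat" where
  "time tr = sum_list (map event_time tr)"

text \<open>Peak memory of an execution that starts with \<open>c\<close> cells in use.\<close>

fun peak :: "nat \<Rightarrow> event list \<Rightarrow> nat" where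
  "peak c [] = c"
| "peak c (Step # tr) = peak c tr"
| "peak c (Call t s # tr) = max (c + s) (peak c tr)"
| "peak c (Alloc n # tr) = peak (c + n) tr"
| "peak c (Free n # tr) = max c (peak (c - n) tr)"

definition space :: "event list \<Rightarrow> nat" where
  "space tr = peak 0 tr"

definition calls :: "event list \<Rightarrow> (nat \<times> nat) list" where
  "calls tr = List.bind tr (\<lambda>e. case e of Call t s \<Rightarrow> [(t, s)] | _ \<Rightarrow> [])"

text \<open>
  The individual calls may be arbitrarily uneven; only their total time is bounded. The condition
  \<open>1 \<le> w\<close> says that a computation of the upper-bound function takes at least one step.
\<close>

definition amortized_call_time :: "real \<Rightarrow> event list \<Rightarrow> bool" where
  "amortized_call_time w tr \<longleftrightarrow>
     1 \<le> w \<and> real (sum_list (map fst (calls tr))) \<le> w * real (length (calls tr))"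

definition call_space :: "nat \<Rightarrow> event list \<Rightarrow> bool" where
  "call_space ws tr \<longleftrightarrow> (\<forall>(t, s)\<in>set (calls tr). s \<le> ws)"

definition bind_prog :: "'a prog \<Rightarrow> ('a \<Rightarrow> 'b prog) \<Rightarrow> 'b prog" where
  "bind_prog p f =
     Prog {(y, t1 @ t2) |x y t1 t2. (x, t1) \<in> outcomes p \<and> (y, t2) \<in> outcomes (f x)}"

adhoc_overloading Monad_Syntax.bind \<rightleftharpoons> bind_prog

definition return :: "'a \<Rightarrow> 'a prog" where
  "return x = Prog {(x, [])}"

definition select :: "'a set \<Rightarrow> 'a prog" where
  "select A = Prog {(x, []) |x. x \<in> A}"

definition tick :: "nat \<Rightarrow> unit prog" where
  "tick n = Prog {((), replicate n Step)}"

definition alloc :: "nat \<Rightarrow> unit prog" where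
  "alloc n = Prog {((), [Alloc n])}"

definition free :: "nat \<Rightarrow> unit prog" where
  "free n = Prog {((), [Free n])}"

definition call :: "(graph \<Rightarrow> nat) \<Rightarrow> graph \<Rightarrow> nat prog" where
  "call \<omega>u H = Prog {(\<omega>u H, [Call t s]) |t s. 1 \<le> t}"

text \<open>
  Iteration over a finite set in an arbitrary order. One cell holds the current element during
  each pass; along a recursion these cells also store the vertices chosen so far.
\<close>

primrec foreach_list :: "('a \<Rightarrow> 's \<Rightarrow> 's prog) \<Rightarrow> 'a list \<Rightarrow> 's \<Rightarrow> 's prog" where
  "foreach_list f [] s = return s"
| "foreach_list f (x # xs) s =
     do { tick 1; alloc 1; s' \<leftarrow> f x s; free 1; foreach_list f xs s' }"

definition foreach :: "'a set \<Rightarrow> ('a \<Rightarrow> 's \<Rightarrow> 's prog) \<Rightarrow> 's \<Rightarrow> 's prog" where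
  "foreach A f s = do { xs \<leftarrow> select {xs. distinct xs \<and> set xs = A}; foreach_list f xs s }"

text \<open>Computing \<open>A \<inter> T\<close> by scanning \<open>A\<close>, with constant-time membership tests in \<open>T\<close>;
  for the common neighbors of two vertices, the smaller neighborhood is scanned.\<close>

definition intersect :: "nat set \<Rightarrow> nat set \<Rightarrow> nat set prog" where
  "intersect A T = do { tick (1 + card A); alloc (card (A \<inter> T)); return (A \<inter> T) }"

definition common_nbrs :: "graph \<Rightarrow> nat \<Rightarrow> nat \<Rightarrow> nat set prog" where
  "common_nbrs G u v =
     (if card (nbrs G u) \<le> card (nbrs G v) then intersect (nbrs G u) (nbrs G v)
      else intersect (nbrs G v) (nbrs G u))"

text \<open>A set that \<open>p\<close> computes and stores, and that is released at the end of the scope.\<close>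

definition with_local :: "nat set prog \<Rightarrow> (nat set \<Rightarrow> 'a prog) \<Rightarrow> 'a prog" where
  "with_local p f = do { S \<leftarrow> p; x \<leftarrow> f S; free (card S); return x }"

text \<open>
  Loop while the queue, the second component of the state, is nonempty. The third component is
  the additional data of an implementation.
\<close>

type_synonym 'x state = "graph \<times> nat set set \<times> 'x"

definition queue :: "'x state \<Rightarrow> nat set set" where
  "queue s = fst (snd s)"

inductive loop_run :: "('x state \<Rightarrow> 'x state prog) \<Rightarrow> 'x state \<Rightarrow> event list \<Rightarrow> 'x state \<Rightarrow> bool"
  for body where
  finished: "queue s = {} \<Longrightarrow> loop_run body s [Step] s"
| iterate: "queue s \<noteq> {} \<Longrightarrow> (s', t1) \<in> outcomes (body s) \<Longrightarrow> loop_run body s' t2 s'' \<Longrightarrow>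
    loop_run body s (Step # t1 @ t2) s''"

definition loop :: "('x state \<Rightarrow> 'x state prog) \<Rightarrow> 'x state \<Rightarrow> 'x state prog" where
  "loop body s = Prog {(s', tr) |s' tr. loop_run body s tr s'}"

definition execute :: "'x state prog \<Rightarrow> ('x state \<Rightarrow> 'x state prog) \<Rightarrow> graph prog" where
  "execute init body = do { s \<leftarrow> init; s' \<leftarrow> loop body s; return (fst s') }"

definition always_terminates :: "'x state prog \<Rightarrow> ('x state \<Rightarrow> 'x state prog) \<Rightarrow> bool" where
  "always_terminates init body \<longleftrightarrow>
     outcomes init \<noteq> {} \<and>
     (\<forall>(s, t)\<in>outcomes init.
        terminates (\<lambda>s s'. \<exists>tr. (s', tr) \<in> outcomes (body s)) (\<lambda>s. queue s = {}) s)"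


section \<open>Operations common to both implementations\<close>

text \<open>
  Reads the graph into adjacency sets (one cell per vertex, two per edge), skipping the isolated
  vertices from then on, and fills the queue.
\<close>

definition load_graph :: "graph \<Rightarrow> (graph \<times> nat set set) prog" where
  "load_graph G =
     do { tick (card (verts G) + card (edges G));
          alloc (card (verts G) + 2 * card (edges G));
          tick (card (edges G));
          alloc (card (edges G));
          return (G, edges G) }"

definition pick :: "nat set set \<Rightarrow> ((nat \<times> nat) \<times> nat set set) prog" where
  "pick Q =
     do { (v1, v2) \<leftarrow> select {(v1, v2). {v1, v2} \<in> Q};
          tick 1;
          free 1;
          return ((v1, v2), Q - {{v1, v2}}) }"

definition enqueue :: "nat set \<Rightarrow> nat set set \<Rightarrow> nat set set prog" where
  "enqueue e Q = do { tick 1; alloc (if e \<in> Q then 0 else 1); return (insert e Q) }"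

definition requeue ::
    "nat \<Rightarrow> (graph \<Rightarrow> nat) \<Rightarrow> graph \<Rightarrow> nat \<Rightarrow> nat \<Rightarrow> nat set set \<Rightarrow> nat set set prog" where
  "requeue d \<omega>u G v1 v2 Q =
     with_local (common_nbrs G v1 v2) (\<lambda>S.
       do { Q1 \<leftarrow> foreach S (\<lambda>w Q. do { Q' \<leftarrow> enqueue {w, v1} Q; enqueue {w, v2} Q' }) Q;
            if 0 < d \<or> edge_sensitive \<omega>u
            then foreach S (\<lambda>w1 Q.
                   with_local (intersect S (nbrs G w1)) (\<lambda>T.
                     foreach T (\<lambda>w2 Q. enqueue {w1, w2} Q) Q)) Q1
            else return Q1 })"

definition remove_edge :: "graph \<Rightarrow> nat \<Rightarrow> nat \<Rightarrow> graph prog" where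
  "remove_edge G u v = do { tick 1; free 2; return (delete_edge G u v) }"


section \<open>Implementation that recomputes common neighborhoods\<close>

text \<open>
  The first argument after the graph is \<open>d - |R|\<close>, the number of vertices still to be chosen;
  the set \<open>R\<close> itself influences nothing else.
\<close>

primrec c_rec_prog ::
    "nat \<Rightarrow> nat \<Rightarrow> (graph \<Rightarrow> nat) \<Rightarrow> graph \<Rightarrow> nat \<Rightarrow> nat set \<Rightarrow> nat set \<Rightarrow> bool prog" where
  "c_rec_prog k d \<omega>u G 0 U B =
     do { x \<leftarrow> call \<omega>u (induced G U); tick 1; return (k - d \<le> x) }"
| "c_rec_prog k d \<omega>u G (Suc r) U B =
     foreach B (\<lambda>v b.
       with_local (intersect U (nbrs G v)) (\<lambda>U'.
         with_local (intersect B (nbrs_above G v)) (\<lambda>B'.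
           do { c \<leftarrow> c_rec_prog k d \<omega>u G r U' B'; return (b \<or> c) }))) False"

definition cond_recompute ::
    "nat \<Rightarrow> nat \<Rightarrow> (graph \<Rightarrow> nat) \<Rightarrow> nat \<Rightarrow> nat \<Rightarrow> graph \<Rightarrow> bool prog" where
  "cond_recompute k d \<omega>u v1 v2 G =
     with_local (common_nbrs G v1 v2) (\<lambda>S. c_rec_prog k d \<omega>u G d S S)"

definition init_recompute :: "graph \<Rightarrow> unit state prog" where
  "init_recompute G = do { (G, Q) \<leftarrow> load_graph G; return (G, Q, ()) }"

definition body_recompute ::
    "nat \<Rightarrow> nat \<Rightarrow> (graph \<Rightarrow> nat) \<Rightarrow> unit state \<Rightarrow> unit state prog" where
  "body_recompute k d \<omega>u = (\<lambda>(G, Q, _).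
     do { ((v1, v2), Q1) \<leftarrow> pick Q;
          alloc 2;
          b \<leftarrow> cond_recompute k d \<omega>u v1 v2 G;
          (G', Q') \<leftarrow>
            (if b then return (G, Q1)
             else do { Q2 \<leftarrow> requeue d \<omega>u G v1 v2 Q1;
                       G' \<leftarrow> remove_edge G v1 v2;
                       return (G', Q2) });
          free 2;
          return (G', Q', ()) })"

definition truss_recompute :: "nat \<Rightarrow> nat \<Rightarrow> (graph \<Rightarrow> nat) \<Rightarrow> graph \<Rightarrow> graph prog" where
  "truss_recompute k d \<omega>u G = execute (init_recompute G) (body_recompute k d \<omega>u)"


section \<open>Implementation with a dictionary of common neighborhoods\<close>

text \<open>Maps every \<open>(d + 2)\<close>-clique \<open>K\<close> of the current graph \<open>G\<close> to \<open>W G K\<close>.\<close>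

type_synonym dict = "nat set \<Rightarrow> nat set option"

definition entry_size :: "dict \<Rightarrow> nat set \<Rightarrow> nat" where
  "entry_size D K = (case D K of None \<Rightarrow> 0 | Some U \<Rightarrow> 1 + card K + card U)"

definition store :: "nat set \<Rightarrow> nat set \<Rightarrow> dict \<Rightarrow> dict prog" where
  "store K U D =
     do { tick (1 + card K + card U);
          free (entry_size D K);
          alloc (1 + card K + card U);
          return (D(K \<mapsto> U)) }"

definition lookup :: "nat set \<Rightarrow> dict \<Rightarrow> nat set prog" where
  "lookup K D = do { tick 1; return (case D K of None \<Rightarrow> {} | Some U \<Rightarrow> U) }"

definition remove_from_entry :: "nat set \<Rightarrow> nat \<Rightarrow> dict \<Rightarrow> dict prog" where
  "remove_from_entry K x D =
     (case D K of
        None \<Rightarrow> do { tick 1; return D }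
      | Some U \<Rightarrow> do { tick 1; free (if x \<in> U then 1 else 0); return (D(K \<mapsto> U - {x})) })"

definition delete_entry :: "nat set \<Rightarrow> dict \<Rightarrow> dict prog" where
  "delete_entry K D =
     do { tick (1 + entry_size D K); free (entry_size D K); return (D(K := None)) }"

text \<open>
  Each clique is generated once, in increasing order of its vertices, starting from the edge
  formed by its two smallest ones.
\<close>

primrec store_cliques ::
    "graph \<Rightarrow> nat \<Rightarrow> nat set \<Rightarrow> nat set \<Rightarrow> nat set \<Rightarrow> dict \<Rightarrow> dict prog" where
  "store_cliques G 0 K U B D = store K U D"
| "store_cliques G (Suc r) K U B D =
     foreach B (\<lambda>v D.
       with_local (intersect U (nbrs G v)) (\<lambda>U'.
         with_local (intersect B (nbrs_above G v)) (\<lambda>B'.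
           store_cliques G r (insert v K) U' B' D))) D"

definition build_dict :: "nat \<Rightarrow> graph \<Rightarrow> dict prog" where
  "build_dict d G =
     foreach (edges G) (\<lambda>e D.
       with_local (common_nbrs G (Min e) (Max e)) (\<lambda>S.
         with_local (intersect S (nbrs_above G (Max e))) (\<lambda>B.
           store_cliques G d e S B D))) Map.empty"

text \<open>
  Applies \<open>f\<close> to \<open>R \<union> R'\<close> for every \<open>r\<close>-clique \<open>R'\<close> inside the candidate set computed by
  \<open>p\<close>. The program \<open>p\<close> is executed only if there is still a vertex to be chosen.
\<close>

primrec foreach_clique ::
    "graph \<Rightarrow> nat \<Rightarrow> nat set \<Rightarrow> nat set prog \<Rightarrow> (nat set \<Rightarrow> 's \<Rightarrow> 's prog) \<Rightarrow> 's \<Rightarrow> 's prog"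
  where
  "foreach_clique G 0 R p f s = f R s"
| "foreach_clique G (Suc r) R p f s =
     with_local p (\<lambda>B. foreach B (\<lambda>v s.
       foreach_clique G r (insert v R) (intersect B (nbrs_above G v)) f s) s)"

definition cond_dict ::
    "nat \<Rightarrow> nat \<Rightarrow> (graph \<Rightarrow> nat) \<Rightarrow> nat \<Rightarrow> nat \<Rightarrow> graph \<Rightarrow> dict \<Rightarrow> bool prog" where
  "cond_dict k d \<omega>u v1 v2 G D =
     foreach_clique G d {} (common_nbrs G v1 v2) (\<lambda>R b.
       do { U \<leftarrow> lookup ({v1, v2} \<union> R) D;
            x \<leftarrow> call \<omega>u (induced G U);
            tick 1;
            return (b \<or> k - d \<le> x) }) False"

text \<open>
  Prepares the dictionary for the deletion of the edge between \<open>v1\<close> and \<open>v2\<close>. If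
  \<open>v1 \<in> K\<close> and \<open>v2 \<in> W G K\<close> for a \<open>(d + 2)\<close>-clique \<open>K\<close>, then \<open>K - {v1}\<close> is a \<open>(d + 1)\<close>-clique
  of common neighbors of \<open>v1\<close> and \<open>v2\<close>; the entries of the cliques containing both disappear.
\<close>

definition update_dict :: "nat \<Rightarrow> graph \<Rightarrow> nat \<Rightarrow> nat \<Rightarrow> dict \<Rightarrow> dict prog" where
  "update_dict d G v1 v2 D =
     do { D1 \<leftarrow> foreach_clique G (d + 1) {} (common_nbrs G v1 v2) (\<lambda>R D.
            do { D' \<leftarrow> remove_from_entry (insert v1 R) v2 D;
                 remove_from_entry (insert v2 R) v1 D' }) D;
          foreach_clique G d {} (common_nbrs G v1 v2) (\<lambda>R D.
            delete_entry ({v1, v2} \<union> R) D) D1 }"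

definition init_dict :: "nat \<Rightarrow> graph \<Rightarrow> dict state prog" where
  "init_dict d G =
     do { (G, Q) \<leftarrow> load_graph G; D \<leftarrow> build_dict d G; return (G, Q, D) }"

definition body_dict ::
    "nat \<Rightarrow> nat \<Rightarrow> (graph \<Rightarrow> nat) \<Rightarrow> dict state \<Rightarrow> dict state prog" where
  "body_dict k d \<omega>u = (\<lambda>(G, Q, D).
     do { ((v1, v2), Q1) \<leftarrow> pick Q;
          alloc 2;
          b \<leftarrow> cond_dict k d \<omega>u v1 v2 G D;
          (G', Q', D') \<leftarrow>
            (if b then return (G, Q1, D)
             else do { Q2 \<leftarrow> requeue d \<omega>u G v1 v2 Q1;
                       D' \<leftarrow> update_dict d G v1 v2 D;
                       G' \<leftarrow> remove_edge G v1 v2;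
                       return (G', Q2, D') });
          free 2;
          return (G', Q', D') })"

definition truss_dict :: "nat \<Rightarrow> nat \<Rightarrow> (graph \<Rightarrow> nat) \<Rightarrow> graph \<Rightarrow> graph prog" where
  "truss_dict k d \<omega>u G = execute (init_dict d G) (body_dict k d \<omega>u)"

end

theory Submission
  imports Defs
begin

text \<open>
  Correctness. Deleting an edge can only harm edges that share a triangle with it, and edges
  between two common neighbors of its ends. These are the edges put back into the queue
  (\<open>truss_condition_delete_edge\<close>), so every edge outside the queue satisfies the condition at
  all times, and the final graph is a candidate for the truss. For an increasing bound, no edge of
  any candidate is ever deleted (\<open>candidate_survives\<close>). Hence the final graph contains all
  candidates and is the only one with the maximum number of edges.

  Running time. Write \<open>m\<close> for the number of edges and \<open>s\<close> for its square root, and let \<open>S e\<close> be the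
  common neighborhood of the ends of \<open>e\<close>. The time of one check of \<open>e\<close> and its number of calls of
  the upper-bound function are governed by the time \<open>scan_cost G r (S e)\<close> that a search for
  \<open>r\<close>-cliques inside \<open>S e\<close> takes, and the heart of the matter is that the sum of this over all
  edges is in \<open>O(s ^ (r + 2))\<close> (\<open>sum_scan_cost_edges\<close>). Two observations give it. The squares of
  the smaller degrees of the ends of the edges sum to at most \<open>4 * m\<^sup>2\<close>, as the product of two
  degrees counts pairs of darts. And the degrees inside a set \<open>U\<close> sum to at most both \<open>2 * m\<close> and
  \<open>(card U)\<^sup>2\<close>, hence to at most \<open>2 * s * card U\<close>, so one more level of the search costs a factor
  \<open>s\<close>.

  Every edge is checked once at the beginning and at most once more for each deleted edge, which
  multiplies the cost of a round of checks by \<open>m + 1\<close>. If only edges of common triangles are put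
  back, the relation between a deleted edge and the edges put back is symmetric. The number of
  additional checks of \<open>e\<close> is then at most \<open>2 * card (S e)\<close>, and \<open>sum_requeued_outer_le\<close> replaces
  the factor \<open>m\<close> by these numbers. A potential function turns this counting into a bound for
  every execution of the loop (\<open>body_outcome\<close>).

  Programs. The triple \<open>exec\<close> bounds result, steps, calls and memory of a program at once. It is
  derived compositionally for both implementations. Calls of the upper-bound function are only
  counted; their time enters at the end, through the amortized bound.
\<close>


section \<open>Simple graphs\<close>

lemma edgeE:
  assumes "simple_graph G" "e \<in> edges G"
  obtains u v where "e = {u, v}" "u \<noteq> v" "u \<in> verts G" "v \<in> verts G"
  using assms unfolding simple_graph_def by blast

lemma edge_endpoints:
  assumes "simple_graph G" "{u, v} \<in> edges G"
  shows "u \<noteq> v" "u \<in> verts G" "v \<in> verts G"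
proof -
  obtain a b where "{u, v} = {a, b}" "a \<noteq> b" "a \<in> verts G" "b \<in> verts G"
    using edgeE[OF assms] by metis
  then show "u \<noteq> v" "u \<in> verts G" "v \<in> verts G" by (auto simp: doubleton_eq_iff)
qed

lemma finite_edges:
  assumes "simple_graph G"
  shows "finite (edges G)"
proof (rule finite_subset)
  show "edges G \<subseteq> Pow (verts G)" by (auto elim!: edgeE[OF assms])
  show "finite (Pow (verts G))" using assms by (simp add: simple_graph_def)
qed

lemma in_nbrs_iff: "u \<in> nbrs G v \<longleftrightarrow> {u, v} \<in> edges G"
  by (simp add: nbrs_def)

lemma nbrs_sym: "u \<in> nbrs G v \<longleftrightarrow> v \<in> nbrs G u"
  by (simp add: nbrs_def insert_commute)

lemma finite_nbrs: "simple_graph G \<Longrightarrow> finite (nbrs G v)"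
  using edge_endpoints(2)[of G _ v]
  by (intro finite_subset[of "nbrs G v" "verts G"]) (auto simp: in_nbrs_iff simple_graph_def)

lemma not_self_nbr: "simple_graph G \<Longrightarrow> v \<notin> nbrs G v"
  using edge_endpoints(1)[of G v v] by (auto simp: in_nbrs_iff)

lemma nbrs_mono: "edges H \<subseteq> edges G \<Longrightarrow> nbrs H v \<subseteq> nbrs G v"
  by (auto simp: nbrs_def)

lemma simple_graph_spanning:
  "simple_graph G \<Longrightarrow> verts H = verts G \<Longrightarrow> edges H \<subseteq> edges G \<Longrightarrow> simple_graph H"
  unfolding simple_graph_def by auto

lemma simple_graph_induced: "simple_graph G \<Longrightarrow> simple_graph (induced G U)"
  unfolding simple_graph_def induced_def by fastforce

lemma delete_edge_simps [simp]:
  "verts (delete_edge G u v) = verts G"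
  "edges (delete_edge G u v) = edges G - {{u, v}}"
  by (simp_all add: delete_edge_def)

lemma W_insert: "W G (insert v K) = nbrs G v \<inter> W G K"
  by (simp add: W_def)

lemma W_empty [simp]: "W G {} = UNIV"
  by (simp add: W_def)

lemma W_union: "W G (K \<union> K') = W G K \<inter> W G K'"
  by (auto simp: W_def)

lemma W_mono: "edges H \<subseteq> edges G \<Longrightarrow> W H K \<subseteq> W G K"
  unfolding W_def using nbrs_mono[of H G] by blast

lemma W_antimono: "K \<subseteq> K' \<Longrightarrow> W G K' \<subseteq> W G K"
  by (auto simp: W_def)

lemma W_pair: "W G {u, v} = nbrs G u \<inter> nbrs G v"
  by (simp add: W_def)

lemma finite_W: "simple_graph G \<Longrightarrow> K \<noteq> {} \<Longrightarrow> finite (W G K)"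
  unfolding W_def using finite_nbrs by blast

lemma induced_subgraph_mono:
  assumes "verts H = verts G" "edges H \<subseteq> edges G" "U \<subseteq> U'"
  shows "subgraph (induced H U) (induced G U')"
  using assms by (auto simp: subgraph_def induced_def)

text \<open>
  The search for cliques extends a partial clique by vertices of increasing label, so it meets
  every clique inside a candidate set exactly once, entering it at its least vertex. The two
  equations below are the recursion that both implementations and \<open>c_rec\<close> follow.
\<close>

definition cliques_in :: "graph \<Rightarrow> nat \<Rightarrow> nat set \<Rightarrow> nat set set" where
  "cliques_in G r B =
     {R. finite R \<and> card R = r \<and> R \<subseteq> B \<and> (\<forall>u\<in>R. \<forall>v\<in>R. u \<noteq> v \<longrightarrow> {u, v} \<in> edges G)}"

lemma cliques_in_0 [simp]: "cliques_in G 0 B = {{}}"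
  by (auto simp: cliques_in_def)

lemma cliques_in_Suc:
  "cliques_in G (Suc r) B = (\<Union>v\<in>B. insert v ` cliques_in G r (B \<inter> nbrs_above G v))"
proof (intro equalityI subsetI)
  fix R assume R: "R \<in> cliques_in G (Suc r) B"
  then have ne: "R \<noteq> {}" and fin: "finite R" by (auto simp: cliques_in_def)
  define v where "v = Min R"
  have v: "v \<in> R" using ne fin by (simp add: v_def)
  have above: "v < u" if "u \<in> R - {v}" for u
    using that fin Min_le[of R u] unfolding v_def by (metis Diff_iff insertCI order_le_less)
  have "R - {v} \<in> cliques_in G r (B \<inter> nbrs_above G v)"
    using R v above unfolding cliques_in_def nbrs_above_def in_nbrs_iff by auto
  moreover have "v \<in> B" "R = insert v (R - {v})" using v R by (auto simp: cliques_in_def)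
  ultimately show "R \<in> (\<Union>v\<in>B. insert v ` cliques_in G r (B \<inter> nbrs_above G v))"
    by blast
next
  fix R assume "R \<in> (\<Union>v\<in>B. insert v ` cliques_in G r (B \<inter> nbrs_above G v))"
  then obtain v R' where v: "v \<in> B" and R: "R = insert v R'"
    and R': "R' \<in> cliques_in G r (B \<inter> nbrs_above G v)" by blast
  have "v \<notin> R'" using R' by (auto simp: cliques_in_def nbrs_above_def)
  then show "R \<in> cliques_in G (Suc r) B"
    using R' v unfolding R cliques_in_def
    by (simp add: insert_subset subset_iff nbrs_above_def in_nbrs_iff) (metis insert_commute)
qed

lemma clique_iff_cliques_in:
  assumes G: "simple_graph G" and e: "{u, v} \<in> edges G"
  shows "clique G K \<and> card K = r + 2 \<and> u \<in> K \<and> v \<in> K \<longleftrightarrow>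
         (\<exists>R\<in>cliques_in G r (W G {u, v}). K = {u, v} \<union> R)" (is "?L \<longleftrightarrow> ?R")
proof
  note uv = edge_endpoints[OF G e]
  assume L: ?L
  then have fin: "finite K" by (metis add_is_0 card.infinite zero_neq_numeral)
  have "card (K - {u, v}) = r" using L uv by (subst card_Diff_subset) auto
  then have "K - {u, v} \<in> cliques_in G r (W G {u, v})"
    using L fin unfolding cliques_in_def W_pair clique_def subset_iff by (simp add: in_nbrs_iff)
  then show ?R using L by (intro bexI[of _ "K - {u, v}"]) auto
next
  note uv = edge_endpoints[OF G e]
  assume ?R
  then obtain R where R: "R \<in> cliques_in G r (W G {u, v})" and K: "K = {u, v} \<union> R" by blast
  have disj: "u \<notin> R" "v \<notin> R"
    using R not_self_nbr[OF G] by (auto simp: cliques_in_def W_pair)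
  have "R \<subseteq> verts G"
    using R edge_endpoints[OF G] by (fastforce simp: cliques_in_def W_pair in_nbrs_iff)
  moreover have "\<And>x. x \<in> R \<Longrightarrow> {x, u} \<in> edges G \<and> {x, v} \<in> edges G"
    using R by (auto simp: cliques_in_def W_pair in_nbrs_iff)
  ultimately have "clique G K"
    using R e uv unfolding clique_def K cliques_in_def by (auto simp: insert_commute)
  moreover have "card K = r + 2"
    using R disj uv by (simp add: K cliques_in_def)
  ultimately show ?L by (simp add: K)
qed

section \<open>The peeling procedure is correct\<close>

lemma c_rec_iff:
  assumes "finite R" "card R + r = d" "R \<inter> B = {}"
  shows "c_rec k d \<omega>u G R U B \<longleftrightarrow>
         (\<exists>R'\<in>cliques_in G r B. k - d \<le> \<omega>u (induced G (U \<inter> W G R')))"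
  using assms
proof (induction r arbitrary: R U B)
  case 0
  then show ?case by (auto intro: c_rec.leaf elim: c_rec.cases)
next
  case (Suc r)
  have IH: "c_rec k d \<omega>u G (R \<union> {v}) (U \<inter> nbrs G v) (B \<inter> nbrs_above G v) \<longleftrightarrow>
      (\<exists>R'\<in>cliques_in G r (B \<inter> nbrs_above G v).
          k - d \<le> \<omega>u (induced G (U \<inter> nbrs G v \<inter> W G R')))" if "v \<in> B" for v
  proof (rule Suc.IH)
    show "card (R \<union> {v}) + r = d" using Suc.prems that by (subst card_Un_disjoint) auto
  qed (use Suc.prems in \<open>auto simp: nbrs_above_def\<close>)
  have "c_rec k d \<omega>u G R U B \<longleftrightarrow>
      (\<exists>v\<in>B. c_rec k d \<omega>u G (R \<union> {v}) (U \<inter> nbrs G v) (B \<inter> nbrs_above G v))"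
    using Suc.prems by (subst c_rec.simps) auto
  then show ?case
    using IH by (auto simp: cliques_in_Suc W_insert Int_assoc)
qed

lemma cond_iff:
  "cond k d \<omega>u u v G \<longleftrightarrow> (\<exists>R\<in>cliques_in G d (W G {u, v}).
     k - d \<le> \<omega>u (induced G (W G ({u, v} \<union> R))))"
  unfolding cond_def Let_def W_union by (subst c_rec_iff[where r = d]) (auto simp: W_pair)

lemma cond_iff_truss_condition:
  assumes "simple_graph G" "{u, v} \<in> edges G"
  shows "cond k d \<omega>u u v G \<longleftrightarrow> truss_condition k d \<omega>u G u v"
proof -
  have "truss_condition k d \<omega>u G u v \<longleftrightarrow>
      (\<exists>K. (clique G K \<and> card K = d + 2 \<and> u \<in> K \<and> v \<in> K) \<and> k - d \<le> \<omega>u (induced G (W G K)))"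
    unfolding truss_condition_def by simp
  then show ?thesis
    unfolding cond_iff clique_iff_cliques_in[OF assms] by auto
qed

text \<open>
  The edges put back into the queue, described through the edge alone instead of an ordered
  pair of end vertices.
\<close>

definition requeued_by :: "bool \<Rightarrow> graph \<Rightarrow> nat set \<Rightarrow> nat set set" where
  "requeued_by inner G e =
     {{w, x} |w x. w \<in> W G e \<and> x \<in> e} \<union> (if inner then {f \<in> edges G. f \<subseteq> W G e} else {})"

lemma requeued_eq:
  assumes "simple_graph G"
  shows "requeued d \<omega>u G u v = requeued_by (0 < d \<or> edge_sensitive \<omega>u) G {u, v}"
proof -
  have "{{w1, w2} |w1 w2. w1 \<in> W G {u, v} \<and> w2 \<in> W G {u, v} \<inter> nbrs G w1} =
        {f \<in> edges G. f \<subseteq> W G {u, v}}" (is "?L = ?R")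
  proof (intro equalityI subsetI)
    fix f assume "f \<in> ?R"
    then show "f \<in> ?L" using assms by (auto simp: in_nbrs_iff insert_commute elim!: edgeE)
  qed (auto simp: in_nbrs_iff insert_commute)
  moreover have "{{w, x} |w x. w \<in> W G {u, v} \<and> x \<in> {u, v}} =
      {{w, u} |w. w \<in> W G {u, v}} \<union> {{w, v} |w. w \<in> W G {u, v}}" by blast
  ultimately show ?thesis
    unfolding requeued_def requeued_by_def Let_def W_pair[symmetric] by auto
qed

lemma requeued_by_edges:
  assumes "simple_graph G" "e \<in> edges G"
  shows "requeued_by inner G e \<subseteq> edges G - {e}"
proof -
  obtain u v where e: "e = {u, v}" using assms edgeE by metis
  have uv: "u \<notin> W G e" "v \<notin> W G e" using not_self_nbr[OF assms(1)] by (auto simp: e W_pair)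
  have "{w, x} \<in> edges G - {e}" if "w \<in> W G e" "x \<in> e" for w x
    using that uv by (auto simp: e W_pair in_nbrs_iff doubleton_eq_iff)
  moreover have "\<not> e \<subseteq> W G e" using uv by (auto simp: e)
  ultimately show ?thesis
    unfolding requeued_by_def by auto
qed

lemma requeued_by_mono:
  assumes "edges H \<subseteq> edges G"
  shows "requeued_by inner H e \<subseteq> requeued_by inner G e"
  using assms W_mono[OF assms, of e] unfolding requeued_by_def by (auto 0 3)

text \<open>
  Deleting an edge \<open>e\<close> can only harm the edges that are put back. A clique \<open>K\<close> that witnesses
  the condition for another edge \<open>f\<close> is lost only if \<open>e \<subseteq> K\<close>; its common neighborhood shrinks
  only if \<open>K\<close> contains one end of \<open>e\<close> and the other end is adjacent to all of \<open>K\<close>; and the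
  graph induced on it changes only if \<open>e\<close> lies inside, which matters only for an edge-sensitive
  bound. In each case \<open>f\<close> belongs to a triangle with \<open>e\<close>, or both of its ends are common
  neighbors of the ends of \<open>e\<close>, the latter in the first two cases only when \<open>d > 0\<close>.
\<close>

lemma truss_condition_delete_edge:
  assumes G: "simple_graph G" and e: "{a, b} \<in> edges G" and f: "{u, v} \<in> edges G"
    and ne: "{u, v} \<noteq> {a, b}"
    and notin: "{u, v} \<notin> requeued d \<omega>u G a b"
    and tc: "truss_condition k d \<omega>u G u v"
  shows "truss_condition k d \<omega>u (delete_edge G a b) u v"
proof -
  let ?G' = "delete_edge G a b"
  let ?inner = "0 < d \<or> edge_sensitive \<omega>u"
  obtain K where K: "clique G K" "card K = d + 2" "u \<in> K" "v \<in> K"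
    "k - d \<le> \<omega>u (induced G (W G K))"
    using tc unfolding truss_condition_def by blast
  note ab = edge_endpoints[OF G e] and uv = edge_endpoints[OF G f]
  have fin: "finite K" using K(2) by (metis add_is_0 card.infinite zero_neq_numeral)
  have notin1: "\<not> (w \<in> W G {a, b} \<and> x \<in> {a, b} \<and> {u, v} = {w, x})" for w x
    using notin unfolding requeued_eq[OF G] requeued_by_def by blast
  have notin2: "\<not> (?inner \<and> {u, v} \<subseteq> W G {a, b})"
    using notin f unfolding requeued_eq[OF G] requeued_by_def by fastforce
  have dpos: "0 < d" if "x \<in> K" "x \<notin> {u, v}" for x
  proof -
    have "card {u, v, x} \<le> card K" using fin that K by (intro card_mono) auto
    then show ?thesis using that uv K(2) by auto
  qed
  have other_end: "y \<notin> {a, b}" if "{u, v} = {y, x}" "x \<in> {a, b}" for x y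
  proof
    assume "y \<in> {a, b}"
    moreover have "y \<noteq> x" using that(1) uv by (auto simp: doubleton_eq_iff)
    ultimately have "{y, x} = {a, b}" using that(2) by auto
    then show False using that(1) ne by simp
  qed
  have two: False if x: "x \<in> K" "x \<in> {a, b}" and sub: "K - {a, b} \<subseteq> W G {a, b}" for x
  proof (cases "x \<in> {u, v}")
    case True
    then consider "x = u" | "x = v" by blast
    then obtain y where y: "{u, v} = {y, x}" "y \<in> K"
      using K(3,4) by cases (metis insert_commute)+
    then have "y \<in> W G {a, b}" using other_end[OF y(1) x(2)] sub by blast
    then show False using notin1[of y x] x(2) y(1) by simp
  next
    case out: False
    have "{u, v} \<subseteq> W G {a, b}"
    proof (rule ccontr)
      assume "\<not> ?thesis"
      then obtain z where z: "z \<in> {u, v}" "z \<in> {a, b}" using sub K by blast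
      from z(1) consider "z = u" | "z = v" by blast
      then obtain y where y: "{u, v} = {y, z}" "y \<in> K"
        using K(3,4) by cases (metis insert_commute)+
      then have "y \<in> W G {a, b}" using other_end[OF y(1) z(2)] sub by blast
      then show False using notin1[of y z] z(2) y(1) by simp
    qed
    then show False using notin2 dpos[OF x(1) out] by blast
  qed
  have no_e: "\<not> {a, b} \<subseteq> K"
  proof
    assume s: "{a, b} \<subseteq> K"
    then have "K - {a, b} \<subseteq> W G {a, b}"
      using K(1) s by (simp add: clique_def W_pair in_nbrs_iff subset_iff)
    then show False using two[of a] s by simp
  qed
  have cl: "clique ?G' K"
    using K(1) no_e unfolding clique_def by (auto simp: doubleton_eq_iff)
  have half: False if "x \<in> K" "y \<in> W G K" "{x, y} = {a, b}" for x y
  proof -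
    have "K - {a, b} \<subseteq> W G {a, b}"
    proof
      fix z assume z: "z \<in> K - {a, b}"
      then have "z \<in> nbrs G x" using K(1) that by (auto simp: clique_def in_nbrs_iff)
      moreover have "z \<in> nbrs G y" using that z by (auto simp: W_def nbrs_sym[of z])
      ultimately show "z \<in> W G {a, b}" by (simp flip: that(3) add: W_pair)
    qed
    then show False using two[of x] that by auto
  qed
  have W: "W ?G' K = W G K"
  proof
    show "W ?G' K \<subseteq> W G K" by (rule W_mono) auto
    show "W G K \<subseteq> W ?G' K"
    proof
      fix y assume y: "y \<in> W G K"
      have "{y, x} \<noteq> {a, b}" if "x \<in> K" for x using half[OF that y] by (auto simp: insert_commute)
      then show "y \<in> W ?G' K" using y by (auto simp: W_def in_nbrs_iff)
    qed
  qed
  have "\<omega>u (induced ?G' (W G K)) = \<omega>u (induced G (W G K))"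
  proof (cases "{a, b} \<subseteq> W G K")
    case True
    then have "x \<in> W G {a, b}" if "x \<in> K" for x
      using that unfolding W_def by (auto simp: nbrs_sym[of x])
    then have "{u, v} \<subseteq> W G {a, b}" using K by blast
    then have "\<not> edge_sensitive \<omega>u" using notin2 by blast
    moreover have "induced ?G' (W G K) = delete_edge (induced G (W G K)) a b"
      by (auto simp: induced_def delete_edge_def)
    moreover have "{a, b} \<in> edges (induced G (W G K))" using True e by (auto simp: induced_def)
    ultimately show ?thesis
      using simple_graph_induced[OF G] unfolding edge_sensitive_def by metis
  next
    case False
    then have "induced ?G' (W G K) = induced G (W G K)"
      by (auto simp: induced_def)
    then show ?thesis by simp
  qed
  then show ?thesis using K cl unfolding truss_condition_def by (auto simp: W)
qed

lemma truss_condition_mono: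
  assumes inc: "increasing \<omega>u" and G: "simple_graph G"
    and H: "verts H = verts G" "edges H \<subseteq> edges G" and tc: "truss_condition k d \<omega>u H u v"
  shows "truss_condition k d \<omega>u G u v"
proof -
  obtain K where K: "clique H K" "card K = d + 2" "u \<in> K" "v \<in> K"
    "k - d \<le> \<omega>u (induced H (W H K))"
    using tc unfolding truss_condition_def by blast
  have "\<omega>u (induced H (W H K)) \<le> \<omega>u (induced G (W G K))"
    using inc induced_subgraph_mono[OF H W_mono[OF H(2)]] simple_graph_induced G
      simple_graph_spanning[OF G H] unfolding increasing_def by blast
  moreover have "clique G K" using K(1) H unfolding clique_def by auto
  ultimately show ?thesis using K unfolding truss_condition_def by fastforce
qed

text \<open>
  What every reachable state of the loop satisfies. The last part makes the final graph a
  candidate for the truss, since then no edge is queued.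
\<close>

definition peeling_invariant ::
    "nat \<Rightarrow> nat \<Rightarrow> (graph \<Rightarrow> nat) \<Rightarrow> graph \<Rightarrow> graph \<times> nat set set \<Rightarrow> bool" where
  "peeling_invariant k d \<omega>u G = (\<lambda>(H, Q).
     verts H = verts G \<and> edges H \<subseteq> edges G \<and> Q \<subseteq> edges H \<and>
     (\<forall>u v. {u, v} \<in> edges H - Q \<longrightarrow> truss_condition k d \<omega>u H u v))"

lemma peeling_invariant_step:
  assumes G: "simple_graph G"
    and inv: "peeling_invariant k d \<omega>u G s" and step: "truss_step k d \<omega>u s s'"
  shows "peeling_invariant k d \<omega>u G s'"
  using step
proof cases
  case (keep a b Q H)
  then have H: "simple_graph H" "{a, b} \<in> edges H"
    using inv simple_graph_spanning[OF G, of H] by (auto simp: peeling_invariant_def)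
  have "truss_condition k d \<omega>u H u v" if "{u, v} = {a, b}" for u v
  proof -
    have "truss_condition k d \<omega>u H a b" using keep cond_iff_truss_condition[OF H] by simp
    then show ?thesis using that unfolding truss_condition_def by (auto simp: doubleton_eq_iff)
  qed
  then show ?thesis using inv keep unfolding peeling_invariant_def by auto
next
  case (peel a b Q H)
  then have H: "simple_graph H" "{a, b} \<in> edges H"
    using inv simple_graph_spanning[OF G, of H] by (auto simp: peeling_invariant_def)
  have "truss_condition k d \<omega>u (delete_edge H a b) u v"
    if "{u, v} \<in> edges H" "{u, v} \<noteq> {a, b}" "{u, v} \<notin> Q" "{u, v} \<notin> requeued d \<omega>u H a b" for u v
    using truss_condition_delete_edge[OF H that(1,2,4)] that inv peel
    by (auto simp: peeling_invariant_def)
  moreover have "requeued d \<omega>u H a b \<subseteq> edges H - {{a, b}}"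
    unfolding requeued_eq[OF H(1)] by (rule requeued_by_edges[OF H])
  ultimately show ?thesis using inv peel unfolding peeling_invariant_def by auto
qed

lemma peeling_invariant_steps:
  assumes "simple_graph G" "(truss_step k d \<omega>u)\<^sup>*\<^sup>* (G, edges G) s"
  shows "peeling_invariant k d \<omega>u G s"
  using assms(2)
  by (induction rule: rtranclp_induct)
    (simp_all add: peeling_invariant_step[OF assms(1)], simp add: peeling_invariant_def)

text \<open>
  For an increasing bound, an edge of a candidate \<open>H\<close> satisfies the condition in every graph
  that contains \<open>H\<close>, so peeling never removes it.
\<close>

lemma candidate_survives:
  assumes G: "simple_graph G" and inc: "increasing \<omega>u" and H: "truss_candidate k d \<omega>u G H"
    and steps: "(truss_step k d \<omega>u)\<^sup>*\<^sup>* (G, edges G) s"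
  shows "edges H \<subseteq> edges (fst s)"
  using steps
proof (induction rule: rtranclp_induct)
  case base
  then show ?case using H by (simp add: truss_candidate_def)
next
  case (step s s')
  have inv: "peeling_invariant k d \<omega>u G s" using peeling_invariant_steps[OF G step(1)] .
  from step(2) show ?case
  proof cases
    case (keep a b Q G0)
    then show ?thesis using step.IH by simp
  next
    case (peel a b Q G0)
    have G0: "simple_graph G0" "{a, b} \<in> edges G0" "verts H = verts G0"
      using inv peel H simple_graph_spanning[OF G, of G0]
      by (auto simp: peeling_invariant_def truss_candidate_def)
    have "{a, b} \<notin> edges H"
    proof
      assume "{a, b} \<in> edges H"
      then have "truss_condition k d \<omega>u H a b" using H by (simp add: truss_candidate_def)
      then have "truss_condition k d \<omega>u G0 a b"
        using truss_condition_mono[OF inc G0(1,3)] step.IH peel by simp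
      then show False using peel cond_iff_truss_condition[OF G0(1,2)] by simp
    qed
    then show ?thesis using step.IH peel by auto
  qed
qed

lemma peeling_output_is_the_truss:
  assumes G: "simple_graph G" and inc: "increasing \<omega>u" and out: "truss_output k d \<omega>u G G'"
  shows "is_truss k d \<omega>u G G' \<and> (\<forall>H. is_truss k d \<omega>u G H \<longrightarrow> H = G')"
proof -
  have steps: "(truss_step k d \<omega>u)\<^sup>*\<^sup>* (G, edges G) (G', {})"
    using out by (simp add: truss_output_def)
  have cand: "truss_candidate k d \<omega>u G G'"
    using peeling_invariant_steps[OF G steps] by (simp add: peeling_invariant_def truss_candidate_def)
  have sub: "edges H \<subseteq> edges G'" if "truss_candidate k d \<omega>u G H" for H
    using candidate_survives[OF G inc that steps] by simp
  have fin: "finite (edges G')"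
    using cand finite_edges[OF G] finite_subset by (auto simp: truss_candidate_def)
  have "is_truss k d \<omega>u G G'"
    unfolding is_truss_def using cand sub fin by (simp add: card_mono)
  moreover have "H = G'" if H: "is_truss k d \<omega>u G H" for H
  proof -
    have "edges H = edges G'"
      using H cand sub fin unfolding is_truss_def by (meson card_seteq)
    moreover have "verts H = verts G'" using H cand by (simp add: is_truss_def truss_candidate_def)
    ultimately show ?thesis by (simp add: graph.expand)
  qed
  ultimately show ?thesis by blast
qed

text \<open>Each step either deletes an edge of the graph, or keeps the graph and shortens the queue.\<close>

lemma peeling_terminates:
  assumes G: "simple_graph G" and inv: "peeling_invariant k d \<omega>u G s"
  shows "terminates (truss_step k d \<omega>u) (\<lambda>(H, Q). Q = {}) s"
  using inv
proof (induction s rule: wf_induct_rule[OF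
      wf_measures[of "[\<lambda>(H, Q). card (edges H), \<lambda>(H, Q). card Q]"]])
  case (1 s)
  obtain H Q where s: "s = (H, Q)" by (cases s)
  have H: "simple_graph H" "Q \<subseteq> edges H"
    using 1(2) simple_graph_spanning[OF G, of H] by (auto simp: s peeling_invariant_def)
  have fin: "finite (edges H)" "finite Q" using finite_edges[OF H(1)] H(2) finite_subset by auto
  show ?case
  proof (rule terminates.intros)
    assume "\<not> (case s of (H, Q) \<Rightarrow> Q = {})"
    then obtain e where e: "e \<in> Q" by (auto simp: s)
    then have "e \<in> edges H" using H(2) by blast
    then obtain u v where "e = {u, v}" by (rule edgeE[OF H(1)])
    with e have uv: "{u, v} \<in> Q" by simp
    then show "\<exists>s'. truss_step k d \<omega>u s s'"
      unfolding s using truss_step.keep[OF uv] truss_step.peel[OF uv] by metis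
  next
    fix s' assume step: "truss_step k d \<omega>u s s'"
    have "(s', s) \<in> measures [\<lambda>(H, Q). card (edges H), \<lambda>(H, Q). card Q]"
      using step
    proof cases
      case (keep a b Q' H')
      then show ?thesis using fin s card_Diff1_less[of Q "{a, b}"] by auto
    next
      case (peel a b Q' H')
      then show ?thesis using fin s H card_Diff1_less[of "edges H" "{a, b}"] by auto
    qed
    then show "terminates (truss_step k d \<omega>u) (\<lambda>(H, Q). Q = {}) s'"
      using 1 peeling_invariant_step[OF G 1(2) step] by blast
  qed
qed

section \<open>Counting cliques\<close>

text \<open>
  All running times are governed by this function. Up to a constant factor, for \<open>r \<ge> 1\<close>, it
  bounds the time of a search that has to choose \<open>r\<close> more vertices from the candidate set \<open>U\<close>,
  and the number of cliques that it finds. Each choice of a vertex but the last is followed by a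
  scan of \<open>U\<close>, which yields the candidates for the next one. A search that also computes the
  remaining candidates after the last choice is charged with one level more.
\<close>

fun scan_cost :: "graph \<Rightarrow> nat \<Rightarrow> nat set \<Rightarrow> nat" where
  "scan_cost G 0 U = 1"
| "scan_cost G (Suc 0) U = 1 + card U"
| "scan_cost G (Suc (Suc r)) U = (\<Sum>v\<in>U. 1 + card U + scan_cost G (Suc r) (U \<inter> nbrs G v))"

abbreviation edge_scan :: "graph \<Rightarrow> nat \<Rightarrow> nat set \<Rightarrow> nat" where
  "edge_scan G r e \<equiv> scan_cost G r (W G e)"

lemma scan_cost_mono:
  assumes "edges H \<subseteq> edges G" "U \<subseteq> U'" "finite U'"
  shows "scan_cost H r U \<le> scan_cost G r U'"
  using assms
proof (induction H r U arbitrary: U' rule: scan_cost.induct)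
  case (3 H r U)
  have le: "scan_cost H (Suc r) (U \<inter> nbrs H v) \<le> scan_cost G (Suc r) (U' \<inter> nbrs G v)" if "v \<in> U" for v
    using that 3(2-) nbrs_mono[OF 3(2), of v] by (intro 3(1)) auto
  have "scan_cost H (Suc (Suc r)) U \<le> (\<Sum>v\<in>U. 1 + card U' + scan_cost G (Suc r) (U' \<inter> nbrs G v))"
    using le card_mono[OF 3(4,3)] unfolding scan_cost.simps by (intro sum_mono add_mono) auto
  also have "\<dots> \<le> scan_cost G (Suc (Suc r)) U'"
    using 3(3,4) unfolding scan_cost.simps by (intro sum_mono2) auto
  finally show ?case .
qed (auto intro: card_mono)

lemma sum_scan_cost_le: "(\<Sum>v\<in>U. scan_cost G r (U \<inter> nbrs G v)) \<le> scan_cost G (Suc r) U"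
  by (cases r) (auto intro: sum_mono)

lemma nbrs_above_subset: "B \<inter> nbrs_above G v \<subseteq> B \<inter> nbrs G v"
  by (auto simp: nbrs_above_def)

definition darts :: "graph \<Rightarrow> (nat \<times> nat) set" where
  "darts G = {(u, v). {u, v} \<in> edges G}"

lemma darts_eq: "darts G = Sigma UNIV (nbrs G)"
  by (auto simp: darts_def in_nbrs_iff insert_commute)

lemma darts_subset: "simple_graph G \<Longrightarrow> darts G \<subseteq> verts G \<times> verts G"
  by (clarsimp simp: darts_def edge_endpoints)

lemma finite_darts: "simple_graph G \<Longrightarrow> finite (darts G)"
  by (rule finite_subset[OF darts_subset]) (simp_all add: simple_graph_def)

lemma card_darts_le:
  assumes G: "simple_graph G"
  shows "card (darts G) \<le> 2 * card (edges G)"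
proof -
  have two: "card {(u, v). {u, v} = e} \<le> 2" if e: "e \<in> edges G" for e
  proof -
    obtain a b where ab: "e = {a, b}" using e by (rule edgeE[OF G])
    have "{(u, v). {u, v} = e} \<subseteq> {(a, b), (b, a)}"
      unfolding ab doubleton_eq_iff by blast
    from card_mono[OF _ this] have "card {(u, v). {u, v} = e} \<le> card {(a, b), (b, a)}" by blast
    also have "\<dots> \<le> 2" using card_length[of "[(a, b), (b, a)]"] by simp
    finally show ?thesis .
  qed
  have "darts G = (\<Union>e\<in>edges G. {(u, v). {u, v} = e})" by (auto simp: darts_def)
  then have "card (darts G) \<le> (\<Sum>e\<in>edges G. card {(u, v). {u, v} = e})"
    by (simp add: card_UN_le finite_edges[OF G])
  also have "\<dots> \<le> (\<Sum>e\<in>edges G. 2)" using two by (rule sum_mono)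
  finally show ?thesis by simp
qed

text \<open>The time to scan the smaller neighborhood of the two ends of an edge.\<close>

definition min_degree :: "graph \<Rightarrow> nat set \<Rightarrow> nat" where
  "min_degree G e = Min ((\<lambda>x. card (nbrs G x)) ` e)"

lemma min_degree_pair: "min_degree G {u, v} = min (card (nbrs G u)) (card (nbrs G v))"
  by (simp add: min_degree_def)

lemma min_degree_mono:
  assumes "simple_graph G" "edges H \<subseteq> edges G"
  shows "min_degree H {u, v} \<le> min_degree G {u, v}"
  unfolding min_degree_pair
  using assms by (intro min.mono card_mono finite_nbrs nbrs_mono)

lemma card_W_pair_le: "simple_graph G \<Longrightarrow> card (W G {u, v}) \<le> min_degree G {u, v}"
  by (simp add: W_pair min_degree_pair card_mono finite_nbrs)

lemma card_nbrs_le_edges: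
  assumes G: "simple_graph G"
  shows "card (nbrs G v) \<le> card (edges G)"
proof (rule card_inj_on_le[OF _ _ finite_edges[OF G]])
  show "inj_on (\<lambda>u. {u, v}) (nbrs G v)" by (auto simp: inj_on_def doubleton_eq_iff)
qed (auto simp: in_nbrs_iff)

lemma card_W_edge_le:
  assumes "simple_graph G" "e \<in> edges G"
  shows "card (W G e) \<le> min_degree G e" "card (W G e) \<le> card (edges G)" "finite (W G e)"
proof -
  obtain u v where e: "e = {u, v}" using assms(2) by (rule edgeE[OF assms(1)])
  show "card (W G e) \<le> min_degree G e" unfolding e by (rule card_W_pair_le[OF assms(1)])
  have "card (W G e) \<le> card (nbrs G u)"
    unfolding e W_pair by (intro card_mono finite_nbrs[OF assms(1)]) auto
  then show "card (W G e) \<le> card (edges G)" using card_nbrs_le_edges[OF assms(1), of u] by simp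
  show "finite (W G e)" unfolding e by (intro finite_W[OF assms(1)]) simp
qed

lemma sum_edges_le_darts:
  assumes "simple_graph G"
  shows "(\<Sum>e\<in>edges G. g e) \<le> (\<Sum>(u, v)\<in>darts G. g {u, v} :: nat)"
proof -
  have "edges G = (\<lambda>(u, v). {u, v}) ` darts G"
  proof (intro equalityI subsetI)
    fix e assume e: "e \<in> edges G"
    then obtain u v where "e = {u, v}" by (rule edgeE[OF assms])
    then show "e \<in> (\<lambda>(u, v). {u, v}) ` darts G" using e by (intro image_eqI[of _ _ "(u, v)"]) (auto simp: darts_def)
  qed (auto simp: darts_def)
  then have "sum g (edges G) \<le> sum (g \<circ> (\<lambda>(u, v). {u, v})) (darts G)"
    using sum_image_le[OF finite_darts[OF assms], of g "\<lambda>(u, v). {u, v}"] by simp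
  then show ?thesis by (simp add: case_prod_beta comp_def)
qed

text \<open>
  The square of the smaller degree is at most the product of the degrees, and summing the latter
  over all pairs of vertices gives the square of the number of darts.
\<close>

lemma sum_min_degree_squared_le:
  assumes G: "simple_graph G"
  shows "(\<Sum>e\<in>edges G. (min_degree G e)\<^sup>2) \<le> 4 * (card (edges G))\<^sup>2"
proof -
  let ?d = "\<lambda>v. card (nbrs G v)"
  have fin: "finite (verts G)" using G by (simp add: simple_graph_def)
  have D: "darts G = Sigma (verts G) (nbrs G)"
    using darts_subset[OF G] by (auto simp: darts_eq)
  have card: "card (darts G) = (\<Sum>v\<in>verts G. ?d v)"
    unfolding D using fin finite_nbrs[OF G] by simp
  have "(\<Sum>e\<in>edges G. (min_degree G e)\<^sup>2) \<le> (\<Sum>(u, v)\<in>darts G. (min_degree G {u, v})\<^sup>2)"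
    by (rule sum_edges_le_darts[OF G])
  also have "\<dots> \<le> (\<Sum>(u, v)\<in>darts G. ?d u * ?d v)"
    by (intro sum_mono) (auto simp: min_degree_pair power2_eq_square intro!: mult_mono)
  also have "\<dots> \<le> (\<Sum>(u, v)\<in>verts G \<times> verts G. ?d u * ?d v)"
    using fin darts_subset[OF G] by (intro sum_mono2) auto
  also have "\<dots> = (card (darts G))\<^sup>2"
    by (simp add: card power2_eq_square sum_product sum.cartesian_product)
  also have "\<dots> \<le> (2 * card (edges G))\<^sup>2" using card_darts_le[OF G] by (rule power_mono) simp
  finally show ?thesis by (simp add: power_mult_distrib)
qed

text \<open>From here on \<open>sqrt (real (card (edges G)))\<close> is the unit in which sums are measured.\<close>

definition root_edges :: "graph \<Rightarrow> real" where
  "root_edges G = sqrt (real (card (edges G)))"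

lemma root_edges_nonneg [simp]: "0 \<le> root_edges G"
  by (simp add: root_edges_def)

lemma root_edges_squared: "(root_edges G)\<^sup>2 = real (card (edges G))"
  by (simp add: root_edges_def)

lemma root_edges_power_mono:
  assumes "1 \<le> i" "i \<le> j"
  shows "root_edges G ^ i \<le> root_edges G ^ j"
proof (cases "card (edges G) = 0")
  case True
  then show ?thesis using assms by (simp add: root_edges_def power_0_left)
next
  case False
  then have "1 \<le> root_edges G" by (simp add: root_edges_def)
  then show ?thesis using assms by (simp add: power_increasing)
qed

lemma sum_min_degree_squared_le_root:
  assumes "simple_graph G"
  shows "(\<Sum>e\<in>edges G. (real (min_degree G e))\<^sup>2) \<le> 4 * root_edges G ^ 4"
proof -
  have "real (\<Sum>e\<in>edges G. (min_degree G e)\<^sup>2) \<le> real (4 * (card (edges G))\<^sup>2)"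
    using sum_min_degree_squared_le[OF assms] of_nat_mono by blast
  moreover have "root_edges G ^ 4 = (real (card (edges G)))\<^sup>2"
    by (simp flip: root_edges_squared power_mult)
  ultimately show ?thesis by simp
qed

text \<open>With \<open>s\<close> for the unit, \<open>2 * s * x \<le> x\<^sup>2 + s\<^sup>2\<close> reduces this sum to the sum of the squares.\<close>

lemma sum_min_degree_le_root:
  assumes G: "simple_graph G"
  shows "(\<Sum>e\<in>edges G. real (min_degree G e)) \<le> 3 * root_edges G ^ 3"
proof (cases "card (edges G) = 0")
  case True
  then show ?thesis using finite_edges[OF G] by simp
next
  case False
  let ?s = "root_edges G"
  have s: "0 < ?s" using False by (simp add: root_edges_def)
  have "2 * ?s * (\<Sum>e\<in>edges G. real (min_degree G e)) = (\<Sum>e\<in>edges G. 2 * ?s * real (min_degree G e))"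
    by (simp add: sum_distrib_left)
  also have "\<dots> \<le> (\<Sum>e\<in>edges G. (real (min_degree G e))\<^sup>2 + ?s\<^sup>2)"
    using sum_squares_bound[of ?s] by (intro sum_mono) (subst add.commute, blast)
  also have "\<dots> \<le> 4 * ?s ^ 4 + ?s ^ 4"
    using sum_min_degree_squared_le_root[OF G]
    by (simp add: sum.distrib flip: root_edges_squared power_add)
  also have "\<dots> \<le> 2 * ?s * (3 * ?s ^ 3)"
    using s by (simp add: power_Suc[symmetric] numeral_eq_Suc)
  finally show ?thesis using s by (simp add: mult_le_cancel_left_pos)
qed

lemma sum_nbrs_inside_le:
  assumes G: "simple_graph G" and U: "finite U"
  shows "(\<Sum>v\<in>U. real (card (U \<inter> nbrs G v))) \<le> 2 * (root_edges G)\<^sup>2"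
    and "(\<Sum>v\<in>U. real (card (U \<inter> nbrs G v))) \<le> (real (card U))\<^sup>2"
proof -
  have "(\<Sum>v\<in>U. card (U \<inter> nbrs G v)) = card (Sigma U (\<lambda>v. U \<inter> nbrs G v))" using U by simp
  also have "\<dots> \<le> card (darts G)"
    by (intro card_mono finite_darts[OF G]) (auto simp: darts_eq)
  also have "\<dots> \<le> 2 * card (edges G)" by (rule card_darts_le[OF G])
  finally have "real (\<Sum>v\<in>U. card (U \<inter> nbrs G v)) \<le> real (2 * card (edges G))"
    by (rule of_nat_mono)
  then show "(\<Sum>v\<in>U. real (card (U \<inter> nbrs G v))) \<le> 2 * (root_edges G)\<^sup>2"
    by (simp add: root_edges_squared)
  have "(\<Sum>v\<in>U. real (card (U \<inter> nbrs G v))) \<le> (\<Sum>v\<in>U. real (card U))"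
    using U by (intro sum_mono) (simp add: card_mono)
  then show "(\<Sum>v\<in>U. real (card (U \<inter> nbrs G v))) \<le> (real (card U))\<^sup>2"
    by (simp add: power2_eq_square)
qed

text \<open>
  The degrees inside \<open>U\<close> sum to at most both \<open>2 * m\<close> and the square of \<open>card U\<close>, hence to at
  most \<open>2 * sqrt m * card U\<close>. The first bound serves for the quadratic term and the last one for
  the linear term, so each level of the search costs a factor \<open>sqrt m\<close>.
\<close>

lemma scan_cost_le:
  "\<exists>C\<ge>0. \<forall>G U. simple_graph G \<longrightarrow> edges G \<noteq> {} \<longrightarrow> finite U \<longrightarrow>
     real (scan_cost G (Suc (Suc r)) U) \<le>
       C * ((real (card U))\<^sup>2 + real (card U) * root_edges G ^ Suc r)"
proof (induction r)
  case 0
  have "real (scan_cost G 2 U) \<le> 4 * ((real (card U))\<^sup>2 + real (card U) * root_edges G)"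
    if "finite U" for G U
  proof -
    have "scan_cost G 2 U = (\<Sum>v\<in>U. 2 + card U + card (U \<inter> nbrs G v))"
      by (simp add: numeral_2_eq_2)
    also have "\<dots> \<le> (\<Sum>v\<in>U. 2 + card U + card U)"
      using that by (intro sum_mono add_mono card_mono) auto
    also have "\<dots> = 2 * card U + 2 * (card U)\<^sup>2" by (simp add: algebra_simps power2_eq_square)
    also have "\<dots> \<le> 4 * (card U)\<^sup>2" by (simp add: power2_eq_square)
    finally have "real (scan_cost G 2 U) \<le> real (4 * (card U)\<^sup>2)" by (rule of_nat_mono)
    also have "\<dots> \<le> 4 * ((real (card U))\<^sup>2 + real (card U) * root_edges G)" by simp
    finally show ?thesis .
  qed
  then show ?case by (intro exI[of _ 4]) (simp add: numeral_2_eq_2)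
next
  case (Suc r)
  then obtain C where C: "0 \<le> C" and IH: "\<And>G U. simple_graph G \<Longrightarrow> edges G \<noteq> {} \<Longrightarrow> finite U \<Longrightarrow>
     real (scan_cost G (Suc (Suc r)) U) \<le>
       C * ((real (card U))\<^sup>2 + real (card U) * root_edges G ^ Suc r)"
    by blast
  have "real (scan_cost G (Suc (Suc (Suc r))) U) \<le>
      (2 + 4 * C) * ((real (card U))\<^sup>2 + real (card U) * root_edges G ^ Suc (Suc r))"
    if G: "simple_graph G" "edges G \<noteq> {}" and U: "finite U" for G U
  proof -
    let ?s = "root_edges G" and ?u = "real (card U)"
    let ?d = "\<lambda>v. real (card (U \<inter> nbrs G v))"
    have s: "1 \<le> ?s"
      using G finite_edges[OF G(1)] by (simp add: root_edges_def Suc_le_eq card_gt_0_iff)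
    have d_le: "?d v \<le> ?u" for v using U by (simp add: card_mono)
    note degs = sum_nbrs_inside_le[OF G(1) U]
    have sum_nonneg: "0 \<le> (\<Sum>v\<in>U. ?d v)" by (simp add: sum_nonneg)
    have linear: "(\<Sum>v\<in>U. ?d v) \<le> 2 * ?s * ?u"
    proof (rule power2_le_imp_le)
      have "(\<Sum>v\<in>U. ?d v)\<^sup>2 \<le> (2 * ?s\<^sup>2) * ?u\<^sup>2"
        unfolding power2_eq_square[of "sum _ _"] using degs sum_nonneg by (intro mult_mono) auto
      also have "\<dots> \<le> (2 * ?s * ?u)\<^sup>2" by (simp add: power_mult_distrib)
      finally show "(\<Sum>v\<in>U. ?d v)\<^sup>2 \<le> (2 * ?s * ?u)\<^sup>2" .
    qed simp
    have "(\<Sum>v\<in>U. (?d v)\<^sup>2) \<le> (\<Sum>v\<in>U. ?u * ?d v)"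
      using d_le by (intro sum_mono) (simp add: power2_eq_square mult_right_mono)
    also have "\<dots> \<le> ?u * (2 * ?s\<^sup>2)"
      unfolding sum_distrib_left[symmetric] using degs by (intro mult_left_mono) auto
    also have "\<dots> \<le> 2 * (?u * ?s ^ Suc (Suc r))"
      using mult_left_mono[OF power_increasing[OF _ s, of 2 "Suc (Suc r)"], of ?u]
      by (simp add: power_Suc mult_ac del: power_Suc)
    finally have quadratic: "(\<Sum>v\<in>U. (?d v)\<^sup>2) \<le> 2 * (?u * ?s ^ Suc (Suc r))" .
    have "real (scan_cost G (Suc (Suc (Suc r))) U)
        = (\<Sum>v\<in>U. 1 + ?u + real (scan_cost G (Suc (Suc r)) (U \<inter> nbrs G v)))"
      by (simp only: scan_cost.simps of_nat_sum of_nat_add of_nat_1)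
    also have "\<dots> \<le> (\<Sum>v\<in>U. 1 + ?u + C * ((?d v)\<^sup>2 + ?d v * ?s ^ Suc r))"
      using IH[OF G] U by (intro sum_mono add_left_mono) auto
    also have "\<dots> = ?u + ?u\<^sup>2 + C * ((\<Sum>v\<in>U. (?d v)\<^sup>2) + (\<Sum>v\<in>U. ?d v) * ?s ^ Suc r)"
      by (simp add: sum.distrib sum_distrib_left sum_distrib_right algebra_simps power2_eq_square)
    also have "\<dots> \<le> 2 * ?u\<^sup>2 + C * (2 * (?u * ?s ^ Suc (Suc r)) + 2 * ?s * ?u * ?s ^ Suc r)"
    proof (intro add_mono mult_left_mono C quadratic mult_right_mono linear)
      have "card U \<le> card U * card U" by simp
      then have "?u \<le> ?u\<^sup>2" unfolding power2_eq_square of_nat_mult[symmetric] by (rule of_nat_mono)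
      then show "?u + ?u\<^sup>2 \<le> 2 * ?u\<^sup>2" by simp
    qed simp
    also have "\<dots> = 2 * ?u\<^sup>2 + 4 * C * (?u * ?s ^ Suc (Suc r))" by (simp add: algebra_simps)
    also have "\<dots> \<le> (2 + 4 * C) * (?u\<^sup>2 + ?u * ?s ^ Suc (Suc r))"
      using C by (simp add: algebra_simps)
    finally show ?thesis .
  qed
  moreover have "0 \<le> 2 + 4 * C" using C by simp
  ultimately show ?case by blast
qed

text \<open>
  The common neighborhood of the ends of an edge is at most as large as the smaller degree, so the
  sums of these degrees and of their squares bound the two terms of \<open>scan_cost_le\<close>. That lemma
  starts at two levels, because a quadratic term for fewer levels would be too large here.
\<close>

lemma sum_scan_cost_edges:
  "\<exists>C\<ge>0. \<forall>G. simple_graph G \<longrightarrow>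
     (\<Sum>e\<in>edges G. real (edge_scan G r e)) \<le> C * root_edges G ^ (r + 2)"
proof -
  consider (0) "r = 0" | (1) "r = 1" | (2) r' where "r = Suc (Suc r')"
    by (metis One_nat_def not0_implies_Suc)
  then show ?thesis
  proof cases
    case 0
    then show ?thesis by (intro exI[of _ 1]) (simp flip: root_edges_squared add: numeral_2_eq_2)
  next
    case 1
    have "(\<Sum>e\<in>edges G. real (edge_scan G r e)) \<le> 4 * root_edges G ^ (r + 2)"
      if G: "simple_graph G" for G
    proof -
      have "(\<Sum>e\<in>edges G. real (edge_scan G r e)) \<le> (\<Sum>e\<in>edges G. 1 + real (min_degree G e))"
        using card_W_edge_le(1)[OF G] 1 by (intro sum_mono) simp
      also have "\<dots> \<le> root_edges G ^ 2 + 3 * root_edges G ^ 3"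
        using sum_min_degree_le_root[OF G] by (simp add: sum.distrib root_edges_squared)
      also have "\<dots> \<le> 4 * root_edges G ^ 3" using root_edges_power_mono[of 2 3 G] by simp
      finally show ?thesis using 1 by (simp add: numeral_3_eq_3)
    qed
    then show ?thesis by (intro exI[of _ 4]) simp
  next
    case 2
    obtain C where C: "0 \<le> C" and le: "\<And>G U. simple_graph G \<Longrightarrow> edges G \<noteq> {} \<Longrightarrow> finite U \<Longrightarrow>
       real (scan_cost G r U) \<le> C * ((real (card U))\<^sup>2 + real (card U) * root_edges G ^ Suc r')"
      using scan_cost_le[of r'] 2 by blast
    have "(\<Sum>e\<in>edges G. real (edge_scan G r e)) \<le> 7 * C * root_edges G ^ (r + 2)"
      if G: "simple_graph G" for G
    proof -
      let ?s = "root_edges G" and ?d = "\<lambda>e. real (min_degree G e)"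
      have "real (edge_scan G r e) \<le> C * ((?d e)\<^sup>2 + ?d e * ?s ^ Suc r')"
        if e: "e \<in> edges G" for e
      proof -
        have w: "real (card (W G e)) \<le> ?d e" using card_W_edge_le(1)[OF G e] by simp
        have "real (edge_scan G r e) \<le>
            C * ((real (card (W G e)))\<^sup>2 + real (card (W G e)) * ?s ^ Suc r')"
          using le[OF G] card_W_edge_le(3)[OF G e] e by blast
        also have "\<dots> \<le> C * ((?d e)\<^sup>2 + ?d e * ?s ^ Suc r')"
          using w by (intro mult_left_mono[OF _ C] add_mono mult_right_mono power_mono) auto
        finally show ?thesis .
      qed
      then have "(\<Sum>e\<in>edges G. real (edge_scan G r e)) \<le>
          (\<Sum>e\<in>edges G. C * ((?d e)\<^sup>2 + ?d e * ?s ^ Suc r'))" by (rule sum_mono)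
      also have "\<dots> = C * ((\<Sum>e\<in>edges G. (?d e)\<^sup>2) + (\<Sum>e\<in>edges G. ?d e) * ?s ^ Suc r')"
        by (simp add: sum.distrib sum_distrib_left sum_distrib_right distrib_left)
      also have "\<dots> \<le> C * (4 * ?s ^ (r + 2) + 3 * ?s ^ 3 * ?s ^ Suc r')"
      proof (intro mult_left_mono[OF _ C] add_mono mult_right_mono)
        show "(\<Sum>e\<in>edges G. (?d e)\<^sup>2) \<le> 4 * ?s ^ (r + 2)"
          using sum_min_degree_squared_le_root[OF G] root_edges_power_mono[of 4 "r + 2" G] 2 by simp
      qed (use sum_min_degree_le_root[OF G] in auto)
      also have "?s ^ 3 * ?s ^ Suc r' = ?s ^ (r + 2)"
        using 2 by (simp flip: power_add add: numeral_eq_Suc)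
      then have "3 * ?s ^ 3 * ?s ^ Suc r' = 3 * ?s ^ (r + 2)" by (simp add: mult.assoc)
      finally show ?thesis by (simp add: algebra_simps)
    qed
    then show ?thesis using C by (intro exI[of _ "7 * C"]) simp
  qed
qed

text \<open>
  With \<open>inner\<close> false, two edges put each other back exactly if they lie in a common triangle.
  This symmetry lets a sum over all deletions be regrouped by the edge put back.
\<close>

lemma requeued_by_outer_sym:
  assumes G: "simple_graph G" and "e \<in> edges G" "f \<in> requeued_by False G e"
  shows "e \<in> requeued_by False G f"
proof -
  obtain w x where w: "w \<in> W G e" "x \<in> e" "f = {w, x}"
    using assms(3) by (auto simp: requeued_by_def)
  obtain a b where "e = {a, b}" using assms(2) by (rule edgeE[OF G])
  then obtain y where e: "e = {y, x}" using w(2) by auto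
  have "y \<in> W G f" using w assms(2) by (auto simp: e W_pair in_nbrs_iff insert_commute)
  then show ?thesis unfolding requeued_by_def using w(3) e by blast
qed

lemma card_requeued_by_outer_le:
  assumes "simple_graph G" "e \<in> edges G"
  shows "card (requeued_by False G e) \<le> 2 * card (W G e)"
proof -
  obtain a b where e: "e = {a, b}" using assms(2) by (rule edgeE[OF assms(1)])
  have fin: "finite (W G e)" using card_W_edge_le[OF assms] by simp
  have "requeued_by False G e = (\<lambda>w. {w, a}) ` W G e \<union> (\<lambda>w. {w, b}) ` W G e"
    unfolding requeued_by_def e by auto
  then have "card (requeued_by False G e) \<le> card ((\<lambda>w. {w, a}) ` W G e) + card ((\<lambda>w. {w, b}) ` W G e)"
    by (simp add: card_Un_le)
  also have "\<dots> \<le> 2 * card (W G e)"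
    using card_image_le[OF fin, of "\<lambda>w. {w, a}"] card_image_le[OF fin, of "\<lambda>w. {w, b}"] by simp
  finally show ?thesis .
qed

text \<open>By symmetry, \<open>f\<close> is put back only by deletions of edges that \<open>f\<close> itself would put back.\<close>

lemma sum_requeued_outer_le:
  assumes G: "simple_graph G"
  shows "(\<Sum>e\<in>edges G. \<Sum>f\<in>requeued_by False G e. g f) \<le> (\<Sum>f\<in>edges G. 2 * card (W G f) * g f :: nat)"
proof -
  let ?E = "edges G" and ?R = "requeued_by False G"
  note fin = finite_edges[OF G]
  have sub: "?R e \<subseteq> ?E" if "e \<in> ?E" for e using requeued_by_edges[OF G that] by blast
  have "(\<Sum>e\<in>?E. \<Sum>f\<in>?R e. g f) = (\<Sum>e\<in>?E. \<Sum>f | f \<in> ?E \<and> f \<in> ?R e. g f)"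
    using sub by (intro sum.cong refl) auto
  also have "\<dots> = (\<Sum>f\<in>?E. \<Sum>e | e \<in> ?E \<and> f \<in> ?R e. g f)"
    using fin by (rule sum.swap_restrict) (rule fin)
  also have "\<dots> \<le> (\<Sum>f\<in>?E. 2 * card (W G f) * g f)"
  proof (rule sum_mono)
    fix f assume f: "f \<in> ?E"
    have "card {e \<in> ?E. f \<in> ?R e} \<le> card (?R f)"
      using requeued_by_outer_sym[OF G] finite_subset[OF sub[OF f] fin]
      by (intro card_mono) auto
    then have "card {e \<in> ?E. f \<in> ?R e} \<le> 2 * card (W G f)"
      using card_requeued_by_outer_le[OF G f] by simp
    then show "(\<Sum>e | e \<in> ?E \<and> f \<in> ?R e. g f) \<le> 2 * card (W G f) * g f"
      by (simp add: mult_right_mono)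
  qed
  finally show ?thesis .
qed

lemma sum_requeued_le:
  assumes G: "simple_graph G"
  shows "(\<Sum>e\<in>edges G. \<Sum>f\<in>requeued_by inner G e. g f) \<le> card (edges G) * (\<Sum>f\<in>edges G. g f :: nat)"
proof -
  have "(\<Sum>f\<in>requeued_by inner G e. g f) \<le> (\<Sum>f\<in>edges G. g f)" if "e \<in> edges G" for e
    using requeued_by_edges[OF G that, of inner] by (intro sum_mono2 finite_edges[OF G]) auto
  from sum_mono[OF this] show ?thesis by simp
qed

section \<open>Resources of an execution\<close>

text \<open>
  Calls of the upper-bound function are counted here, not timed; \<open>time_eq\<close> and \<open>peak_le\<close> add
  their time and space afterwards. The functions \<open>mem\<close> and \<open>high\<close> give the final and the highest
  memory use of an execution that starts with \<open>c\<close> cells in use.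
\<close>

definition step_count :: "event list \<Rightarrow> nat" where
  "step_count tr = length (filter ((=) Step) tr)"

definition call_count :: "event list \<Rightarrow> nat" where
  "call_count tr = length (calls tr)"

fun mem :: "nat \<Rightarrow> event list \<Rightarrow> nat" where
  "mem c [] = c"
| "mem c (Step # tr) = mem c tr"
| "mem c (Call t s # tr) = mem c tr"
| "mem c (Alloc n # tr) = mem (c + n) tr"
| "mem c (Free n # tr) = mem (c - n) tr"

fun high :: "nat \<Rightarrow> event list \<Rightarrow> nat" where
  "high c [] = c"
| "high c (Step # tr) = high c tr"
| "high c (Call t s # tr) = high c tr"
| "high c (Alloc n # tr) = high (c + n) tr"
| "high c (Free n # tr) = max c (high (c - n) tr)"

lemma calls_simps [simp]:
  "calls [] = []" "calls (Step # tr) = calls tr" "calls (Call t s # tr) = (t, s) # calls tr"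
  "calls (Alloc n # tr) = calls tr" "calls (Free n # tr) = calls tr"
  by (simp_all add: calls_def)

lemma calls_append [simp]: "calls (tr @ tr') = calls tr @ calls tr'"
  by (simp add: calls_def List.bind_def)

lemma call_count_simps [simp]:
  "call_count [] = 0" "call_count (Step # tr) = call_count tr"
  "call_count (Call t s # tr) = Suc (call_count tr)"
  "call_count (Alloc n # tr) = call_count tr" "call_count (Free n # tr) = call_count tr"
  "call_count (tr @ tr') = call_count tr + call_count tr'"
  by (simp_all add: call_count_def)

lemma step_count_simps [simp]:
  "step_count [] = 0" "step_count (Step # tr) = Suc (step_count tr)"
  "step_count (Call t s # tr) = step_count tr"
  "step_count (Alloc n # tr) = step_count tr" "step_count (Free n # tr) = step_count tr"
  "step_count (tr @ tr') = step_count tr + step_count tr'"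
  by (simp_all add: step_count_def)

lemma le_high: "c \<le> high c tr"
  by (induction c tr rule: high.induct) auto

lemma mem_le_high: "mem c tr \<le> high c tr"
  by (induction c tr rule: high.induct) auto

lemma mem_append [simp]: "mem c (tr @ tr') = mem (mem c tr) tr'"
  by (induction c tr rule: mem.induct) auto

lemma high_append [simp]: "high c (tr @ tr') = max (high c tr) (high (mem c tr) tr')"
  by (induction c tr rule: high.induct) (use le_high in \<open>auto simp: max.assoc max_absorb2\<close>)

lemma replicate_Step_simps [simp]:
  "step_count (replicate n Step) = n" "call_count (replicate n Step) = 0"
  "mem c (replicate n Step) = c" "high c (replicate n Step) = c"
  by (induction n) auto

lemma time_eq: "Defs.time tr = step_count tr + sum_list (map fst (calls tr))"
proof (induction tr)
  case (Cons e tr)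
  then show ?case by (cases e) (simp_all add: time_def)
qed (simp add: time_def)

lemma peak_le: "call_space ws tr \<Longrightarrow> peak c tr \<le> high c tr + ws"
proof (induction c tr rule: high.induct)
  case (3 c t s tr)
  then show ?case using le_high[of c tr] by (auto simp: call_space_def)
next
  case (5 c n tr)
  then have "peak (c - n) tr \<le> high (c - n) tr + ws" by (auto simp: call_space_def)
  then show ?case by auto
qed (auto simp: call_space_def)

text \<open>
  A Hoare triple with resource bounds: started with \<open>c\<close> cells in use, the program can run, and
  every execution ends with a result and a memory use that satisfy \<open>P\<close>, after at most \<open>a\<close>
  elementary steps and \<open>b\<close> calls, never using more than \<open>h\<close> cells outside of calls.
  That some execution exists is included because it yields that the main loop never gets stuck.
\<close>

definition exec :: "nat \<Rightarrow> 'a prog \<Rightarrow> ('a \<Rightarrow> nat \<Rightarrow> bool) \<Rightarrow> nat \<Rightarrow> nat \<Rightarrow> nat \<Rightarrow> bool" where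
  "exec c p P a b h \<longleftrightarrow> outcomes p \<noteq> {} \<and>
     (\<forall>(x, tr)\<in>outcomes p. P x (mem c tr) \<and> step_count tr \<le> a \<and> call_count tr \<le> b \<and> high c tr \<le> h)"

lemma execD:
  assumes "exec c p P a b h" "(x, tr) \<in> outcomes p"
  shows "P x (mem c tr)" "step_count tr \<le> a" "call_count tr \<le> b" "high c tr \<le> h"
  using assms unfolding exec_def by auto

lemma exec_nonempty: "exec c p P a b h \<Longrightarrow> outcomes p \<noteq> {}"
  by (simp add: exec_def)

lemma exec_weaken:
  assumes "exec c p P a b h" "\<And>x c'. P x c' \<Longrightarrow> c' \<le> h \<Longrightarrow> Q x c'" "a \<le> a'" "b \<le> b'"
  shows "exec c p Q a' b' h"
  unfolding exec_def
proof (intro conjI ballI)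
  show "outcomes p \<noteq> {}" using assms(1) by (rule exec_nonempty)
  fix y assume "y \<in> outcomes p"
  then obtain x tr where y: "y = (x, tr)" "(x, tr) \<in> outcomes p" by (cases y) auto
  note D = execD[OF assms(1) y(2)]
  have "mem c tr \<le> h" using mem_le_high[of c tr] D(4) by simp
  then show "case y of (x, tr) \<Rightarrow>
      Q x (mem c tr) \<and> step_count tr \<le> a' \<and> call_count tr \<le> b' \<and> high c tr \<le> h"
    using D assms(2)[OF D(1)] assms(3,4) by (simp add: y)
qed

lemma outcomes_bind: "(y, tr) \<in> outcomes (bind_prog p f) \<longleftrightarrow>
    (\<exists>x t1 t2. tr = t1 @ t2 \<and> (x, t1) \<in> outcomes p \<and> (y, t2) \<in> outcomes (f x))"
  unfolding bind_prog_def by auto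

lemma exec_bind:
  assumes p: "exec c p P a1 b1 h"
    and f: "\<And>x c'. P x c' \<Longrightarrow> c' \<le> h \<Longrightarrow> exec c' (f x) Q a2 b2 h"
  shows "exec c (bind_prog p f) Q (a1 + a2) (b1 + b2) h"
  unfolding exec_def
proof (intro conjI ballI)
  have f': "exec (mem c tr) (f x) Q a2 b2 h" if "(x, tr) \<in> outcomes p" for x tr
    using f execD(1,4)[OF p that] mem_le_high[of c tr] by simp
  obtain x tr where x: "(x, tr) \<in> outcomes p" using exec_nonempty[OF p] by fastforce
  obtain y tr' where "(y, tr') \<in> outcomes (f x)" using exec_nonempty[OF f'[OF x]] by fastforce
  with x have "(y, tr @ tr') \<in> outcomes (bind_prog p f)" unfolding outcomes_bind by blast
  then show "outcomes (bind_prog p f) \<noteq> {}" by blast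
  fix z assume "z \<in> outcomes (bind_prog p f)"
  then obtain x t1 y t2 where z: "z = (y, t1 @ t2)" "(x, t1) \<in> outcomes p" "(y, t2) \<in> outcomes (f x)"
    by (cases z) (auto simp: outcomes_bind)
  show "case z of (x, tr) \<Rightarrow> Q x (mem c tr) \<and> step_count tr \<le> a1 + a2 \<and>
      call_count tr \<le> b1 + b2 \<and> high c tr \<le> h"
    using execD[OF p z(2)] execD[OF f'[OF z(2)] z(3)] by (simp add: z(1))
qed

lemma exec_return: "P x c \<Longrightarrow> c \<le> h \<Longrightarrow> exec c (return x) P 0 0 h"
  by (simp add: exec_def return_def)

lemma exec_select: "A \<noteq> {} \<Longrightarrow> c \<le> h \<Longrightarrow> exec c (select A) (\<lambda>x c'. x \<in> A \<and> c' = c) 0 0 h"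
  by (auto simp: exec_def select_def)

lemma exec_call: "c \<le> h \<Longrightarrow> exec c (call \<omega>u H) (\<lambda>x c'. x = \<omega>u H \<and> c' = c) 0 1 h"
  by (auto simp: exec_def call_def)

lemma exec_start_le: "exec c p P a b h \<Longrightarrow> c \<le> h"
  unfolding exec_def using le_high order_trans by fastforce

lemma exec_tick:
  assumes "exec c (f ()) P a b h"
  shows "exec c (bind_prog (tick n) f) P (n + a) b h"
proof -
  have "exec c (tick n) (\<lambda>_ c'. c' = c) n 0 h"
    using exec_start_le[OF assms] by (simp add: exec_def tick_def)
  from exec_bind[OF this, of f P a b] show ?thesis using assms by simp
qed

lemma exec_alloc: "exec (c + n) (f ()) P a b h \<Longrightarrow> exec c (bind_prog (alloc n) f) P a b h"
  unfolding exec_def alloc_def bind_prog_def by auto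

lemma exec_free: "c \<le> h \<Longrightarrow> exec (c - n) (f ()) P a b h \<Longrightarrow> exec c (bind_prog (free n) f) P a b h"
  unfolding exec_def free_def bind_prog_def by auto

lemma exec_with_local:
  assumes "exec c p (\<lambda>S c'. S = S0 \<and> c' = c + card S0) a1 b1 h"
    and "exec (c + card S0) (f S0) (\<lambda>x c'. P x (c' - card S0)) a2 b2 h"
  shows "exec c (with_local p f) P (a1 + a2) (b1 + b2) h"
  unfolding with_local_def
proof (rule exec_bind[OF assms(1)])
  fix S c' assume S: "S = S0 \<and> c' = c + card S0"
  have "exec (c + card S0) (bind_prog (f S0) (\<lambda>x. bind_prog (free (card S0)) (\<lambda>_. return x)))
      P (a2 + 0) (b2 + 0) h"
    by (rule exec_bind[OF assms(2)]) (auto intro!: exec_free exec_return)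
  then show "exec c' (bind_prog (f S) (\<lambda>x. bind_prog (free (card S)) (\<lambda>_. return x))) P a2 b2 h"
    using S by simp
qed

text \<open>
  The invariant speaks about the set of elements already treated, since their order is arbitrary.
  Each pass runs with one more cell in use, which holds the current element.
\<close>

lemma exec_foreach:
  assumes A: "finite A" and init: "I {} s c" and c: "c \<le> h"
    and step: "\<And>X x s c. X \<subseteq> A \<Longrightarrow> x \<in> A \<Longrightarrow> x \<notin> X \<Longrightarrow> I X s c \<Longrightarrow>
      exec (c + 1) (f x s) (\<lambda>s' c'. I (insert x X) s' (c' - 1)) (a x) (b x) h"
  shows "exec c (foreach A f s) (I A) (\<Sum>x\<in>A. 1 + a x) (\<Sum>x\<in>A. b x) h"
proof -
  have list: "exec c (foreach_list f xs s) (I (X \<union> set xs)) (\<Sum>x\<in>set xs. 1 + a x) (\<Sum>x\<in>set xs. b x) h"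
    if "distinct xs" "X \<inter> set xs = {}" "X \<union> set xs \<subseteq> A" "I X s c" "c \<le> h" for xs X s c
    using that
  proof (induction xs arbitrary: X s c)
    case Nil
    then show ?case by (simp add: exec_return)
  next
    case (Cons x xs)
    let ?p = "bind_prog (f x s) (\<lambda>s'. bind_prog (free 1) (\<lambda>_. foreach_list f xs s'))"
    have "exec (c + 1) ?p (I (X \<union> set (x # xs)))
        (a x + (\<Sum>x\<in>set xs. 1 + a x)) (b x + (\<Sum>x\<in>set xs. b x)) h"
    proof (rule exec_bind)
      show "exec (c + 1) (f x s) (\<lambda>s' c'. I (insert x X) s' (c' - 1)) (a x) (b x) h"
        using Cons.prems by (intro step) auto
      fix s' c' assume inv: "I (insert x X) s' (c' - 1)" "c' \<le> h"
      have "exec (c' - 1) (foreach_list f xs s') (I (insert x X \<union> set xs))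
          (\<Sum>x\<in>set xs. 1 + a x) (\<Sum>x\<in>set xs. b x) h"
        using Cons.prems inv by (intro Cons.IH) auto
      then show "exec c' (bind_prog (free 1) (\<lambda>_. foreach_list f xs s')) (I (X \<union> set (x # xs)))
          (\<Sum>x\<in>set xs. 1 + a x) (\<Sum>x\<in>set xs. b x) h"
        using inv(2) by (intro exec_free) simp_all
    qed
    then have "exec c (foreach_list f (x # xs) s) (I (X \<union> set (x # xs)))
        (1 + (a x + (\<Sum>x\<in>set xs. 1 + a x))) (b x + (\<Sum>x\<in>set xs. b x)) h"
      unfolding foreach_list.simps by (intro exec_tick exec_alloc)
    then show ?case using Cons.prems(1) by (simp add: add.assoc)
  qed
  have "exec c (foreach A f s) (I A) (0 + (\<Sum>x\<in>A. 1 + a x)) (0 + (\<Sum>x\<in>A. b x)) h"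
    unfolding foreach_def
  proof (rule exec_bind[OF exec_select[OF _ c]])
    show "{xs. distinct xs \<and> set xs = A} \<noteq> {}" using finite_distinct_list[OF A] by auto
    fix xs c' assume "xs \<in> {xs. distinct xs \<and> set xs = A} \<and> c' = c"
    then show "exec c' (foreach_list f xs s) (I A) (\<Sum>x\<in>A. 1 + a x) (\<Sum>x\<in>A. b x) h"
      using list[of xs "{}" s c] init c by auto
  qed
  then show ?thesis by simp
qed

section \<open>Resources of the components\<close>

lemma exec_intersect:
  assumes "c + card (A \<inter> T) \<le> h"
  shows "exec c (intersect A T) (\<lambda>S c'. S = A \<inter> T \<and> c' = c + card (A \<inter> T)) (1 + card A) 0 h"
proof -
  have "exec c (intersect A T) (\<lambda>S c'. S = A \<inter> T \<and> c' = c + card (A \<inter> T)) (1 + card A + 0) 0 h"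
    unfolding intersect_def using assms by (intro exec_tick exec_alloc exec_return) auto
  then show ?thesis by simp
qed

lemma exec_common_nbrs:
  assumes "c + card (W G {u, v}) \<le> h"
  shows "exec c (common_nbrs G u v) (\<lambda>S c'. S = W G {u, v} \<and> c' = c + card (W G {u, v}))
    (1 + min_degree G {u, v}) 0 h"
proof (cases "card (nbrs G u) \<le> card (nbrs G v)")
  case True
  then show ?thesis
    using exec_intersect[of c "nbrs G u" "nbrs G v" h] assms
    by (simp add: common_nbrs_def W_pair min_degree_pair)
next
  case False
  then show ?thesis
    using exec_intersect[of c "nbrs G v" "nbrs G u" h] assms
    by (simp add: common_nbrs_def W_pair min_degree_pair Int_commute)
qed

text \<open>
  Per vertex, a level takes one step for the pass and \<open>2 + card U + card B\<close> steps for two scans,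
  in total at most \<open>3 * (1 + card U)\<close>. It stores the two resulting sets and the vertex.
\<close>

lemma exec_c_rec_prog:
  assumes "finite U" "B \<subseteq> U" "c + r * (2 * card U + 1) \<le> h"
  shows "exec c (c_rec_prog k d \<omega>u G r U B)
    (\<lambda>x c'. (x \<longleftrightarrow> (\<exists>R\<in>cliques_in G r B. k - d \<le> \<omega>u (induced G (U \<inter> W G R)))) \<and> c' \<le> c)
    (3 * scan_cost G (Suc r) U) (scan_cost G r U) h"
  using assms
proof (induction r arbitrary: U B c)
  case 0
  have "exec c (c_rec_prog k d \<omega>u G 0 U B) (\<lambda>x c'. (x \<longleftrightarrow> k - d \<le> \<omega>u (induced G U)) \<and> c' \<le> c)
      (0 + (1 + 0)) (1 + 0) h"
    unfolding c_rec_prog.simps using 0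
    by (intro exec_bind[OF exec_call] exec_tick exec_return) auto
  then show ?case by (rule exec_weaken) auto
next
  case (Suc r)
  let ?U = "\<lambda>v. U \<inter> nbrs G v" and ?B = "\<lambda>v. B \<inter> nbrs_above G v"
  let ?found = "\<lambda>v. \<exists>R\<in>cliques_in G r (?B v). k - d \<le> \<omega>u (induced G (?U v \<inter> W G R))"
  let ?a = "\<lambda>v. (1 + card U) + ((1 + card B) + 3 * scan_cost G (Suc r) (?U v))"
  have finB: "finite B" using Suc.prems finite_subset by blast
  have "exec c (c_rec_prog k d \<omega>u G (Suc r) U B) (\<lambda>x c'. (x \<longleftrightarrow> (\<exists>v\<in>B. ?found v)) \<and> c' \<le> c)
      (\<Sum>v\<in>B. 1 + ?a v) (\<Sum>v\<in>B. scan_cost G r (?U v)) h"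
    unfolding c_rec_prog.simps
  proof (rule exec_foreach[OF finB, where I = "\<lambda>X x c'. (x \<longleftrightarrow> (\<exists>v\<in>X. ?found v)) \<and> c' \<le> c"])
    show "c \<le> h" using Suc.prems by simp
    fix X v b c1 assume v: "v \<in> B" and inv: "(b \<longleftrightarrow> (\<exists>v\<in>X. ?found v)) \<and> c1 \<le> c"
    have sub: "card (?U v) \<le> card U" "card (?B v) \<le> card (?U v)" "?B v \<subseteq> ?U v" "finite (?U v)"
      using Suc.prems by (auto intro!: card_mono simp: nbrs_above_def)
    have room: "c1 + 1 + card (?U v) + card (?B v) + r * (2 * card (?U v) + 1) \<le> h"
    proof -
      have "r * (2 * card (?U v) + 1) \<le> r * (2 * card U + 1)" using sub by simp
      moreover have "c + (2 * card U + 1) + r * (2 * card U + 1) \<le> h" using Suc.prems(3) by simp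
      ultimately show ?thesis using sub inv by linarith
    qed
    let ?pass = "with_local (intersect U (nbrs G v)) (\<lambda>U'.
        with_local (intersect B (nbrs_above G v)) (\<lambda>B'.
          bind_prog (c_rec_prog k d \<omega>u G r U' B') (\<lambda>x. return (b \<or> x))))"
    let ?post = "\<lambda>x c'. (x \<longleftrightarrow> (\<exists>v\<in>insert v X. ?found v)) \<and> c' - 1 \<le> c"
    have "exec (c1 + 1 + card (?U v) + card (?B v)) (bind_prog (c_rec_prog k d \<omega>u G r (?U v) (?B v))
        (\<lambda>x. return (b \<or> x)))
        (\<lambda>x c'. (x \<longleftrightarrow> (\<exists>v\<in>insert v X. ?found v)) \<and> c' - card (?B v) - card (?U v) - 1 \<le> c)
        (3 * scan_cost G (Suc r) (?U v) + 0) (scan_cost G r (?U v) + 0) h"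
      by (rule exec_bind[OF Suc.IH]) (use sub room inv in \<open>auto intro!: exec_return\<close>)
    then have "exec (c1 + 1) ?pass ?post (?a v) (0 + (0 + scan_cost G r (?U v))) h"
      using room by (intro exec_with_local[OF exec_intersect]) auto
    then show "exec (c1 + 1) ?pass ?post (?a v) (scan_cost G r (?U v)) h"
      by simp
  qed simp
  then show ?case
  proof (rule exec_weaken)
    have "card B \<le> card U" using Suc.prems by (intro card_mono)
    then have "(\<Sum>v\<in>B. 1 + ?a v) \<le> (\<Sum>v\<in>B. 3 * (1 + card U + scan_cost G (Suc r) (?U v)))"
      by (intro sum_mono) simp
    also have "\<dots> \<le> (\<Sum>v\<in>U. 3 * (1 + card U + scan_cost G (Suc r) (?U v)))"
      using Suc.prems by (intro sum_mono2) auto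
    finally show "(\<Sum>v\<in>B. 1 + ?a v) \<le> 3 * scan_cost G (Suc (Suc r)) U"
      by (simp only: scan_cost.simps sum_distrib_left)
    have "(\<Sum>v\<in>B. scan_cost G r (?U v)) \<le> (\<Sum>v\<in>U. scan_cost G r (?U v))"
      using Suc.prems by (intro sum_mono2) auto
    then show "(\<Sum>v\<in>B. scan_cost G r (?U v)) \<le> scan_cost G (Suc r) U"
      using sum_scan_cost_le[of G r U] by simp
  qed (auto simp: cliques_in_Suc W_insert Int_assoc)
qed

text \<open>
  The invariant again speaks about the set of cliques already treated. The common memory bound
  \<open>M\<close> leaves room for the candidate set and the current vertex of every level.
\<close>

lemma exec_foreach_clique:
  assumes "finite B" "c + r * (card B + 1) \<le> M" "M \<le> h" "I \<X> s"
    and "\<And>c. c + card B \<le> h \<Longrightarrow> exec c p (\<lambda>S c'. S = B \<and> c' = c + card B) cp 0 h"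
    and "\<And>\<Y> R' s c. R' \<in> cliques_in G r B \<Longrightarrow> I \<Y> s \<Longrightarrow> c \<le> M \<Longrightarrow>
      exec c (f (R \<union> R') s) (\<lambda>s' c'. I (insert (R \<union> R') \<Y>) s' \<and> c' \<le> c) l q h"
  shows "exec c (foreach_clique G r R p f s)
    (\<lambda>s' c'. I (\<X> \<union> (\<union>) R ` cliques_in G r B) s' \<and> c' \<le> c)
    (if r = 0 then l else cp + (l + 2) * scan_cost G r B) (q * scan_cost G r B) h"
  using assms
proof (induction r arbitrary: R p B \<X> s c cp)
  case 0
  then show ?case using "0.prems"(6)[of "{}" \<X> s c] by simp
next
  case (Suc r)
  let ?B = "\<lambda>v. B \<inter> nbrs_above G v"
  let ?a = "\<lambda>v. if r = 0 then l else 1 + card B + (l + 2) * scan_cost G r (?B v)"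
  let ?b = "\<lambda>v. q * scan_cost G r (?B v)"
  let ?done = "\<lambda>X. \<X> \<union> (\<Union>v\<in>X. (\<union>) (insert v R) ` cliques_in G r (?B v))"
  have Bv: "finite (?B v)" "card (?B v) \<le> card B" for v
    using Suc.prems(1) by (auto intro: card_mono)
  have loop: "exec (c + card B) (foreach B (\<lambda>v s.
        foreach_clique G r (insert v R) (intersect B (nbrs_above G v)) f s) s)
      (\<lambda>s' c'. I (?done B) s' \<and> c' \<le> c + card B) (\<Sum>v\<in>B. 1 + ?a v) (\<Sum>v\<in>B. ?b v) h"
  proof (rule exec_foreach[OF Suc.prems(1), where I = "\<lambda>X s' c'. I (?done X) s' \<and> c' \<le> c + card B"])
    show "c + card B \<le> h" using Suc.prems(2,3) by simp
    show "I (?done {}) s \<and> c + card B \<le> c + card B" using Suc.prems(4) by simp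
    fix X v s1 c1 assume v: "v \<in> B" and inv: "I (?done X) s1 \<and> c1 \<le> c + card B"
    have cl: "insert v R' \<in> cliques_in G (Suc r) B" if "R' \<in> cliques_in G r (?B v)" for R'
      using that v by (auto simp: cliques_in_Suc)
    have "exec (c1 + 1) (foreach_clique G r (insert v R) (intersect B (nbrs_above G v)) f s1)
        (\<lambda>s' c'. I (?done X \<union> (\<union>) (insert v R) ` cliques_in G r (?B v)) s' \<and> c' \<le> c1 + 1)
        (?a v) (?b v) h"
    proof (rule Suc.IH[OF Bv(1) _ Suc.prems(3) conjunct1[OF inv]])
      have "r * (card (?B v) + 1) \<le> r * (card B + 1)" using Bv(2)[of v] by simp
      moreover have "c + (card B + 1) + r * (card B + 1) \<le> M" using Suc.prems(2) by simp
      ultimately show "c1 + 1 + r * (card (?B v) + 1) \<le> M" using inv by linarith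
      fix c' assume "c' + card (?B v) \<le> h"
      then show "exec c' (intersect B (nbrs_above G v)) (\<lambda>S c''. S = ?B v \<and> c'' = c' + card (?B v))
          (1 + card B) 0 h" by (rule exec_intersect)
    next
      fix \<Y> R' s' c' assume "R' \<in> cliques_in G r (?B v)" "I \<Y> s'" "c' \<le> M"
      then show "exec c' (f (insert v R \<union> R') s')
          (\<lambda>s'' c''. I (insert (insert v R \<union> R') \<Y>) s'' \<and> c'' \<le> c') l q h"
        using Suc.prems(6)[OF cl] by simp
    qed
    then show "exec (c1 + 1) (foreach_clique G r (insert v R) (intersect B (nbrs_above G v)) f s1)
        (\<lambda>s' c'. I (?done (insert v X)) s' \<and> c' - 1 \<le> c + card B) (?a v) (?b v) h"
      by (rule exec_weaken) (use inv in \<open>auto simp: Un_ac\<close>)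
  qed
  have "exec c (foreach_clique G (Suc r) R p f s)
      (\<lambda>s' c'. I (?done B) s' \<and> c' \<le> c) (cp + (\<Sum>v\<in>B. 1 + ?a v)) (0 + (\<Sum>v\<in>B. ?b v)) h"
    unfolding foreach_clique.simps
    by (rule exec_with_local[OF Suc.prems(5)])
      (use Suc.prems(2,3) in \<open>simp, auto intro: exec_weaken[OF loop]\<close>)
  then show ?case
  proof (rule exec_weaken)
    have eq: "?done B = \<X> \<union> (\<union>) R ` cliques_in G (Suc r) B"
      by (auto simp: cliques_in_Suc image_UN image_image)
    show "I (\<X> \<union> (\<union>) R ` cliques_in G (Suc r) B) s' \<and> c' \<le> c"
      if "I (?done B) s' \<and> c' \<le> c" for s' c'
      using that unfolding eq .
    have le: "scan_cost G r (?B v) \<le> scan_cost G r (B \<inter> nbrs G v)" for v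
      using Suc.prems(1) nbrs_above_subset by (intro scan_cost_mono) auto
    have "(\<Sum>v\<in>B. 1 + ?a v) \<le> (l + 2) * scan_cost G (Suc r) B"
    proof (cases r)
      case 0
      then show ?thesis by (simp add: mult.commute[of "card B"])
    next
      case (Suc r')
      have "(\<Sum>v\<in>B. 1 + ?a v) \<le> (\<Sum>v\<in>B. (l + 2) * (1 + card B + scan_cost G r (B \<inter> nbrs G v)))"
      proof (rule sum_mono)
        fix v
        have "2 + card B \<le> (l + 2) * (1 + card B)" by (simp add: algebra_simps)
        moreover have "(l + 2) * scan_cost G r (?B v) \<le> (l + 2) * scan_cost G r (B \<inter> nbrs G v)"
          using le by (rule mult_le_mono2)
        moreover have "(l + 2) * (1 + card B + scan_cost G r (B \<inter> nbrs G v)) =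
            (l + 2) * (1 + card B) + (l + 2) * scan_cost G r (B \<inter> nbrs G v)"
          by (rule distrib_left)
        ultimately show "1 + ?a v \<le> (l + 2) * (1 + card B + scan_cost G r (B \<inter> nbrs G v))"
          using Suc by simp
      qed
      then show ?thesis unfolding Suc by (simp only: scan_cost.simps sum_distrib_left)
    qed
    then show "cp + (\<Sum>v\<in>B. 1 + ?a v) \<le>
        (if Suc r = 0 then l else cp + (l + 2) * scan_cost G (Suc r) B)" by simp
    have "(\<Sum>v\<in>B. ?b v) \<le> (\<Sum>v\<in>B. q * scan_cost G r (B \<inter> nbrs G v))"
      using le by (intro sum_mono mult_le_mono2)
    also have "\<dots> \<le> q * scan_cost G (Suc r) B"
      unfolding sum_distrib_left[symmetric] by (intro mult_le_mono2 sum_scan_cost_le)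
    finally show "0 + (\<Sum>v\<in>B. ?b v) \<le> q * scan_cost G (Suc r) B" by simp
  qed
qed

lemma exec_enqueue:
  assumes "finite Q" "c \<le> base + card Q" "base + card (insert e Q) \<le> h"
  shows "exec c (enqueue e Q) (\<lambda>Q' c'. Q' = insert e Q \<and> c' \<le> base + card Q') 1 0 h"
proof -
  have "exec c (enqueue e Q) (\<lambda>Q' c'. Q' = insert e Q \<and> c' \<le> base + card Q') (1 + 0) 0 h"
    unfolding enqueue_def using assms
    by (intro exec_tick exec_alloc exec_return) (auto simp: card_insert_if split: if_splits)
  then show ?thesis by simp
qed

text \<open>
  Memory is charged to the queue: it stays below a fixed base plus the number of queued edges.
\<close>

lemma exec_requeue:
  assumes G: "simple_graph G" and e: "{u, v} \<in> edges G" and Q: "Q \<subseteq> edges G"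
    and c: "c \<le> base + card Q" and h: "base + 3 * card (edges G) + 2 \<le> h"
  shows "exec c (requeue d \<omega>u G u v Q)
    (\<lambda>Q' c'. Q' = Q \<union> requeued d \<omega>u G u v \<and> c' \<le> base + card Q')
    (1 + min_degree G {u, v} + 3 * card (W G {u, v}) +
      (if 0 < d \<or> edge_sensitive \<omega>u then card (W G {u, v}) * (2 + 3 * card (W G {u, v})) else 0)) 0 h"
proof -
  let ?S = "W G {u, v}" and ?m = "card (edges G)"
  let ?inner = "0 < d \<or> edge_sensitive \<omega>u"
  let ?outer = "\<lambda>X. {{w, u} |w. w \<in> X} \<union> {{w, v} |w. w \<in> X}"
  let ?in = "\<lambda>X. {{w1, w2} |w1 w2. w1 \<in> X \<and> w2 \<in> ?S \<inter> nbrs G w1}"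
  let ?post = "\<lambda>Q' c'. Q' = Q \<union> requeued d \<omega>u G u v \<and> c' \<le> base + card ?S + card Q'"
  let ?outer_loop = "foreach ?S (\<lambda>w Q. bind_prog (enqueue {w, u} Q) (enqueue {w, v})) Q"
  let ?inner_loop = "foreach ?S (\<lambda>w1 Q. with_local (intersect ?S (nbrs G w1)) (\<lambda>T.
      foreach T (\<lambda>w2 Q. enqueue {w1, w2} Q) Q))"
  note S = card_W_edge_le(2,3)[OF G e]
  have fin: "finite (edges G)" by (rule finite_edges[OF G])
  have small: "finite Q' \<and> card Q' \<le> ?m" if "Q' \<subseteq> edges G" for Q'
    using that fin by (auto intro: card_mono finite_subset)
  have Sedges: "{w, u} \<in> edges G" "{w, v} \<in> edges G" if "w \<in> ?S" for w
    using that by (auto simp: W_pair in_nbrs_iff)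
  have step1: "exec (c + card ?S) ?outer_loop
      (\<lambda>Q' c'. Q' = Q \<union> ?outer ?S \<and> c' \<le> base + card ?S + card Q')
      (\<Sum>w\<in>?S. 1 + (1 + 1)) (\<Sum>w\<in>?S. 0 + 0) h"
  proof (rule exec_foreach[OF S(2),
        where I = "\<lambda>X Q' c'. Q' = Q \<union> ?outer X \<and> c' \<le> base + card ?S + card Q'"])
    show "c + card ?S \<le> h" using c h S small[OF Q] by linarith
    show "Q = Q \<union> ?outer {} \<and> c + card ?S \<le> base + card ?S + card Q" using c by auto
    fix X w Q1 c1
    assume X: "X \<subseteq> ?S" and w: "w \<in> ?S" and inv: "Q1 = Q \<union> ?outer X \<and> c1 \<le> base + card ?S + card Q1"
    have Q1: "insert {w, v} (insert {w, u} Q1) \<subseteq> edges G" using inv Q X w Sedges by blast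
    have sz: "finite Q1" "card (insert {w, u} Q1) \<le> ?m" "card (insert {w, v} (insert {w, u} Q1)) \<le> ?m"
      using small[of Q1] small[of "insert {w, u} Q1"] small[OF Q1] Q1 by auto
    have "exec (c1 + 1) (bind_prog (enqueue {w, u} Q1) (enqueue {w, v}))
        (\<lambda>Q' c'. Q' = insert {w, v} (insert {w, u} Q1) \<and> c' \<le> base + card ?S + 1 + card Q') (1 + 1) (0 + 0) h"
    proof (rule exec_bind[OF exec_enqueue[where base = "base + card ?S + 1"]])
      fix Q2 c2 assume "Q2 = insert {w, u} Q1 \<and> c2 \<le> base + card ?S + 1 + card Q2"
      then show "exec c2 (enqueue {w, v} Q2) (\<lambda>Q' c'. Q' = insert {w, v} (insert {w, u} Q1) \<and>
          c' \<le> base + card ?S + 1 + card Q') 1 0 h"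
        using sz S h by (intro exec_weaken[OF exec_enqueue[where base = "base + card ?S + 1"]]) auto
    qed (use sz S h inv in auto)
    then show "exec (c1 + 1) (bind_prog (enqueue {w, u} Q1) (enqueue {w, v}))
        (\<lambda>Q' c'. Q' = Q \<union> ?outer (insert w X) \<and> c' - 1 \<le> base + card ?S + card Q') (1 + 1) (0 + 0) h"
      by (rule exec_weaken) (use inv in auto)
  qed
  have step2: "exec c1 (?inner_loop Q1)
      (\<lambda>Q' c'. Q' = Q1 \<union> ?in ?S \<and> c' \<le> base + card ?S + card Q')
      (\<Sum>w\<in>?S. 1 + (1 + card ?S + 2 * card ?S)) (\<Sum>w\<in>?S. 0 + 0) h"
    if Q1: "Q1 \<subseteq> edges G" and c1: "c1 \<le> base + card ?S + card Q1" for Q1 c1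
  proof (rule exec_foreach[OF S(2),
        where I = "\<lambda>X Q' c'. Q' = Q1 \<union> ?in X \<and> c' \<le> base + card ?S + card Q'"])
    show "c1 \<le> h" using c1 h S small[OF Q1] by linarith
    show "Q1 = Q1 \<union> ?in {} \<and> c1 \<le> base + card ?S + card Q1" using c1 by auto
    fix X w Q2 c2
    assume X: "X \<subseteq> ?S" and w: "w \<in> ?S" and inv: "Q2 = Q1 \<union> ?in X \<and> c2 \<le> base + card ?S + card Q2"
    let ?T = "?S \<inter> nbrs G w"
    let ?pass = "with_local (intersect ?S (nbrs G w)) (\<lambda>T.
        foreach T (\<lambda>w2 Q. enqueue {w, w2} Q) Q2)"
    have T: "finite ?T" "card ?T \<le> card ?S" using S by (auto intro: card_mono)
    have in_edges: "?in ?S \<subseteq> edges G" by (auto simp: in_nbrs_iff insert_commute)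
    have Q2: "Q2 \<subseteq> edges G" using inv Q1 X in_edges by blast
    have room: "c2 + 1 + card ?T \<le> h" using inv small[OF Q2] S T h by linarith
    have "exec (c2 + 1 + card ?T) (foreach ?T (\<lambda>w2 Q. enqueue {w, w2} Q) Q2)
        (\<lambda>Q' c'. Q' = Q2 \<union> {{w, w2} |w2. w2 \<in> ?T} \<and> c' \<le> base + card ?S + 1 + card ?T + card Q')
        (\<Sum>w2\<in>?T. 1 + 1) (\<Sum>w2\<in>?T. 0) h"
    proof (rule exec_foreach[OF T(1) _ room, where I = "\<lambda>Y Q' c'.
          Q' = Q2 \<union> {{w, w2} |w2. w2 \<in> Y} \<and> c' \<le> base + card ?S + 1 + card ?T + card Q'"])
      show "Q2 = Q2 \<union> {{w, w2} |w2. w2 \<in> {}} \<and> c2 + 1 + card ?T \<le> base + card ?S + 1 + card ?T + card Q2"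
        using inv by auto
      fix Y w2 Q3 c3 assume Y: "Y \<subseteq> ?T" "w2 \<in> ?T" and
        inv3: "Q3 = Q2 \<union> {{w, w2} |w2. w2 \<in> Y} \<and> c3 \<le> base + card ?S + 1 + card ?T + card Q3"
      have "insert {w, w2} Q3 \<subseteq> edges G" using inv3 Y Q2 w in_edges by blast
      then have sz: "finite Q3" "card (insert {w, w2} Q3) \<le> ?m"
        using small[of "insert {w, w2} Q3"] by auto
      have eq: "insert {w, w2} Q3 = Q2 \<union> {{w, x} |x. x \<in> insert w2 Y}" using inv3 by blast
      show "exec (c3 + 1) (enqueue {w, w2} Q3) (\<lambda>Q' c'. Q' = Q2 \<union> {{w, x} |x. x \<in> insert w2 Y} \<and>
          c' - 1 \<le> base + card ?S + 1 + card ?T + card Q') 1 0 h"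
        unfolding eq[symmetric]
        by (rule exec_weaken[OF exec_enqueue[where base = "base + card ?S + 2 + card ?T"]])
          (use sz inv3 S T h in auto)
    qed
    then have "exec (c2 + 1) ?pass
        (\<lambda>Q' c'. Q' = Q2 \<union> {{w, w2} |w2. w2 \<in> ?T} \<and> c' \<le> base + card ?S + 1 + card Q')
        (1 + card ?S + (\<Sum>w2\<in>?T. 1 + 1)) (0 + (\<Sum>w2\<in>?T. 0)) h"
      using room by (intro exec_with_local[OF exec_intersect]) (auto elim!: exec_weaken)
    moreover have "Q2 \<union> {{w, w2} |w2. w2 \<in> ?T} = Q1 \<union> ?in (insert w X)" using inv by blast
    ultimately show "exec (c2 + 1) ?pass
        (\<lambda>Q' c'. Q' = Q1 \<union> ?in (insert w X) \<and> c' - 1 \<le> base + card ?S + card Q')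
        (1 + card ?S + 2 * card ?S) (0 + 0) h"
      using T(2) by (auto elim!: exec_weaken)
  qed
  have outer_edges: "Q \<union> ?outer ?S \<subseteq> edges G" using Q Sedges by blast
  have requeued: "requeued d \<omega>u G u v = ?outer ?S \<union> (if ?inner then ?in ?S else {})"
    unfolding requeued_def Let_def W_pair by simp
  have "exec (c + card ?S) (bind_prog ?outer_loop
      (\<lambda>Q1. if ?inner then ?inner_loop Q1 else return Q1))
      ?post
      (3 * card ?S + (if ?inner then card ?S * (2 + 3 * card ?S) else 0)) (0 + 0) h"
  proof (rule exec_bind)
    show "exec (c + card ?S) ?outer_loop
      (\<lambda>Q' c'. Q' = Q \<union> ?outer ?S \<and> c' \<le> base + card ?S + card Q') (3 * card ?S) 0 h"
      by (rule exec_weaken[OF step1]) auto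
    fix Q1 c1 assume Q1: "Q1 = Q \<union> ?outer ?S \<and> c1 \<le> base + card ?S + card Q1" "c1 \<le> h"
    show "exec c1 (if ?inner then ?inner_loop Q1 else return Q1)
      ?post
      (if ?inner then card ?S * (2 + 3 * card ?S) else 0) 0 h"
    proof (cases ?inner)
      case True
      have "exec c1 (?inner_loop Q1)
        ?post
        (card ?S * (2 + 3 * card ?S)) 0 h"
      proof (rule exec_weaken[OF step2])
        show "Q' = Q \<union> requeued d \<omega>u G u v \<and> c' \<le> base + card ?S + card Q'"
          if "Q' = Q1 \<union> ?in ?S \<and> c' \<le> base + card ?S + card Q'" for Q' c'
        proof -
          have "Q1 \<union> ?in ?S = Q \<union> requeued d \<omega>u G u v"
            using Q1 True by (simp add: requeued Un_assoc)
          then show ?thesis using that by metis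
        qed
      qed (use Q1 outer_edges in auto)
      then show ?thesis using True by simp
    next
      case False
      then have "Q1 = Q \<union> requeued d \<omega>u G u v" using Q1 False unfolding requeued by simp
      then show ?thesis using Q1 False by (auto intro!: exec_return)
    qed
  qed
  then have "exec c (requeue d \<omega>u G u v Q)
    (\<lambda>Q' c'. Q' = Q \<union> requeued d \<omega>u G u v \<and> c' \<le> base + card Q')
    (1 + min_degree G {u, v} + (3 * card ?S +
      (if ?inner then card ?S * (2 + 3 * card ?S) else 0))) (0 + (0 + 0)) h"
    unfolding requeue_def using c h S small[OF Q]
    by (intro exec_with_local[OF exec_common_nbrs]) (auto elim!: exec_weaken)
  then show ?thesis by (simp add: add.assoc)
qed

section \<open>Amortized analysis of the peeling loop\<close>

text \<open>
  What remains to be charged for checks, at price \<open>g\<close> each: the queued edges, and for every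
  edge that can still be deleted, those that its deletion puts back into the queue.
\<close>

definition potential ::
    "bool \<Rightarrow> graph \<Rightarrow> (nat set \<Rightarrow> nat) \<Rightarrow> graph \<Rightarrow> nat set set \<Rightarrow> nat" where
  "potential inner G g H Q = (\<Sum>e\<in>Q. g e) + (\<Sum>e\<in>edges H. \<Sum>f\<in>requeued_by inner G e. g f)"

lemma potential_keep:
  assumes "finite Q" "e \<in> Q"
  shows "g e + potential inner G g H (Q - {e}) = potential inner G g H Q"
  using assms by (simp add: potential_def sum.remove)

text \<open>The share of the deleted edge pays for all edges that its deletion puts back.\<close>

lemma potential_peel:
  assumes G: "simple_graph G" and H: "edges H \<subseteq> edges G" "Q \<subseteq> edges H" and e: "{u, v} \<in> Q"
  shows "g {u, v} + potential inner G g (delete_edge H u v) (Q - {{u, v}} \<union> requeued_by inner H {u, v})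
    \<le> potential inner G g H Q"
proof -
  let ?e = "{u, v}" and ?R = "requeued_by inner G"
  have fin: "finite (edges H)" "finite Q" "finite (?R ?e)"
    using finite_edges[OF G] H requeued_by_edges[OF G, of ?e inner] e
    by (auto intro: finite_subset rev_finite_subset)
  have sub: "requeued_by inner H ?e \<subseteq> ?R ?e" using requeued_by_mono[OF H(1)] .
  have "(\<Sum>f\<in>Q - {?e} \<union> requeued_by inner H ?e. g f) \<le> (\<Sum>f\<in>Q - {?e} \<union> ?R ?e. g f)"
    using fin sub by (intro sum_mono2) auto
  also have "\<dots> \<le> (\<Sum>f\<in>Q - {?e}. g f) + (\<Sum>f\<in>?R ?e. g f)"
    using fin by (simp add: sum_Un_nat)
  finally have "g ?e + (\<Sum>f\<in>Q - {?e} \<union> requeued_by inner H ?e. g f) \<le>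
      (\<Sum>f\<in>Q. g f) + (\<Sum>f\<in>?R ?e. g f)"
    using fin e by (simp add: sum.remove)
  moreover have "(\<Sum>e\<in>edges H. \<Sum>f\<in>?R e. g f) =
      (\<Sum>f\<in>?R ?e. g f) + (\<Sum>e\<in>edges H - {?e}. \<Sum>f\<in>?R e. g f)"
    using fin e H by (intro sum.remove) auto
  ultimately show ?thesis by (simp add: potential_def)
qed

text \<open>
  Both implementations have this form: \<open>treat\<close> checks an edge that was removed from the queue
  and deletes it if necessary. A check takes at most \<open>check e\<close> steps and \<open>num_calls e\<close> calls, a
  deletion at most \<open>delete e\<close> steps; \<open>valid\<close> relates the additional data to the current graph.
\<close>

locale peeling_implementation =
  fixes k d :: nat and \<omega>u :: "graph \<Rightarrow> nat" and G :: graph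
    and valid :: "graph \<Rightarrow> 'x \<Rightarrow> bool"
    and treat :: "graph \<Rightarrow> 'x \<Rightarrow> nat \<Rightarrow> nat \<Rightarrow> nat set set \<Rightarrow> 'x state prog"
    and body :: "'x state \<Rightarrow> 'x state prog"
    and check num_calls delete :: "nat set \<Rightarrow> nat" and base h :: nat
  assumes simple: "simple_graph G"
    and room: "base + card (edges G) \<le> h"
    and body: "\<And>H Q x. body (H, Q, x) = do { ((u, v), Q1) \<leftarrow> pick Q; treat H x u v Q1 }"
    and treat_keep: "\<And>H x u v Q c. verts H = verts G \<Longrightarrow> edges H \<subseteq> edges G \<Longrightarrow> valid H x \<Longrightarrow>
      {u, v} \<in> edges H \<Longrightarrow> Q \<subseteq> edges H \<Longrightarrow> c \<le> base + card Q \<Longrightarrow> cond k d \<omega>u u v H \<Longrightarrow>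
      exec c (treat H x u v Q) (\<lambda>s c'. s = (H, Q, x) \<and> c' \<le> base + card Q)
        (check {u, v}) (num_calls {u, v}) h"
    and treat_peel: "\<And>H x u v Q c. verts H = verts G \<Longrightarrow> edges H \<subseteq> edges G \<Longrightarrow> valid H x \<Longrightarrow>
      {u, v} \<in> edges H \<Longrightarrow> Q \<subseteq> edges H \<Longrightarrow> c \<le> base + card Q \<Longrightarrow> \<not> cond k d \<omega>u u v H \<Longrightarrow>
      exec c (treat H x u v Q) (\<lambda>(H', Q', x') c'. H' = delete_edge H u v \<and>
          Q' = Q \<union> requeued d \<omega>u H u v \<and> valid H' x' \<and> c' \<le> base + card Q')
        (check {u, v} + delete {u, v}) (num_calls {u, v}) h"
begin

abbreviation "inner \<equiv> 0 < d \<or> edge_sensitive \<omega>u"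

definition sound :: "'x state \<Rightarrow> bool" where
  "sound s \<longleftrightarrow> peeling_invariant k d \<omega>u G (fst s, queue s) \<and> valid (fst s) (snd (snd s))"

text \<open>The numbers 2 count the loop test and the removal of the edge from the queue.\<close>

definition step_budget :: "'x state \<Rightarrow> nat" where
  "step_budget s = potential inner G (\<lambda>e. 2 + check e) (fst s) (queue s) + (\<Sum>e\<in>edges (fst s). delete e)"

definition call_budget :: "'x state \<Rightarrow> nat" where
  "call_budget s = potential inner G num_calls (fst s) (queue s)"

lemma outcomes_pick:
  "(x, tr) \<in> outcomes (pick Q) \<longleftrightarrow>
     (\<exists>u v. {u, v} \<in> Q \<and> x = ((u, v), Q - {{u, v}}) \<and> tr = [Step, Free 1])"
  unfolding pick_def select_def tick_def free_def return_def bind_prog_def by force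

text \<open>
  A pass is paid for by the drop of the budgets, and the memory in use stays within the base plus
  the size of the queue. The edge was chosen arbitrarily, so this covers all executions.
\<close>

lemma body_outcome:
  assumes sound: "sound s" and c: "c \<le> base + card (queue s)" and out: "(s', tr) \<in> outcomes (body s)"
  shows "truss_step k d \<omega>u (fst s, queue s) (fst s', queue s')" "sound s'"
    and "mem c tr \<le> base + card (queue s')" "high c tr \<le> h"
    and "1 + step_count tr + step_budget s' \<le> step_budget s"
    and "call_count tr + call_budget s' \<le> call_budget s"
proof -
  obtain H Q x where s: "s = (H, Q, x)" by (cases s) auto
  obtain u v t where e: "{u, v} \<in> Q" and tr: "tr = Step # Free 1 # t"
    and t: "(s', t) \<in> outcomes (treat H x u v (Q - {{u, v}}))"
    using out unfolding s body by (auto simp: outcomes_bind outcomes_pick)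
  have H: "verts H = verts G" "edges H \<subseteq> edges G" "Q \<subseteq> edges H" "valid H x"
    using sound by (auto simp: s sound_def queue_def peeling_invariant_def)
  note simple_H = simple_graph_spanning[OF simple H(1,2)]
  have fin: "finite (edges H)" "finite Q" using finite_edges[OF simple_H] H(3) finite_subset by auto
  have cardQ: "card Q = Suc (card (Q - {{u, v}}))" using card.remove[OF fin(2) e] .
  have c1: "c - 1 \<le> base + card (Q - {{u, v}})" using c cardQ by (simp add: s queue_def)
  have c_h: "c \<le> h" using c room card_mono[OF finite_edges[OF simple] order_trans[OF H(3,2)]] by (simp add: s queue_def)
  note pre = H(1,2,4) subsetD[OF H(3) e] order_trans[OF Diff_subset H(3)] c1
  have "truss_step k d \<omega>u (fst s, queue s) (fst s', queue s') \<and> sound s' \<and>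
      mem c tr \<le> base + card (queue s') \<and> high c tr \<le> h \<and>
      1 + step_count tr + step_budget s' \<le> step_budget s \<and>
      call_count tr + call_budget s' \<le> call_budget s"
  proof (cases "cond k d \<omega>u u v H")
    case True
    note D = execD[OF treat_keep[OF pre True] t]
    then have s': "s' = (H, Q - {{u, v}}, x)" by simp
    have step: "truss_step k d \<omega>u (H, Q) (H, Q - {{u, v}})" using e True by (rule truss_step.keep)
    note pot = potential_keep[OF fin(2) e, of _ inner G H]
    show ?thesis
      using step sound peeling_invariant_step[OF simple _ step] D c_h
        pot[of "\<lambda>e. 2 + check e"] pot[of num_calls]
      by (simp add: s s' tr queue_def sound_def step_budget_def call_budget_def)
  next
    case False
    note D = execD[OF treat_peel[OF pre False] t]
    then obtain x' where s': "s' = (delete_edge H u v, Q - {{u, v}} \<union> requeued d \<omega>u H u v, x')"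
      and x': "valid (delete_edge H u v) x'" by (cases s') auto
    have step: "truss_step k d \<omega>u (H, Q) (delete_edge H u v, Q - {{u, v}} \<union> requeued d \<omega>u H u v)"
      using e False by (rule truss_step.peel)
    note pot = potential_peel[OF simple H(2,3) e, of _ inner, folded requeued_eq[OF simple_H]]
    have "(\<Sum>f\<in>edges H. delete f) = delete {u, v} + (\<Sum>f\<in>edges H - {{u, v}}. delete f)"
      using fin e H by (intro sum.remove) auto
    then show ?thesis
      using step sound peeling_invariant_step[OF simple _ step] D c_h x'
        pot[of "\<lambda>e. 2 + check e"] pot[of num_calls]
      by (simp add: s s' tr queue_def sound_def step_budget_def call_budget_def)
  qed
  then show "truss_step k d \<omega>u (fst s, queue s) (fst s', queue s')" "sound s'"
    and "mem c tr \<le> base + card (queue s')" "high c tr \<le> h"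
    and "1 + step_count tr + step_budget s' \<le> step_budget s"
    and "call_count tr + call_budget s' \<le> call_budget s"
    by blast+
qed

lemma body_nonempty:
  assumes sound: "sound s" and ne: "queue s \<noteq> {}"
  shows "outcomes (body s) \<noteq> {}"
proof -
  obtain H Q x where s: "s = (H, Q, x)" by (cases s) auto
  have H: "verts H = verts G" "edges H \<subseteq> edges G" "Q \<subseteq> edges H" "valid H x"
    using sound by (auto simp: s sound_def queue_def peeling_invariant_def)
  obtain e where e: "e \<in> Q" using ne by (auto simp: s queue_def)
  then have "e \<in> edges H" using H by blast
  then obtain u v where uv: "e = {u, v}" by (rule edgeE[OF simple_graph_spanning[OF simple H(1,2)]])
  note pre = H(1,2,4) subsetD[OF H(3) e, unfolded uv] order_trans[OF Diff_subset H(3)]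
  have "outcomes (treat H x u v (Q - {e})) \<noteq> {}"
    using exec_nonempty[OF treat_keep[OF pre le0]] exec_nonempty[OF treat_peel[OF pre le0]] by blast
  then obtain s' t where "(s', t) \<in> outcomes (treat H x u v (Q - {{u, v}}))" using uv by auto
  moreover have "(((u, v), Q - {{u, v}}), [Step, Free 1]) \<in> outcomes (pick Q)"
    using e uv by (simp add: outcomes_pick)
  ultimately have "(s', [Step, Free 1] @ t) \<in> outcomes (body s)"
    unfolding s body outcomes_bind by (intro exI conjI) auto
  then show ?thesis by blast
qed

lemma loop_outcome:
  assumes "loop_run body s tr s'" "sound s" "c \<le> base + card (queue s)"
  shows "(truss_step k d \<omega>u)\<^sup>*\<^sup>* (fst s, queue s) (fst s', {})"
    and "step_count tr \<le> 1 + step_budget s" "call_count tr \<le> call_budget s" "high c tr \<le> h"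
proof (atomize(full), use assms in \<open>induction arbitrary: c rule: loop_run.induct\<close>)
  case (finished s)
  then show ?case using room by simp
next
  case (iterate s s' t1 t2 s'')
  note B = body_outcome[OF iterate.prems iterate.hyps(2)]
  note IH = iterate.IH[OF B(2,3)]
  show ?case
    using IH B 
      converse_rtranclp_into_rtranclp[of "truss_step k d \<omega>u", OF B(1), of "(fst s'', {})"]
    by simp
qed

lemma body_terminates:
  assumes "sound s"
  shows "terminates (\<lambda>s s'. \<exists>tr. (s', tr) \<in> outcomes (body s)) (\<lambda>s. queue s = {}) s"
proof -
  have "peeling_invariant k d \<omega>u G (fst s, queue s)" using assms by (simp add: sound_def)
  from peeling_terminates[OF simple this] assms show ?thesis
  proof (induction "(fst s, queue s)" arbitrary: s rule: terminates.induct)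
    case (1 s)
    note sound = 1(4)
    show "terminates (\<lambda>s s'. \<exists>tr. (s', tr) \<in> outcomes (body s)) (\<lambda>s. queue s = {}) s"
    proof (rule terminates.intros)
      assume "queue s \<noteq> {}"
      from body_nonempty[OF sound this] show "\<exists>s' tr. (s', tr) \<in> outcomes (body s)" by fastforce
    next
      fix s' assume ne: "queue s \<noteq> {}" and "\<exists>tr. (s', tr) \<in> outcomes (body s)"
      then obtain tr where tr: "(s', tr) \<in> outcomes (body s)" by blast
      note B = body_outcome[OF sound le0 tr]
      show "terminates (\<lambda>s s'. \<exists>tr. (s', tr) \<in> outcomes (body s)) (\<lambda>s. queue s = {}) s'"
        using 1(3)[OF _ B(1) B(2)] ne by simp
    qed
  qed
qed

lemma execute_outcome:
  assumes init: "exec 0 init (\<lambda>s c. fst s = G \<and> queue s = edges G \<and> valid G (snd (snd s)) \<and>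
      c \<le> base + card (edges G)) t0 0 h"
  shows "always_terminates init body"
    and "(G', tr) \<in> outcomes (execute init body) \<Longrightarrow> truss_output k d \<omega>u G G' \<and>
      step_count tr \<le> t0 + 1 + (\<Sum>e\<in>edges G. 2 + check e) + (\<Sum>e\<in>edges G. delete e) +
        (\<Sum>e\<in>edges G. \<Sum>f\<in>requeued_by inner G e. 2 + check f) \<and>
      call_count tr \<le> (\<Sum>e\<in>edges G. num_calls e) +
        (\<Sum>e\<in>edges G. \<Sum>f\<in>requeued_by inner G e. num_calls f) \<and>
      high 0 tr \<le> h"
      (is "_ \<Longrightarrow> ?R")
proof -
  have sound: "sound s" if "(s, t) \<in> outcomes init" for s t
    using execD(1)[OF init that] by (auto simp: sound_def peeling_invariant_def)
  show "always_terminates init body"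
    unfolding always_terminates_def using exec_nonempty[OF init] body_terminates sound by auto
  assume "(G', tr) \<in> outcomes (execute init body)"
  then obtain s s' t1 t2 where t1: "(s, t1) \<in> outcomes init" and t2: "loop_run body s t2 s'"
    and eq: "tr = t1 @ t2" "G' = fst s'"
    unfolding execute_def outcomes_bind by (auto simp: loop_def return_def)
  note I = execD[OF init t1]
  note L = loop_outcome[OF t2 sound[OF t1], of "mem 0 t1"]
  show ?R
    using I L by (auto simp: truss_output_def eq step_budget_def call_budget_def potential_def)
qed

end

section \<open>The implementation that recomputes common neighborhoods\<close>

abbreviation graph_cells :: "graph \<Rightarrow> nat" where
  "graph_cells G \<equiv> card (verts G) + 2 * card (edges G)"

lemma exec_load_graph:
  assumes "card (verts G) + 3 * card (edges G) \<le> h"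
  shows "exec 0 (load_graph G)
    (\<lambda>x c. x = (G, edges G) \<and> c = graph_cells G + card (edges G))
    (graph_cells G) 0 h"
proof -
  have "exec 0 (load_graph G)
      (\<lambda>x c. x = (G, edges G) \<and> c = graph_cells G + card (edges G))
      (card (verts G) + card (edges G) + (card (edges G) + 0)) 0 h"
    unfolding load_graph_def using assms by (intro exec_tick exec_alloc exec_return) auto
  then show ?thesis by (simp add: mult_2 add.assoc)
qed

lemma exec_remove_edge:
  assumes "c \<le> h"
  shows "exec c (remove_edge G u v) (\<lambda>H c'. H = delete_edge G u v \<and> c' \<le> c) 1 0 h"
proof -
  have "exec c (remove_edge G u v) (\<lambda>H c'. H = delete_edge G u v \<and> c' \<le> c) (1 + 0) 0 h"
    unfolding remove_edge_def using assms by (intro exec_tick exec_free exec_return) auto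
  then show ?thesis by simp
qed

definition requeue_cost :: "bool \<Rightarrow> graph \<Rightarrow> nat set \<Rightarrow> nat" where
  "requeue_cost inner G e = 1 + min_degree G e + 3 * card (W G e) +
     (if inner then card (W G e) * (2 + 3 * card (W G e)) else 0)"

lemma card_W_pair_mono:
  "simple_graph G \<Longrightarrow> edges H \<subseteq> edges G \<Longrightarrow> card (W H {u, v}) \<le> card (W G {u, v})"
  by (intro card_mono finite_W W_mono) auto

lemma scan_cost_pair_mono:
  "simple_graph G \<Longrightarrow> edges H \<subseteq> edges G \<Longrightarrow>
     edge_scan H r {u, v} \<le> edge_scan G r {u, v}"
  by (intro scan_cost_mono finite_W W_mono) auto

lemma requeue_cost_mono:
  assumes "simple_graph G" "edges H \<subseteq> edges G"
  shows "requeue_cost inner H {u, v} \<le> requeue_cost inner G {u, v}"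
  using min_degree_mono[OF assms, of u v] card_W_pair_mono[OF assms, of u v]
  unfolding requeue_cost_def by (auto intro!: add_mono mult_le_mono)

definition recompute_check :: "nat \<Rightarrow> graph \<Rightarrow> nat set \<Rightarrow> nat" where
  "recompute_check d G e = 1 + min_degree G e + 3 * edge_scan G (Suc d) e"

lemma exec_cond_recompute:
  assumes H: "simple_graph H" "{u, v} \<in> edges H" and h: "c + (2 * d + 1) * card (edges H) + d \<le> h"
  shows "exec c (cond_recompute k d \<omega>u u v H) (\<lambda>x c'. (x \<longleftrightarrow> cond k d \<omega>u u v H) \<and> c' \<le> c)
    (recompute_check d H {u, v}) (edge_scan H d {u, v}) h"
proof -
  let ?S = "W H {u, v}"
  note S = card_W_edge_le(2,3)[OF H]
  have room: "c + card ?S + d * (2 * card ?S + 1) \<le> h"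
  proof -
    have "(2 * d + 1) * card ?S \<le> (2 * d + 1) * card (edges H)" using S by (intro mult_le_mono2)
    then show ?thesis using h by (simp add: algebra_simps)
  qed
  have "exec c (cond_recompute k d \<omega>u u v H) (\<lambda>x c'. (x \<longleftrightarrow> cond k d \<omega>u u v H) \<and> c' \<le> c)
      (1 + min_degree H {u, v} + 3 * scan_cost H (Suc d) ?S) (0 + scan_cost H d ?S) h"
    unfolding cond_recompute_def
  proof (rule exec_with_local[OF exec_common_nbrs])
    show "exec (c + card ?S) (c_rec_prog k d \<omega>u H d ?S ?S)
        (\<lambda>x c'. (x \<longleftrightarrow> cond k d \<omega>u u v H) \<and> c' - card ?S \<le> c)
        (3 * scan_cost H (Suc d) ?S) (scan_cost H d ?S) h"
      unfolding cond_iff W_union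
      by (rule exec_weaken[OF exec_c_rec_prog[OF S(2) order_refl room]]) auto
  qed (use room in simp)
  then show ?thesis by (simp add: recompute_check_def)
qed

text \<open>
  Two cells hold the ends of the current edge; the rest of the memory beyond the graph and the
  queue is taken by the sets that a check or a requeueing keeps at one time.
\<close>

definition recompute_space :: "nat \<Rightarrow> graph \<Rightarrow> nat" where
  "recompute_space d G = card (verts G) + (2 * d + 8) * card (edges G) + d + 4"

definition treat_recompute ::
    "nat \<Rightarrow> nat \<Rightarrow> (graph \<Rightarrow> nat) \<Rightarrow> graph \<Rightarrow> unit \<Rightarrow> nat \<Rightarrow> nat \<Rightarrow> nat set set \<Rightarrow> unit state prog" where
  "treat_recompute k d \<omega>u H x u v Q =
     do { alloc 2;
          b \<leftarrow> cond_recompute k d \<omega>u u v H;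
          (H', Q') \<leftarrow>
            (if b then return (H, Q)
             else do { Q2 \<leftarrow> requeue d \<omega>u H u v Q;
                       H' \<leftarrow> remove_edge H u v;
                       return (H', Q2) });
          free 2;
          return (H', Q', ()) }"

lemma exec_treat_recompute:
  assumes G: "simple_graph G" and H: "verts H = verts G" "edges H \<subseteq> edges G"
    and e: "{u, v} \<in> edges H" and Q: "Q \<subseteq> edges H"
    and c: "c \<le> graph_cells G + card Q"
  shows "exec c (treat_recompute k d \<omega>u H x u v Q)
    (\<lambda>(H', Q', x') c'. c' \<le> graph_cells G + card Q' \<and>
      (if cond k d \<omega>u u v H then H' = H \<and> Q' = Q
       else H' = delete_edge H u v \<and> Q' = Q \<union> requeued d \<omega>u H u v))
    (recompute_check d G {u, v} + (if cond k d \<omega>u u v H then 0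
       else requeue_cost (0 < d \<or> edge_sensitive \<omega>u) G {u, v} + 1))
    (edge_scan G d {u, v}) (recompute_space d G)"
    (is "exec c _ ?P _ _ ?h")
proof -
  let ?base = "graph_cells G"
  let ?inner = "0 < d \<or> edge_sensitive \<omega>u"
  let ?b = "cond k d \<omega>u u v H"
  let ?peel = "do { Q2 \<leftarrow> requeue d \<omega>u H u v Q; H' \<leftarrow> remove_edge H u v; return (H', Q2) }"
  note simple_H = simple_graph_spanning[OF G H]
  note fin = finite_edges[OF G]
  have card: "card (edges H) \<le> card (edges G)" "card Q \<le> card (edges G)"
    using H Q fin by (auto intro: card_mono)
  have prod: "(2 * d + 1) * card (edges H) \<le> (2 * d + 1) * card (edges G)"
    using card by (intro mult_le_mono2)
  have room: "c + 2 + (2 * d + 1) * card (edges H) + d \<le> ?h"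
    using prod c card by (simp add: recompute_space_def algebra_simps)
  have h: "?base + 2 + 3 * card (edges H) + 2 \<le> ?h" "?base + 2 + card (edges G) \<le> ?h"
    using card by (auto simp: recompute_space_def algebra_simps)
  have update: "exec c' (if ?b then return (H, Q)
        else ?peel)
      (\<lambda>(H', Q') c'. c' \<le> ?base + 2 + card Q' \<and> (if ?b then H' = H \<and> Q' = Q
         else H' = delete_edge H u v \<and> Q' = Q \<union> requeued d \<omega>u H u v))
      (if ?b then 0 else requeue_cost ?inner H {u, v} + 1) 0 ?h" if c': "c' \<le> c + 2" for c'
  proof (cases ?b)
    case True
    then show ?thesis using c' c card h by (auto intro!: exec_return)
  next
    case False
    have "exec c' ?peel
      (\<lambda>(H', Q') c'. c' \<le> ?base + 2 + card Q' \<and>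
         H' = delete_edge H u v \<and> Q' = Q \<union> requeued d \<omega>u H u v)
      (requeue_cost ?inner H {u, v} + (1 + 0)) (0 + (0 + 0)) ?h"
      unfolding requeue_cost_def
      by (rule exec_bind[OF exec_requeue[OF simple_H e Q, where base = "?base + 2"]],
          use c' c h in simp, use h in simp, rule exec_bind[OF exec_remove_edge], simp,
          rule exec_return) auto
    then show ?thesis using False by simp
  qed
  have "exec c (treat_recompute k d \<omega>u H x u v Q) ?P
    (recompute_check d H {u, v} + ((if ?b then 0 else requeue_cost ?inner H {u, v} + 1) + 0))
    (edge_scan H d {u, v} + (0 + 0)) ?h"
    unfolding treat_recompute_def
  proof (intro exec_alloc, rule exec_bind[OF exec_cond_recompute[OF simple_H e room]])
    fix b c' assume bc: "(b \<longleftrightarrow> ?b) \<and> c' \<le> c + 2"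
    then have c': "c' \<le> c + 2" and b: "b = ?b" by auto
    show "exec c' (do { (H', Q') \<leftarrow> (if b then return (H, Q)
             else ?peel);
          free 2; return (H', Q', ()) }) ?P
        ((if ?b then 0 else requeue_cost ?inner H {u, v} + 1) + 0) (0 + 0) ?h"
      unfolding b
      by (rule exec_bind[OF update[OF c']]) (auto intro!: exec_free exec_return)
  qed
  then show ?thesis
  proof (rule exec_weaken)
    show "recompute_check d H {u, v} + ((if ?b then 0 else requeue_cost ?inner H {u, v} + 1) + 0)
      \<le> recompute_check d G {u, v} + (if ?b then 0 else requeue_cost ?inner G {u, v} + 1)"
      using min_degree_mono[OF G H(2), of u v] scan_cost_pair_mono[OF G H(2), of "Suc d" u v]
        requeue_cost_mono[OF G H(2), of ?inner u v]
      by (simp add: recompute_check_def)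
    show "edge_scan H d {u, v} + (0 + 0) \<le> edge_scan G d {u, v}"
      using scan_cost_pair_mono[OF G H(2)] by simp
  qed
qed

lemma recompute_space_ge: "card (verts G) + 3 * card (edges G) \<le> recompute_space d G"
  by (simp add: recompute_space_def add_mult_distrib)

lemma recompute_implementation:
  assumes G: "simple_graph G"
  shows "peeling_implementation k d \<omega>u G (\<lambda>_ _. True) (treat_recompute k d \<omega>u) (body_recompute k d \<omega>u)
    (recompute_check d G) (edge_scan G d)
    (\<lambda>e. requeue_cost (0 < d \<or> edge_sensitive \<omega>u) G e + 1)
    (graph_cells G) (recompute_space d G)"
proof (unfold_locales, goal_cases)
  case 2
  show ?case using recompute_space_ge[of G d] by simp
next
  case (3 H Q x)
  show ?case unfolding body_recompute_def treat_recompute_def by simp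
next
  case (4 H x u v Q c)
  show ?case by (rule exec_weaken[OF exec_treat_recompute[OF G 4(1,2,4-6)]]) (use 4(7) in auto)
next
  case (5 H x u v Q c)
  show ?case by (rule exec_weaken[OF exec_treat_recompute[OF G 5(1,2,4-6)]]) (use 5(7) in auto)
qed (rule G)

lemma exec_init_recompute:
  "exec 0 (init_recompute G) (\<lambda>s c. fst s = G \<and> queue s = edges G \<and> True \<and>
      c \<le> graph_cells G + card (edges G))
    (graph_cells G) 0 (recompute_space d G)"
proof -
  have "exec 0 (init_recompute G) (\<lambda>s c. fst s = G \<and> queue s = edges G \<and> True \<and>
      c \<le> graph_cells G + card (edges G))
    (graph_cells G + 0) (0 + 0) (recompute_space d G)"
    unfolding init_recompute_def
    by (rule exec_bind[OF exec_load_graph])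
      (use recompute_space_ge[of G d] in \<open>auto simp: queue_def intro!: exec_return\<close>)
  then show ?thesis by simp
qed

section \<open>The implementation with a dictionary\<close>

definition stored :: "graph \<Rightarrow> nat set set \<Rightarrow> dict \<Rightarrow> bool" where
  "stored G \<X> D \<longleftrightarrow> (\<forall>K\<in>\<X>. D K = Some (W G K))"

definition cliques_of_size :: "graph \<Rightarrow> nat \<Rightarrow> nat set set" where
  "cliques_of_size G r = {K. clique G K \<and> card K = r}"

abbreviation dict_of :: "nat \<Rightarrow> graph \<Rightarrow> dict \<Rightarrow> bool" where
  "dict_of d G \<equiv> stored G (cliques_of_size G (d + 2))"

lemma exec_store:
  assumes "stored G \<X> D" "c + (1 + card K + card (W G K)) \<le> h"
  shows "exec c (store K (W G K) D)
    (\<lambda>D' c'. stored G (insert K \<X>) D' \<and> c' \<le> c + (1 + card K + card (W G K)))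
    (1 + card K + card (W G K)) 0 h"
proof -
  have "exec c (store K (W G K) D)
    (\<lambda>D' c'. stored G (insert K \<X>) D' \<and> c' \<le> c + (1 + card K + card (W G K)))
    (1 + card K + card (W G K) + 0) 0 h"
    unfolding store_def
    using assms by (intro exec_tick exec_free exec_alloc exec_return) (auto simp: stored_def)
  then show ?thesis by simp
qed

text \<open>
  At the last level, \<open>scan_cost\<close> counts \<open>1 + card (W G K)\<close> for a clique \<open>K\<close>; the factor \<open>d + 3\<close>
  makes this at least the size of the entry for \<open>K\<close>. Hence one expression bounds both the time and
  the memory that the entries keep; the rest of the memory is released level by level.
\<close>

lemma exec_store_cliques:
  assumes "simple_graph G" "finite K" "K \<noteq> {}" "card K + r = d + 2" "B \<subseteq> W G K" "stored G \<X> D"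
    and "c + (d + 3) * scan_cost G (Suc r) (W G K) + r * (2 * card (W G K) + 1) \<le> h"
  shows "exec c (store_cliques G r K (W G K) B D)
    (\<lambda>D' c'. stored G (\<X> \<union> (\<union>) K ` cliques_in G r B) D' \<and>
      c' \<le> c + (d + 3) * scan_cost G (Suc r) (W G K))
    ((d + 3) * scan_cost G (Suc r) (W G K)) 0 h"
  using assms(2-)
proof (induction r arbitrary: K B \<X> D c)
  case 0
  have cost: "1 + card K + card (W G K) \<le> (d + 3) * scan_cost G (Suc 0) (W G K)"
    using 0 by simp
  then have "c + (1 + card K + card (W G K)) \<le> h" using 0 by linarith
  note exec_store[OF "0.prems"(5) this]
  then show ?case unfolding store_cliques.simps
    by (rule exec_weaken) (use cost in auto)
next
  case (Suc r)
  let ?U = "W G K" and ?B = "\<lambda>v. B \<inter> nbrs_above G v"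
  let ?t = "\<lambda>v. (d + 3) * scan_cost G (Suc r) (?U \<inter> nbrs G v)"
  let ?T = "(d + 3) * scan_cost G (Suc (Suc r)) ?U"
  let ?a = "\<lambda>v. (1 + card ?U) + ((1 + card B) + ?t v)"
  let ?done = "\<lambda>X. \<X> \<union> (\<Union>v\<in>X. (\<union>) (insert v K) ` cliques_in G r (?B v))"
  have finU: "finite ?U" by (rule finite_W[OF assms(1) Suc.prems(2)])
  have finB: "finite B" using finU Suc.prems(4) finite_subset by blast
  have sum_t: "(\<Sum>v\<in>X. ?t v) \<le> ?T" if "X \<subseteq> ?U" for X
  proof -
    have "(\<Sum>v\<in>X. ?t v) \<le> (\<Sum>v\<in>?U. ?t v)" using that finU by (intro sum_mono2) auto
    also have "\<dots> \<le> ?T"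
      unfolding sum_distrib_left[symmetric] by (intro mult_le_mono2 sum_scan_cost_le)
    finally show ?thesis .
  qed
  have "exec c (store_cliques G (Suc r) K ?U B D)
      (\<lambda>D' c'. stored G (?done B) D' \<and> c' \<le> c + (\<Sum>v\<in>B. ?t v)) (\<Sum>v\<in>B. 1 + ?a v) (\<Sum>v\<in>B. 0) h"
    unfolding store_cliques.simps
  proof (rule exec_foreach[OF finB,
        where I = "\<lambda>X D' c'. stored G (?done X) D' \<and> c' \<le> c + (\<Sum>v\<in>X. ?t v)"])
    show "stored G (?done {}) D \<and> c \<le> c + (\<Sum>v\<in>{}. ?t v)" using Suc.prems(5) by simp
    show "c \<le> h" using Suc.prems(6) by simp
    fix X v D1 c1
    assume X: "X \<subseteq> B" and v: "v \<in> B" "v \<notin> X"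
      and inv: "stored G (?done X) D1 \<and> c1 \<le> c + (\<Sum>v\<in>X. ?t v)"
    have ins: "?U \<inter> nbrs G v = W G (insert v K)" by (auto simp: W_insert)
    have sub: "card (?U \<inter> nbrs G v) \<le> card ?U" "card (?B v) \<le> card (?U \<inter> nbrs G v)"
      using finU Suc.prems(4) by (auto intro!: card_mono simp: nbrs_above_def)
    have vK: "v \<notin> K" using v Suc.prems(4) not_self_nbr[OF assms(1), of v] by (auto simp: W_def)
    have sum_ins: "(\<Sum>v\<in>insert v X. ?t v) = ?t v + (\<Sum>v\<in>X. ?t v)"
      using v X finB finite_subset by (intro sum.insert) auto
    have room: "c1 + 1 + card (?U \<inter> nbrs G v) + card (?B v) + ?t v + r * (2 * card (?U \<inter> nbrs G v) + 1) \<le> h"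
    proof -
      have "(\<Sum>v\<in>insert v X. ?t v) \<le> ?T" using X v Suc.prems(4) by (intro sum_t) auto
      then have "c1 + ?t v \<le> c + ?T" using inv sum_ins by simp
      moreover have "c + ?T + (2 * card ?U + 1) + r * (2 * card ?U + 1) \<le> h"
        using Suc.prems(6) by simp
      moreover have "r * (2 * card (?U \<inter> nbrs G v) + 1) \<le> r * (2 * card ?U + 1)"
        using sub by simp
      ultimately show ?thesis using sub by linarith
    qed
    have inner: "exec (c1 + 1 + card (?U \<inter> nbrs G v) + card (?B v))
        (store_cliques G r (insert v K) (?U \<inter> nbrs G v) (?B v) D1)
        (\<lambda>D' c'. stored G (?done X \<union> (\<union>) (insert v K) ` cliques_in G r (?B v)) D' \<and>
          c' \<le> c1 + 1 + card (?U \<inter> nbrs G v) + card (?B v) + ?t v) (?t v) 0 h"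
      unfolding ins
    proof (rule Suc.IH)
      show "card (insert v K) + r = d + 2" using Suc.prems vK by simp
      show "?B v \<subseteq> W G (insert v K)"
        using Suc.prems(4) by (auto simp: W_insert nbrs_above_def)
      show "c1 + 1 + card (W G (insert v K)) + card (?B v) + (d + 3) * scan_cost G (Suc r) (W G (insert v K)) +
          r * (2 * card (W G (insert v K)) + 1) \<le> h"
        using room unfolding ins .
    qed (use Suc.prems inv in auto)
    let ?pass = "with_local (intersect ?U (nbrs G v)) (\<lambda>U'.
        with_local (intersect B (nbrs_above G v)) (\<lambda>B'. store_cliques G r (insert v K) U' B' D1))"
    have "exec (c1 + 1) ?pass
        (\<lambda>D' c'. stored G (?done X \<union> (\<union>) (insert v K) ` cliques_in G r (?B v)) D' \<and>
          c' - 1 \<le> c1 + ?t v) (?a v) (0 + (0 + 0)) h"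
      by (rule exec_with_local[OF exec_intersect], use room in simp,
          rule exec_with_local[OF exec_intersect], use room in simp,
          rule exec_weaken[OF inner]) auto
    then show "exec (c1 + 1) ?pass
        (\<lambda>D' c'. stored G (?done (insert v X)) D' \<and> c' - 1 \<le> c + (\<Sum>v\<in>insert v X. ?t v)) (?a v) 0 h"
    proof (rule exec_weaken)
      fix D' c'
      assume *: "stored G (?done X \<union> (\<union>) (insert v K) ` cliques_in G r (?B v)) D' \<and> c' - 1 \<le> c1 + ?t v"
      have "?done X \<union> (\<union>) (insert v K) ` cliques_in G r (?B v) = ?done (insert v X)" by blast
      with * inv show "stored G (?done (insert v X)) D' \<and> c' - 1 \<le> c + (\<Sum>v\<in>insert v X. ?t v)"
        unfolding sum_ins by simp
    qed simp_all
  qed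
  then show ?case
  proof (rule exec_weaken)
    have eq: "?done B = \<X> \<union> (\<union>) K ` cliques_in G (Suc r) B"
      by (auto simp: cliques_in_Suc image_UN image_image)
    show "stored G (\<X> \<union> (\<union>) K ` cliques_in G (Suc r) B) D' \<and> c' \<le> c + ?T"
      if "stored G (?done B) D' \<and> c' \<le> c + (\<Sum>v\<in>B. ?t v)" for D' c'
      using that sum_t[OF Suc.prems(4)] unfolding eq by simp
    have "card B \<le> card ?U" using finU Suc.prems(4) by (rule card_mono)
    then have "1 + ?a v \<le> (d + 3) * (1 + card ?U + scan_cost G (Suc r) (?U \<inter> nbrs G v))" for v
      by (simp add: distrib_left distrib_right)
    then have "(\<Sum>v\<in>B. 1 + ?a v) \<le> (\<Sum>v\<in>B. (d + 3) * (1 + card ?U + scan_cost G (Suc r) (?U \<inter> nbrs G v)))"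
      by (intro sum_mono) blast
    also have "\<dots> \<le> (\<Sum>v\<in>?U. (d + 3) * (1 + card ?U + scan_cost G (Suc r) (?U \<inter> nbrs G v)))"
      using finU Suc.prems(4) by (intro sum_mono2) auto
    finally show "(\<Sum>v\<in>B. 1 + ?a v) \<le> ?T"
      by (simp only: scan_cost.simps sum_distrib_left)
  qed simp
qed

definition dict_size :: "nat \<Rightarrow> graph \<Rightarrow> nat" where
  "dict_size d G = (\<Sum>e\<in>edges G. (d + 3) * edge_scan G (Suc d) e)"

text \<open>The two least vertices of a clique form the edge from which the clique is generated.\<close>

lemma cliques_of_size_subset:
  "cliques_of_size G (d + 2) \<subseteq>
     (\<Union>e\<in>edges G. (\<union>) e ` cliques_in G d (W G e \<inter> nbrs_above G (Max e)))"
proof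
  fix K assume "K \<in> cliques_of_size G (d + 2)"
  then have K: "clique G K" "card K = Suc (Suc d)" by (auto simp: cliques_of_size_def)
  then have "finite K" by (metis card.infinite nat.distinct(1))
  then have "K \<in> cliques_in G (Suc (Suc d)) (verts G)"
    using K by (auto simp: cliques_in_def clique_def)
  then obtain u v R where uv: "v \<in> nbrs_above G u" and KR: "K = insert u (insert v R)"
    and R: "R \<in> cliques_in G d (verts G \<inter> nbrs_above G u \<inter> nbrs_above G v)"
    by (auto simp: cliques_in_Suc)
  have "verts G \<inter> nbrs_above G u \<inter> nbrs_above G v \<subseteq> W G {u, v} \<inter> nbrs_above G v"
    by (auto simp: nbrs_above_def W_pair)
  with R have "R \<in> cliques_in G d (W G {u, v} \<inter> nbrs_above G v)" by (auto simp: cliques_in_def)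
  moreover have "{u, v} \<in> edges G" "Max {u, v} = v"
    using uv by (auto simp: nbrs_above_def in_nbrs_iff insert_commute)
  ultimately show "K \<in> (\<Union>e\<in>edges G. (\<union>) e ` cliques_in G d (W G e \<inter> nbrs_above G (Max e)))"
    unfolding KR by (intro UN_I[of "{u, v}"] image_eqI[of _ _ R]) auto
qed

lemma exec_build_dict:
  assumes G: "simple_graph G" and h: "c + dict_size d G + (2 * d + 2) * card (edges G) + d + 1 \<le> h"
  shows "exec c (build_dict d G)
    (\<lambda>D c'. dict_of d G D \<and> c' \<le> c + dict_size d G)
    (\<Sum>e\<in>edges G. 3 + min_degree G e + card (W G e) + (d + 3) * edge_scan G (Suc d) e) 0 h"
proof -
  let ?E = "edges G" and ?B = "\<lambda>e. W G e \<inter> nbrs_above G (Max e)"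
  let ?t = "\<lambda>e. (d + 3) * edge_scan G (Suc d) e"
  let ?a = "\<lambda>e. 1 + min_degree G e + ((1 + card (W G e)) + ?t e)"
  let ?done = "\<lambda>X. (\<Union>e\<in>X. (\<union>) e ` cliques_in G d (?B e))"
  note fin = finite_edges[OF G]
  have sum_t: "(\<Sum>e\<in>X. ?t e) \<le> dict_size d G" if "X \<subseteq> ?E" for X
    unfolding dict_size_def using that fin by (intro sum_mono2) auto
  have "exec c (build_dict d G) (\<lambda>D c'. stored G (?done ?E) D \<and> c' \<le> c + (\<Sum>e\<in>?E. ?t e))
      (\<Sum>e\<in>?E. 1 + ?a e) (\<Sum>e\<in>?E. 0) h"
    unfolding build_dict_def
  proof (rule exec_foreach[OF fin,
        where I = "\<lambda>X D c'. stored G (?done X) D \<and> c' \<le> c + (\<Sum>e\<in>X. ?t e)"])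
    show "stored G (?done {}) Map.empty \<and> c \<le> c + (\<Sum>e\<in>{}. ?t e)" by (simp add: stored_def)
    show "c \<le> h" using h by simp
    fix X e D c1
    assume X: "X \<subseteq> ?E" and e: "e \<in> ?E" "e \<notin> X"
      and inv: "stored G (?done X) D \<and> c1 \<le> c + (\<Sum>e\<in>X. ?t e)"
    obtain a b where ab: "e = {a, b}" "a \<noteq> b" using e(1) by (rule edgeE[OF G])
    then have "e = {Min e, Max e}" by (cases "a < b") (auto simp: min_def max_def)
    note e_eq = this[symmetric]
    note S = card_W_edge_le(2,3)[OF G e(1)]
    have B: "card (?B e) \<le> card (W G e)" using S by (auto intro: card_mono)
    have sum_ins: "(\<Sum>e\<in>insert e X. ?t e) = ?t e + (\<Sum>e\<in>X. ?t e)"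
      using e X fin finite_subset by (intro sum.insert) auto
    have room: "c1 + 1 + card (W G e) + card (?B e) + ?t e + d * (2 * card (W G e) + 1) \<le> h"
    proof -
      have "(\<Sum>e\<in>insert e X. ?t e) \<le> dict_size d G" using X e by (intro sum_t) auto
      then have "c1 + ?t e \<le> c + dict_size d G" using inv sum_ins by simp
      moreover have "d * (2 * card (W G e) + 1) \<le> d * (2 * card ?E + 1)" using S by simp
      moreover have "(2 * d + 2) * card ?E + d + 1 = 2 * card ?E + 1 + d * (2 * card ?E + 1)"
        by (simp add: algebra_simps)
      ultimately show ?thesis using h S B by linarith
    qed
    have "exec (c1 + 1 + card (W G e) + card (?B e)) (store_cliques G d e (W G e) (?B e) D)
        (\<lambda>D' c'. stored G (?done X \<union> (\<union>) e ` cliques_in G d (?B e)) D' \<and>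
          c' \<le> c1 + 1 + card (W G e) + card (?B e) + ?t e) (?t e) 0 h"
      by (rule exec_store_cliques[OF G]) (use room inv in \<open>auto simp: ab\<close>)
    note store = this
    let ?pass = "with_local (common_nbrs G (Min e) (Max e)) (\<lambda>S.
        with_local (intersect S (nbrs_above G (Max e))) (\<lambda>B. store_cliques G d e S B D))"
    from store have "exec (c1 + 1) ?pass
        (\<lambda>D' c'. stored G (?done X \<union> (\<union>) e ` cliques_in G d (?B e)) D' \<and> c' - 1 \<le> c1 + ?t e)
        (?a e) (0 + (0 + 0)) h"
      using room
      by (intro exec_with_local[OF exec_common_nbrs[of _ G "Min e" "Max e", unfolded e_eq]]
          exec_with_local[OF exec_intersect]) (auto elim!: exec_weaken)
    then show "exec (c1 + 1) ?pass
        (\<lambda>D' c'. stored G (?done (insert e X)) D' \<and> c' - 1 \<le> c + (\<Sum>e\<in>insert e X. ?t e)) (?a e) 0 h"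
    proof (rule exec_weaken)
      fix D' c'
      assume *: "stored G (?done X \<union> (\<union>) e ` cliques_in G d (?B e)) D' \<and> c' - 1 \<le> c1 + ?t e"
      have "?done X \<union> (\<union>) e ` cliques_in G d (?B e) = ?done (insert e X)" by blast
      with * inv show "stored G (?done (insert e X)) D' \<and> c' - 1 \<le> c + (\<Sum>e\<in>insert e X. ?t e)"
        unfolding sum_ins by simp
    qed simp_all
  qed
  then show ?thesis
  proof (rule exec_weaken)
    show "dict_of d G D \<and> c' \<le> c + dict_size d G"
      if "stored G (?done ?E) D \<and> c' \<le> c + (\<Sum>e\<in>?E. ?t e)" for D c'
      using that cliques_of_size_subset[of G d] by (auto simp: stored_def dict_size_def)
    show "(\<Sum>e\<in>?E. 1 + ?a e) \<le> (\<Sum>e\<in>?E. 3 + min_degree G e + card (W G e) + ?t e)"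
      by (intro sum_mono) simp
  qed simp
qed

text \<open>
  For \<open>d = 0\<close> the clique is the edge itself, so that a check is a single lookup and call. The
  bound for a non-edge-sensitive function depends on this.
\<close>

definition dict_check :: "nat \<Rightarrow> graph \<Rightarrow> nat set \<Rightarrow> nat" where
  "dict_check d G e = (if d = 0 then 2 else 1 + min_degree G e + 4 * edge_scan G d e)"

lemma clique_of_edge:
  assumes "simple_graph H" "{u, v} \<in> edges H" "R \<in> cliques_in H d (W H {u, v})"
  shows "{u, v} \<union> R \<in> cliques_of_size H (d + 2)"
  using clique_iff_cliques_in[OF assms(1,2), of "{u, v} \<union> R" d] assms(3)
  by (auto simp: cliques_of_size_def)

lemma exec_cond_dict:
  assumes H: "simple_graph H" "{u, v} \<in> edges H" and D: "dict_of d H D"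
    and h: "c + d * (card (edges H) + 1) \<le> h"
  shows "exec c (cond_dict k d \<omega>u u v H D) (\<lambda>x c'. (x \<longleftrightarrow> cond k d \<omega>u u v H) \<and> c' \<le> c)
    (dict_check d H {u, v}) (edge_scan H d {u, v}) h"
proof -
  let ?S = "W H {u, v}"
  let ?good = "\<lambda>R. k - d \<le> \<omega>u (induced H (W H ({u, v} \<union> R)))"
  note S = card_W_edge_le(2,3)[OF H]
  have "exec c (cond_dict k d \<omega>u u v H D)
      (\<lambda>b c'. (b \<longleftrightarrow> (\<exists>R\<in>{} \<union> (\<union>) {} ` cliques_in H d ?S. ?good R)) \<and> c' \<le> c)
      (if d = 0 then 2 else (1 + min_degree H {u, v}) + (2 + 2) * scan_cost H d ?S)
      (1 * scan_cost H d ?S) h"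
    unfolding cond_dict_def
  proof (rule exec_foreach_clique[OF S(2) _ order_refl, where I = "\<lambda>\<X> b. b \<longleftrightarrow> (\<exists>R\<in>\<X>. ?good R)"])
    show "c + d * (card ?S + 1) \<le> h"
      using h S by (meson add_le_mono1 add_le_cancel_left mult_le_mono2 order_trans)
    show "exec c' (common_nbrs H u v) (\<lambda>S c''. S = ?S \<and> c'' = c' + card ?S) (1 + min_degree H {u, v}) 0 h"
      if "c' + card ?S \<le> h" for c' using that by (rule exec_common_nbrs)
    fix \<Y> R b c' assume R: "R \<in> cliques_in H d ?S" and b: "b \<longleftrightarrow> (\<exists>R\<in>\<Y>. ?good R)" and c': "c' \<le> h"
    have look: "D ({u, v} \<union> R) = Some (W H ({u, v} \<union> R))"
      using D clique_of_edge[OF H R] by (simp add: stored_def)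
    have "exec c' (do { U \<leftarrow> lookup ({u, v} \<union> R) D; x \<leftarrow> call \<omega>u (induced H U); tick 1;
            return (b \<or> k - d \<le> x) })
        (\<lambda>x c''. (x \<longleftrightarrow> (\<exists>R\<in>insert R \<Y>. ?good R)) \<and> c'' \<le> c') ((1 + 0) + (0 + (1 + 0))) (0 + (1 + 0)) h"
    proof (rule exec_bind)
      fix U c'' assume U: "U = W H ({u, v} \<union> R) \<and> c'' = c'"
      show "exec c'' (do { x \<leftarrow> call \<omega>u (induced H U); tick 1; return (b \<or> k - d \<le> x) })
          (\<lambda>x c''. (x \<longleftrightarrow> (\<exists>R\<in>insert R \<Y>. ?good R)) \<and> c'' \<le> c') (0 + (1 + 0)) (1 + 0) h"
        by (rule exec_bind[OF exec_call], use U c' in simp, rule exec_tick, rule exec_return)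
          (use U b c' in auto)
    next
      show "exec c' (lookup ({u, v} \<union> R) D) (\<lambda>U c''. U = W H ({u, v} \<union> R) \<and> c'' = c') (1 + 0) 0 h"
        unfolding lookup_def look using c' by (intro exec_tick exec_return) auto
    qed
    then show "exec c' (do { U \<leftarrow> lookup ({u, v} \<union> ({} \<union> R)) D; x \<leftarrow> call \<omega>u (induced H U); tick 1;
            return (b \<or> k - d \<le> x) })
        (\<lambda>x c''. (x \<longleftrightarrow> (\<exists>R\<in>insert ({} \<union> R) \<Y>. ?good R)) \<and> c'' \<le> c') 2 1 h"
      by (simp add: numeral_2_eq_2)
  qed simp
  then show ?thesis
    by (rule exec_weaken) (auto simp: cond_iff dict_check_def)
qed

lemma exec_remove_from_entry:
  assumes "c \<le> h"
  shows "exec c (remove_from_entry K x D)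
    (\<lambda>D' c'. D' = (case D K of None \<Rightarrow> D | Some U \<Rightarrow> D(K \<mapsto> U - {x})) \<and> c' \<le> c) 1 0 h"
proof -
  have "exec c (remove_from_entry K x D)
    (\<lambda>D' c'. D' = (case D K of None \<Rightarrow> D | Some U \<Rightarrow> D(K \<mapsto> U - {x})) \<and> c' \<le> c) (1 + 0) 0 h"
    using assms unfolding remove_from_entry_def
    by (cases "D K") (auto intro!: exec_tick[where a = 0, simplified] exec_free exec_return)
  then show ?thesis by simp
qed

definition update_cost :: "nat \<Rightarrow> graph \<Rightarrow> nat set \<Rightarrow> nat" where
  "update_cost d G e = 2 * (1 + min_degree G e) + 4 * edge_scan G (Suc d) e +
     (d + 6 + card (W G e)) * edge_scan G d e"

text \<open>
  During the first traversal every entry lies between the new and the old common neighborhood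
  of its clique, and the entries treated so far have lost the end of the deleted edge that they
  had to lose. The second traversal touches only cliques that contain the deleted edge.
\<close>

lemma exec_update_dict:
  assumes H: "simple_graph H" "{u, v} \<in> edges H" and D: "dict_of d H D"
    and h: "c + (d + 1) * (card (edges H) + 1) \<le> h"
  shows "exec c (update_dict d H u v D)
    (\<lambda>D' c'. dict_of d (delete_edge H u v) D' \<and> c' \<le> c)
    (update_cost d H {u, v}) 0 h"
proof -
  let ?S = "W H {u, v}" and ?H = "delete_edge H u v"
  let ?I = "\<lambda>\<X> D. \<forall>K\<in>cliques_of_size H (d + 2). \<exists>U. D K = Some U \<and> W ?H K \<subseteq> U \<and> U \<subseteq> W H K \<and>
      (\<forall>R\<in>\<X>. (K = insert u R \<longrightarrow> v \<notin> U) \<and> (K = insert v R \<longrightarrow> u \<notin> U))"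
  let ?J = "\<lambda>\<X> D. dict_of d ?H D \<and>
      (\<forall>K\<in>cliques_of_size H (d + 2). \<forall>U. D K = Some U \<longrightarrow> U \<subseteq> W H K)"
  let ?l = "d + 4 + card ?S"
  let ?cost1 = "if d + 1 = 0 then 2 else (1 + min_degree H {u, v}) + (2 + 2) * scan_cost H (d + 1) ?S"
  let ?cost2 = "if d = 0 then ?l else (1 + min_degree H {u, v}) + (?l + 2) * scan_cost H d ?S"
  let ?deletions = "foreach_clique H d {} (common_nbrs H u v) (\<lambda>R D. delete_entry ({u, v} \<union> R) D)"
  note S = card_W_edge_le(2,3)[OF H] and uv = edge_endpoints[OF H]
  have WH: "W ?H K \<subseteq> W H K" for K by (rule W_mono) auto
  have gone: "v \<notin> W ?H (insert u R)" "u \<notin> W ?H (insert v R)" for R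
    by (auto simp: W_insert in_nbrs_iff insert_commute)
  have sub: "cliques_of_size ?H (d + 2) \<subseteq> cliques_of_size H (d + 2)"
    by (auto simp: cliques_of_size_def clique_def)
  have room: "c' + r * (card ?S + 1) \<le> h" if "c' \<le> c" "r \<le> d + 1" for c' r
  proof -
    have "r * (card ?S + 1) \<le> (d + 1) * (card (edges H) + 1)"
      using that S by (intro mult_le_mono) auto
    then show ?thesis using h that by simp
  qed
  have common: "exec c' (common_nbrs H u v) (\<lambda>S c''. S = ?S \<and> c'' = c' + card ?S) (1 + min_degree H {u, v}) 0 h"
    if "c' + card ?S \<le> h" for c' using that by (rule exec_common_nbrs)
  have first: "exec c (foreach_clique H (d + 1) {} (common_nbrs H u v) (\<lambda>R D.
        do { D' \<leftarrow> remove_from_entry (insert u R) v D; remove_from_entry (insert v R) u D' }) D)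
      (\<lambda>D' c'. ?I ({} \<union> (\<union>) {} ` cliques_in H (d + 1) ?S) D' \<and> c' \<le> c)
      ?cost1
      (0 * scan_cost H (d + 1) ?S) h"
  proof (rule exec_foreach_clique[OF S(2) room[OF order_refl order_refl] order_refl, where I = ?I])
    show "?I {} D" using D WH by (auto simp: stored_def)
    fix \<Y> R D1 c1 assume inv: "?I \<Y> D1" and c1: "c1 \<le> h"
    let ?rm = "\<lambda>K x D. case D K of None \<Rightarrow> D | Some U \<Rightarrow> D(K \<mapsto> U - {x})"
    have "?I (insert R \<Y>) (?rm (insert v R) u (?rm (insert u R) v D1))"
    proof
      fix K assume "K \<in> cliques_of_size H (d + 2)"
      from bspec[OF inv this] obtain U where U: "D1 K = Some U" "W ?H K \<subseteq> U" "U \<subseteq> W H K"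
        "\<forall>R\<in>\<Y>. (K = insert u R \<longrightarrow> v \<notin> U) \<and> (K = insert v R \<longrightarrow> u \<notin> U)"
        by (elim exE conjE)
      define U' where "U' = (let V = (if K = insert u R then U - {v} else U) in
        if K = insert v R then V - {u} else V)"
      have "?rm (insert v R) u (?rm (insert u R) v D1) K = Some U'"
        using U(1) by (auto simp: U'_def split: option.splits)
      moreover have "(K = insert u R \<longrightarrow> v \<notin> W ?H K) \<and> (K = insert v R \<longrightarrow> u \<notin> W ?H K)"
        using gone[of R] by metis
      then have "W ?H K \<subseteq> U'" using U(2) by (auto simp: U'_def Let_def)
      moreover have "U' \<subseteq> U" by (auto simp: U'_def Let_def)
      moreover have "(K = insert u R \<longrightarrow> v \<notin> U') \<and> (K = insert v R \<longrightarrow> u \<notin> U')"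
        by (auto simp: U'_def Let_def)
      ultimately show "\<exists>U. ?rm (insert v R) u (?rm (insert u R) v D1) K = Some U \<and>
          W ?H K \<subseteq> U \<and> U \<subseteq> W H K \<and>
          (\<forall>R\<in>insert R \<Y>. (K = insert u R \<longrightarrow> v \<notin> U) \<and> (K = insert v R \<longrightarrow> u \<notin> U))"
        using U(3,4) by (intro exI[of _ U']) blast
    qed
    note step = this
    have "exec c1 (do { D' \<leftarrow> remove_from_entry (insert u R) v D1; remove_from_entry (insert v R) u D' })
        (\<lambda>s' c'. ?I (insert R \<Y>) s' \<and> c' \<le> c1) (1 + 1) (0 + 0) h"
    proof (rule exec_bind[OF exec_remove_from_entry[OF c1]])
      fix D' c' assume D': "D' = ?rm (insert u R) v D1 \<and> c' \<le> c1" and "c' \<le> h"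
      from exec_remove_from_entry[OF this(2)]
      show "exec c' (remove_from_entry (insert v R) u D') (\<lambda>s' c'. ?I (insert R \<Y>) s' \<and> c' \<le> c1) 1 0 h"
      proof (rule exec_weaken)
        fix D'' c'' assume D'': "D'' = ?rm (insert v R) u D' \<and> c'' \<le> c'"
        have "D'' = ?rm (insert v R) u (?rm (insert u R) v D1)" using D' D'' by (simp only:)
        then have "?I (insert R \<Y>) D''" using step by (simp only:)
        then show "?I (insert R \<Y>) D'' \<and> c'' \<le> c1" using D' D'' by linarith
      qed simp_all
    qed
    then show "exec c1 (do { D' \<leftarrow> remove_from_entry (insert u ({} \<union> R)) v D1;
          remove_from_entry (insert v ({} \<union> R)) u D' })
        (\<lambda>s' c'. ?I (insert ({} \<union> R) \<Y>) s' \<and> c' \<le> c1) 2 0 h"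
      by (simp add: numeral_2_eq_2)
  qed (rule common)
  have between: "?J {} D'" if I: "?I (cliques_in H (d + 1) ?S) D'" for D'
  proof -
    have "D' K = Some (W ?H K)" if K: "K \<in> cliques_of_size ?H (d + 2)" for K
    proof -
      from bspec[OF I subsetD[OF sub K]]
      obtain U where U: "D' K = Some U" "W ?H K \<subseteq> U" "U \<subseteq> W H K"
        and lost: "\<forall>R\<in>cliques_in H (d + 1) ?S.
          (K = insert u R \<longrightarrow> v \<notin> U) \<and> (K = insert v R \<longrightarrow> u \<notin> U)"
        by (elim exE conjE)
      have fin: "finite K" using K by (auto simp: cliques_of_size_def intro: card_ge_0_finite)
      have K': "clique H K" "card K = d + 2" using K sub by (auto simp: cliques_of_size_def)
      have clique: "K - {x} \<in> cliques_in H (d + 1) ?S" if "x \<in> K" "y \<in> W H K" "{x, y} = {u, v}" for x y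
      proof -
        have "K - {x} \<subseteq> nbrs H x" using K'(1) that(1) by (simp add: clique_def in_nbrs_iff subset_iff)
        moreover have "K - {x} \<subseteq> nbrs H y" using that(2) by (auto simp: W_def nbrs_sym[of y])
        ultimately have "K - {x} \<subseteq> ?S" by (simp flip: that(3) add: W_pair)
        then show ?thesis using K' fin that(1) by (auto simp: cliques_in_def clique_def)
      qed
      have "U \<subseteq> W ?H K"
      proof
        fix y assume y: "y \<in> U"
        have "{y, x} \<noteq> {u, v}" if x: "x \<in> K" for x
        proof
          assume eq: "{y, x} = {u, v}"
          then have "K - {x} \<in> cliques_in H (d + 1) ?S"
            using clique[OF x, of y] y U(3) by (auto simp: insert_commute)
          moreover have "K = insert x (K - {x})" using x by blast
          moreover have "(x = u \<and> y = v) \<or> (x = v \<and> y = u)" using eq by (auto simp: doubleton_eq_iff)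
          ultimately show False using bspec[OF lost, of "K - {x}"] y by metis
        qed
        then show "y \<in> W ?H K" using y U(3) by (auto simp: W_def in_nbrs_iff)
      qed
      then show ?thesis using U by auto
    qed
    then show ?thesis using I by (fastforce simp: stored_def)
  qed
  have second: "exec c1 (?deletions D1)
      (\<lambda>D' c'. ?J ({} \<union> (\<union>) {} ` cliques_in H d ?S) D' \<and> c' \<le> c1)
      ?cost2
      (0 * scan_cost H d ?S) h" if J: "?J {} D1" and c1: "c1 \<le> c" for c1 D1
  proof (rule exec_foreach_clique[OF S(2) room[OF c1 le_add1] order_refl, where I = ?J])
    show "?J {} D1" by (rule J)
    fix \<Y> R D2 c2 assume R: "R \<in> cliques_in H d ?S" and inv: "?J \<Y> D2" and c2: "c2 \<le> h"
    let ?K = "{u, v} \<union> R"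
    note K = clique_of_edge[OF H R]
    have size: "entry_size D2 ?K \<le> d + 3 + card ?S"
    proof (cases "D2 ?K")
      case (Some U)
      then have "U \<subseteq> W H ?K" using inv K by blast
      also have "\<dots> \<subseteq> ?S" by (rule W_antimono) blast
      finally have "card U \<le> card ?S" using S(2) by (intro card_mono)
      then show ?thesis using Some K by (simp add: entry_size_def cliques_of_size_def)
    qed (simp add: entry_size_def)
    have "?K \<notin> cliques_of_size ?H (d + 2)"
      using uv(1) by (auto simp: cliques_of_size_def clique_def)
    then have "?J (insert R \<Y>) (D2(?K := None))" using inv by (auto simp: stored_def)
    then have "exec c2 (delete_entry ?K D2) (\<lambda>D' c'. ?J (insert R \<Y>) D' \<and> c' \<le> c2)
        (1 + entry_size D2 ?K + 0) 0 h"
      unfolding delete_entry_def using c2 by (intro exec_tick exec_free exec_return) auto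
    then show "exec c2 (delete_entry ({u, v} \<union> ({} \<union> R)) D2)
        (\<lambda>D' c'. ?J (insert ({} \<union> R) \<Y>) D' \<and> c' \<le> c2) ?l 0 h"
      unfolding Un_empty_left by (rule exec_weaken) (use size in auto)
  qed (rule common)
  have "exec c (update_dict d H u v D) (\<lambda>D' c'. dict_of d ?H D' \<and> c' \<le> c)
    (?cost1 +
     ?cost2)
    (0 * scan_cost H (d + 1) ?S + 0 * scan_cost H d ?S) h"
    unfolding update_dict_def
  proof (rule exec_bind[OF first])
    fix D1 c1
    assume "?I ({} \<union> (\<union>) {} ` cliques_in H (d + 1) ?S) D1 \<and> c1 \<le> c"
    then have "?I (cliques_in H (d + 1) ?S) D1" "c1 \<le> c" by auto
    note * = second[OF between[OF this(1)] this(2)] this(2)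
    show "exec c1 (?deletions D1)
        (\<lambda>D' c'. dict_of d ?H D' \<and> c' \<le> c)
        ?cost2
        (0 * scan_cost H d ?S) h"
      by (rule exec_weaken[OF *(1)]) (use *(2) in auto)
  qed
  then show ?thesis
    by (rule exec_weaken) (auto simp: update_cost_def)
qed

lemma update_cost_mono:
  assumes "simple_graph G" "edges H \<subseteq> edges G"
  shows "update_cost d H {u, v} \<le> update_cost d G {u, v}"
  unfolding update_cost_def
  using min_degree_mono[OF assms, of u v] card_W_pair_mono[OF assms, of u v]
    scan_cost_pair_mono[OF assms, of d u v] scan_cost_pair_mono[OF assms, of "Suc d" u v]
  by (intro add_mono mult_le_mono) auto

definition dict_space :: "nat \<Rightarrow> graph \<Rightarrow> nat" where
  "dict_space d G = card (verts G) + dict_size d G + (2 * d + 8) * card (edges G) + d + 4"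

lemma dict_space_ge:
  "card (verts G) + dict_size d G + 3 * card (edges G) \<le> dict_space d G"
  by (simp add: dict_space_def add_mult_distrib)

definition treat_dict ::
    "nat \<Rightarrow> nat \<Rightarrow> (graph \<Rightarrow> nat) \<Rightarrow> graph \<Rightarrow> dict \<Rightarrow> nat \<Rightarrow> nat \<Rightarrow> nat set set \<Rightarrow> dict state prog" where
  "treat_dict k d \<omega>u H D u v Q =
     do { alloc 2;
          b \<leftarrow> cond_dict k d \<omega>u u v H D;
          (H', Q', D') \<leftarrow>
            (if b then return (H, Q, D)
             else do { Q2 \<leftarrow> requeue d \<omega>u H u v Q;
                       D' \<leftarrow> update_dict d H u v D;
                       H' \<leftarrow> remove_edge H u v;
                       return (H', Q2, D') });
          free 2;
          return (H', Q', D') }"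

lemma exec_treat_dict:
  assumes G: "simple_graph G" and H: "verts H = verts G" "edges H \<subseteq> edges G"
    and D: "dict_of d H D"
    and e: "{u, v} \<in> edges H" and Q: "Q \<subseteq> edges H"
    and c: "c \<le> graph_cells G + dict_size d G + card Q"
  shows "exec c (treat_dict k d \<omega>u H D u v Q)
    (\<lambda>(H', Q', D') c'. c' \<le> graph_cells G + dict_size d G + card Q' \<and>
      (if cond k d \<omega>u u v H then H' = H \<and> Q' = Q \<and> D' = D
       else H' = delete_edge H u v \<and> Q' = Q \<union> requeued d \<omega>u H u v \<and>
         dict_of d H' D'))
    (dict_check d G {u, v} + (if cond k d \<omega>u u v H then 0
       else requeue_cost (0 < d \<or> edge_sensitive \<omega>u) G {u, v} + update_cost d G {u, v} + 1))
    (edge_scan G d {u, v}) (dict_space d G)"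
    (is "exec c _ ?P _ _ ?h")
proof -
  let ?base = "graph_cells G + dict_size d G"
  let ?inner = "0 < d \<or> edge_sensitive \<omega>u"
  let ?b = "cond k d \<omega>u u v H"
  let ?update = "do { Q2 \<leftarrow> requeue d \<omega>u H u v Q; D' \<leftarrow> update_dict d H u v D;
      H' \<leftarrow> remove_edge H u v; return (H', Q2, D') }"
  let ?post = "\<lambda>(H', Q', D') c'. c' \<le> ?base + 2 + card Q' \<and> H' = delete_edge H u v \<and>
         Q' = Q \<union> requeued d \<omega>u H u v \<and> dict_of d H' D'"
  note simple_H = simple_graph_spanning[OF G H]
  note fin = finite_edges[OF G]
  have card: "card (edges H) \<le> card (edges G)" "card Q \<le> card (edges G)"
    using H Q fin by (auto intro: card_mono)
  have all_queued: "card (Q \<union> requeued d \<omega>u H u v) \<le> card (edges G)"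
    using Q H(2) requeued_by_edges[OF simple_H e, of ?inner]
    unfolding requeued_eq[OF simple_H] by (intro card_mono[OF fin]) blast
  have room: "?base + card (edges G) + 2 + (d + 1) * (card (edges H) + 1) \<le> ?h"
  proof -
    have "(d + 1) * (card (edges H) + 1) \<le> (d + 1) * (card (edges G) + 1)"
      using card by (intro mult_le_mono2) simp
    moreover have "?base + card (edges G) + 2 + (d + 1) * (card (edges G) + 1) \<le> ?h"
      by (simp add: dict_space_def algebra_simps)
    ultimately show ?thesis by linarith
  qed
  have h: "?base + 2 + 3 * card (edges H) + 2 \<le> ?h"
    using card by (simp add: dict_space_def algebra_simps)
  have update: "exec c' (if ?b then return (H, Q, D) else ?update)
      (\<lambda>(H', Q', D') c'. c' \<le> ?base + 2 + card Q' \<and> (if ?b then H' = H \<and> Q' = Q \<and> D' = D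
         else H' = delete_edge H u v \<and> Q' = Q \<union> requeued d \<omega>u H u v \<and>
           dict_of d H' D'))
      (if ?b then 0 else requeue_cost ?inner H {u, v} + update_cost d H {u, v} + 1) 0 ?h"
    if c': "c' \<le> c + 2" for c'
  proof (cases ?b)
    case True
    then show ?thesis using c' c card room by (auto intro!: exec_return)
  next
    case False
    have "exec c' ?update
      ?post
      (requeue_cost ?inner H {u, v} + (update_cost d H {u, v} + (1 + 0))) (0 + (0 + (0 + 0))) ?h"
      unfolding requeue_cost_def
    proof (rule exec_bind[OF exec_requeue[OF simple_H e Q _ h]])
      fix Q2 c2 assume Q2: "Q2 = Q \<union> requeued d \<omega>u H u v \<and> c2 \<le> ?base + 2 + card Q2"
      show "exec c2 (do { D' \<leftarrow> update_dict d H u v D; H' \<leftarrow> remove_edge H u v; return (H', Q2, D') })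
        ?post
        (update_cost d H {u, v} + (1 + 0)) (0 + (0 + 0)) ?h"
      proof (rule exec_bind[OF exec_update_dict[OF simple_H e D]])
        show "c2 + (d + 1) * (card (edges H) + 1) \<le> ?h" using Q2 all_queued room by auto
        fix D' c' assume D': "dict_of d (delete_edge H u v) D' \<and> c' \<le> c2"
          and c'_h: "c' \<le> ?h"
        show "exec c' (do { H' \<leftarrow> remove_edge H u v; return (H', Q2, D') })
          ?post
          (1 + 0) (0 + 0) ?h"
          by (rule exec_bind[OF exec_remove_edge[OF c'_h]], rule exec_return) (use Q2 D' in auto)
      qed
    qed (use c' c in simp)
    then show ?thesis using False by (simp add: add.assoc)
  qed
  have "exec c (treat_dict k d \<omega>u H D u v Q) ?P
    (dict_check d H {u, v} + ((if ?b then 0 else requeue_cost ?inner H {u, v} + update_cost d H {u, v} + 1) + 0))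
    (edge_scan H d {u, v} + (0 + 0)) ?h"
    unfolding treat_dict_def
  proof (intro exec_alloc, rule exec_bind[OF exec_cond_dict[OF simple_H e D]])
    show "c + 2 + d * (card (edges H) + 1) \<le> ?h" using room c card by simp
    fix b c' assume bc: "(b \<longleftrightarrow> ?b) \<and> c' \<le> c + 2"
    then have c': "c' \<le> c + 2" and b: "b = ?b" by auto
    show "exec c' (do { (H', Q', D') \<leftarrow> (if b then return (H, Q, D) else ?update);
          free 2; return (H', Q', D') }) ?P
        ((if ?b then 0 else requeue_cost ?inner H {u, v} + update_cost d H {u, v} + 1) + 0) (0 + 0) ?h"
      unfolding b
      by (rule exec_bind[OF update[OF c']]) (auto intro!: exec_free exec_return)
  qed
  then show ?thesis
  proof (rule exec_weaken)
    have check: "dict_check d H {u, v} \<le> dict_check d G {u, v}"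
      using min_degree_mono[OF G H(2), of u v] scan_cost_pair_mono[OF G H(2), of d u v]
      by (simp add: dict_check_def)
    have delete: "(if ?b then 0 else x + y + 1) \<le> (if ?b then 0 else x' + y' + 1)"
      if "x \<le> x'" "y \<le> y'" for x y x' y' :: nat using that by simp
    show "dict_check d H {u, v} +
        ((if ?b then 0 else requeue_cost ?inner H {u, v} + update_cost d H {u, v} + 1) + 0)
      \<le> dict_check d G {u, v} +
        (if ?b then 0 else requeue_cost ?inner G {u, v} + update_cost d G {u, v} + 1)"
      unfolding add_0_right
      by (intro add_mono check delete requeue_cost_mono[OF G H(2)] update_cost_mono[OF G H(2)])
    show "edge_scan H d {u, v} + (0 + 0) \<le> edge_scan G d {u, v}"
      using scan_cost_pair_mono[OF G H(2)] by simp
  qed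
qed

lemma dict_implementation:
  assumes G: "simple_graph G"
  shows "peeling_implementation k d \<omega>u G (\<lambda>H D. dict_of d H D)
    (treat_dict k d \<omega>u) (body_dict k d \<omega>u) (dict_check d G) (edge_scan G d)
    (\<lambda>e. requeue_cost (0 < d \<or> edge_sensitive \<omega>u) G e + update_cost d G e + 1)
    (graph_cells G + dict_size d G) (dict_space d G)"
proof (unfold_locales, goal_cases)
  case 2
  show ?case using dict_space_ge[of G d] by simp
next
  case (3 H Q x)
  show ?case unfolding body_dict_def treat_dict_def by simp
next
  case (4 H D u v Q c)
  show ?case by (rule exec_weaken[OF exec_treat_dict[OF G 4(1-6)]]) (use 4(7) in auto)
next
  case (5 H D u v Q c)
  show ?case by (rule exec_weaken[OF exec_treat_dict[OF G 5(1-6)]]) (use 5(7) in auto)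
qed (rule G)

lemma exec_init_dict:
  assumes G: "simple_graph G"
  shows "exec 0 (init_dict d G) (\<lambda>s c. fst s = G \<and> queue s = edges G \<and>
      dict_of d G (snd (snd s)) \<and>
      c \<le> graph_cells G + dict_size d G + card (edges G))
    (graph_cells G +
      (\<Sum>e\<in>edges G. 3 + min_degree G e + card (W G e) + (d + 3) * edge_scan G (Suc d) e))
    0 (dict_space d G)"
    (is "exec 0 _ ?P _ _ _")
proof -
  let ?build = "\<Sum>e\<in>edges G. 3 + min_degree G e + card (W G e) + (d + 3) * edge_scan G (Suc d) e"
  have "exec 0 (init_dict d G) ?P
    (graph_cells G + (?build + 0)) (0 + (0 + 0)) (dict_space d G)"
    unfolding init_dict_def
  proof (rule exec_bind[OF exec_load_graph])
    show "card (verts G) + 3 * card (edges G) \<le> dict_space d G" using dict_space_ge[of G d] by simp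
    fix x c assume x: "x = (G, edges G) \<and> c = graph_cells G + card (edges G)"
    have "c + dict_size d G + (2 * d + 2) * card (edges G) + d + 1 \<le> dict_space d G"
      using x by (simp add: dict_space_def algebra_simps)
    then have "exec c (bind_prog (build_dict d G) (\<lambda>D. return (G, edges G, D)))
        ?P (?build + 0) (0 + 0) (dict_space d G)"
      by (intro exec_bind[OF exec_build_dict[OF G]]) (use x in \<open>auto intro!: exec_return simp: queue_def\<close>)
    then show "exec c (case x of (G, Q) \<Rightarrow> bind_prog (build_dict d G) (\<lambda>D. return (G, Q, D)))
        ?P (?build + 0) (0 + 0) (dict_space d G)"
      using x by simp
  qed
  then show ?thesis by simp
qed

section \<open>Asymptotic bounds\<close>

text \<open>
  Bounds that hold uniformly for all simple graphs, in powers of the square root of the number of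
  edges. Additive constants and the number of vertices are treated separately, since there may be
  no edges.
\<close>

definition edge_bounded :: "nat \<Rightarrow> (graph \<Rightarrow> nat) \<Rightarrow> bool" where
  "edge_bounded j f \<longleftrightarrow> (\<exists>C\<ge>0. \<forall>G. simple_graph G \<longrightarrow> real (f G) \<le> C * root_edges G ^ j)"

lemma edge_boundedE:
  assumes "edge_bounded j f"
  obtains C where "0 \<le> C" "\<And>G. simple_graph G \<Longrightarrow> real (f G) \<le> C * root_edges G ^ j"
  using assms unfolding edge_bounded_def by blast

lemma edge_bounded_le:
  assumes "\<And>G. simple_graph G \<Longrightarrow> f G \<le> g G" "edge_bounded j g"
  shows "edge_bounded j f"
proof -
  obtain C where "0 \<le> C" "\<And>G. simple_graph G \<Longrightarrow> real (g G) \<le> C * root_edges G ^ j"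
    using assms(2) by (rule edge_boundedE) blast
  then show ?thesis
    unfolding edge_bounded_def using assms(1) by (meson of_nat_mono order_trans)
qed

lemma edge_bounded_mono:
  assumes "edge_bounded i f" "1 \<le> i" "i \<le> j"
  shows "edge_bounded j f"
proof -
  obtain C where C: "0 \<le> C" "\<And>G. simple_graph G \<Longrightarrow> real (f G) \<le> C * root_edges G ^ i"
    using assms(1) by (rule edge_boundedE) blast
  have "real (f G) \<le> C * root_edges G ^ j" if "simple_graph G" for G
    using C(2)[OF that] mult_left_mono[OF root_edges_power_mono[OF assms(2,3), of G] C(1)]
    by linarith
  then show ?thesis unfolding edge_bounded_def using C(1) by blast
qed

lemma edge_bounded_add:
  assumes "edge_bounded j f" "edge_bounded j g"
  shows "edge_bounded j (\<lambda>G. f G + g G)"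
proof -
  obtain C where C: "0 \<le> C" "\<And>G. simple_graph G \<Longrightarrow> real (f G) \<le> C * root_edges G ^ j"
    using assms(1) by (rule edge_boundedE) blast
  obtain C' where C': "0 \<le> C'" "\<And>G. simple_graph G \<Longrightarrow> real (g G) \<le> C' * root_edges G ^ j"
    using assms(2) by (rule edge_boundedE) blast
  have "real (f G + g G) \<le> (C + C') * root_edges G ^ j" if "simple_graph G" for G
    using C(2)[OF that] C'(2)[OF that] by (simp add: distrib_right)
  then show ?thesis unfolding edge_bounded_def using C(1) C'(1) by (intro exI[of _ "C + C'"]) auto
qed

lemma edge_bounded_mult:
  assumes "edge_bounded i f" "edge_bounded j g"
  shows "edge_bounded (i + j) (\<lambda>G. f G * g G)"
proof -
  obtain C where C: "0 \<le> C" "\<And>G. simple_graph G \<Longrightarrow> real (f G) \<le> C * root_edges G ^ i"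
    using assms(1) by (rule edge_boundedE) blast
  obtain C' where C': "0 \<le> C'" "\<And>G. simple_graph G \<Longrightarrow> real (g G) \<le> C' * root_edges G ^ j"
    using assms(2) by (rule edge_boundedE) blast
  have "real (f G * g G) \<le> (C * C') * root_edges G ^ (i + j)" if "simple_graph G" for G
  proof -
    have "real (f G) * real (g G) \<le> (C * root_edges G ^ i) * (C' * root_edges G ^ j)"
      using C C' that by (intro mult_mono) auto
    then show ?thesis by (simp add: power_add mult_ac)
  qed
  then show ?thesis unfolding edge_bounded_def using C(1) C'(1) by (intro exI[of _ "C * C'"]) auto
qed

lemma edge_bounded_cmult:
  assumes "edge_bounded j f"
  shows "edge_bounded j (\<lambda>G. c * f G)"
proof -
  obtain C where C: "0 \<le> C" "\<And>G. simple_graph G \<Longrightarrow> real (f G) \<le> C * root_edges G ^ j"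
    using assms(1) by (rule edge_boundedE) blast
  have "real (c * f G) \<le> (real c * C) * root_edges G ^ j" if "simple_graph G" for G
    using mult_left_mono[OF C(2)[OF that], of "real c"] by (simp add: mult.assoc)
  then show ?thesis unfolding edge_bounded_def using C(1) by (intro exI[of _ "real c * C"]) auto
qed

lemma edge_bounded_edges: "edge_bounded 2 (\<lambda>G. card (edges G))"
  unfolding edge_bounded_def by (intro exI[of _ 1]) (simp add: root_edges_squared)

lemma edge_bounded_min_degree: "edge_bounded 3 (\<lambda>G. \<Sum>e\<in>edges G. min_degree G e)"
  unfolding edge_bounded_def by (intro exI[of _ 3]) (simp add: sum_min_degree_le_root)

lemma edge_bounded_min_degree_squared: "edge_bounded 4 (\<lambda>G. \<Sum>e\<in>edges G. (min_degree G e)\<^sup>2)"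
  unfolding edge_bounded_def by (intro exI[of _ 4]) (simp add: sum_min_degree_squared_le_root)

lemma edge_bounded_scan_cost: "edge_bounded (r + 2) (\<lambda>G. \<Sum>e\<in>edges G. edge_scan G r e)"
  unfolding edge_bounded_def using sum_scan_cost_edges[of r] by simp

lemma edge_bounded_linear:
  assumes "\<And>G e. simple_graph G \<Longrightarrow> e \<in> edges G \<Longrightarrow> f G e \<le> a + b * min_degree G e"
  shows "edge_bounded 3 (\<lambda>G. \<Sum>e\<in>edges G. f G e)"
proof (rule edge_bounded_le)
  show "(\<Sum>e\<in>edges G. f G e) \<le> a * card (edges G) + b * (\<Sum>e\<in>edges G. min_degree G e)"
    if "simple_graph G" for G
    using sum_mono[of "edges G", OF assms[OF that]]
    by (simp add: sum.distrib sum_distrib_left mult.commute)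
  show "edge_bounded 3 (\<lambda>G. a * card (edges G) + b * (\<Sum>e\<in>edges G. min_degree G e))"
    by (intro edge_bounded_add edge_bounded_cmult edge_bounded_min_degree
        edge_bounded_mono[OF edge_bounded_edges]) auto
qed

lemma edge_bounded_quadratic:
  assumes "\<And>G e. simple_graph G \<Longrightarrow> e \<in> edges G \<Longrightarrow>
    f G e \<le> a + b * min_degree G e + c * (min_degree G e)\<^sup>2"
  shows "edge_bounded 4 (\<lambda>G. \<Sum>e\<in>edges G. f G e)"
proof (rule edge_bounded_le)
  show "(\<Sum>e\<in>edges G. f G e) \<le> (\<Sum>e\<in>edges G. a + b * min_degree G e) +
      c * (\<Sum>e\<in>edges G. (min_degree G e)\<^sup>2)" if "simple_graph G" for G
    using sum_mono[of "edges G", OF assms[OF that]] by (simp add: sum.distrib sum_distrib_left)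
  show "edge_bounded 4 (\<lambda>G. (\<Sum>e\<in>edges G. a + b * min_degree G e) +
      c * (\<Sum>e\<in>edges G. (min_degree G e)\<^sup>2))"
    by (intro edge_bounded_add edge_bounded_cmult edge_bounded_min_degree_squared
        edge_bounded_mono[OF edge_bounded_linear[where a = a and b = b]]) auto
qed

lemma edge_bounded_requeue_cost:
  "edge_bounded (if inner then 4 else 3) (\<lambda>G. \<Sum>e\<in>edges G. requeue_cost inner G e)"
proof (cases inner)
  case True
  have le: "requeue_cost inner G e \<le> 1 + 6 * min_degree G e + 3 * (min_degree G e)\<^sup>2"
    if "simple_graph G" "e \<in> edges G" for G e
  proof -
    have w: "card (W G e) \<le> min_degree G e" using card_W_edge_le(1)[OF that] .
    have "card (W G e) * (2 + 3 * card (W G e)) \<le> min_degree G e * (2 + 3 * min_degree G e)"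
      using w by (intro mult_le_mono) auto
    then show ?thesis
      using w True by (simp add: requeue_cost_def power2_eq_square distrib_left mult_ac)
  qed
  show ?thesis using True edge_bounded_quadratic[OF le] by simp
next
  case False
  have le: "requeue_cost inner G e \<le> 1 + 4 * min_degree G e" if "simple_graph G" "e \<in> edges G" for G e
    using card_W_edge_le(1)[OF that] False by (simp add: requeue_cost_def)
  show ?thesis using False edge_bounded_linear[of "requeue_cost inner", OF le] by simp
qed

text \<open>
  The cost of all checks, if each check of \<open>e\<close> costs \<open>g e\<close>. In general a deletion may put all edges
  back, which costs a factor \<open>m\<close>. If \<open>inner\<close> is false, the sum is regrouped by the edge put back.
\<close>

definition all_checks :: "bool \<Rightarrow> graph \<Rightarrow> (nat set \<Rightarrow> nat) \<Rightarrow> nat" where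
  "all_checks inner G g =
     (\<Sum>e\<in>edges G. g e) + (\<Sum>e\<in>edges G. \<Sum>f\<in>requeued_by inner G e. g f)"

lemma edge_bounded_all_checks:
  assumes "edge_bounded j (\<lambda>G. \<Sum>e\<in>edges G. g G e)" "1 \<le> j"
  shows "edge_bounded (j + 2) (\<lambda>G. all_checks inner G (g G))"
proof (rule edge_bounded_le)
  show "all_checks inner G (g G) \<le>
      (\<Sum>e\<in>edges G. g G e) + (\<Sum>e\<in>edges G. g G e) * card (edges G)" if "simple_graph G" for G
    using sum_requeued_le[OF that, of "g G" inner] by (simp add: all_checks_def mult.commute)
  show "edge_bounded (j + 2) (\<lambda>G. (\<Sum>e\<in>edges G. g G e) + (\<Sum>e\<in>edges G. g G e) * card (edges G))"
    using assms by (intro edge_bounded_add edge_bounded_mult edge_bounded_edges)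
      (auto elim: edge_bounded_mono)
qed

lemma all_checks_outer_le:
  assumes "simple_graph G"
  shows "all_checks False G g \<le> (\<Sum>e\<in>edges G. (1 + 2 * card (W G e)) * g e)"
  using sum_requeued_outer_le[OF assms, of g]
  by (simp add: all_checks_def sum.distrib distrib_right)

lemma edge_bounded_all_checks_outer:
  assumes "edge_bounded j (\<lambda>G. \<Sum>e\<in>edges G. (1 + 2 * card (W G e)) * g G e)"
  shows "edge_bounded j (\<lambda>G. all_checks False G (g G))"
  by (rule edge_bounded_le[OF _ assms]) (rule all_checks_outer_le)

lemma edge_bounded_num_calls:
  "edge_bounded (d + 4) (\<lambda>G. all_checks True G (edge_scan G d))"
  using edge_bounded_all_checks[OF edge_bounded_scan_cost[of d], of True] by (simp add: numeral_eq_Suc)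

lemma edge_bounded_num_calls_outer:
  "edge_bounded 3 (\<lambda>G. all_checks False G (edge_scan G 0))"
proof (rule edge_bounded_all_checks_outer)
  show "edge_bounded 3 (\<lambda>G. \<Sum>e\<in>edges G. (1 + 2 * card (W G e)) * edge_scan G 0 e)"
    by (rule edge_bounded_linear[where a = 1 and b = 2]) (use card_W_edge_le(1) in auto)
qed

definition recompute_steps :: "bool \<Rightarrow> nat \<Rightarrow> graph \<Rightarrow> nat" where
  "recompute_steps inner d G = 2 * card (edges G) + all_checks inner G (\<lambda>e. 2 + recompute_check d G e) +
     (\<Sum>e\<in>edges G. requeue_cost inner G e + 1)"

lemma edge_bounded_recompute_steps: "edge_bounded (d + 5) (recompute_steps True d)"
proof -
  have "edge_bounded (d + 3) (\<lambda>G. \<Sum>e\<in>edges G. 3 + min_degree G e)"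
    by (rule edge_bounded_mono[OF edge_bounded_linear[where a = 3 and b = 1]]) auto
  then have "edge_bounded (d + 3) (\<lambda>G. (\<Sum>e\<in>edges G. 3 + min_degree G e) +
      3 * (\<Sum>e\<in>edges G. edge_scan G (Suc d) e))"
    using edge_bounded_scan_cost[of "Suc d"]
    by (intro edge_bounded_add edge_bounded_cmult) (simp_all add: numeral_eq_Suc)
  then have "edge_bounded (d + 3) (\<lambda>G. \<Sum>e\<in>edges G. 2 + recompute_check d G e)"
  proof (rule edge_bounded_le[rotated])
    show "(\<Sum>e\<in>edges G. 2 + recompute_check d G e) \<le> (\<Sum>e\<in>edges G. 3 + min_degree G e) +
        3 * (\<Sum>e\<in>edges G. edge_scan G (Suc d) e)" for G
      unfolding sum_distrib_left sum.distrib[symmetric]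
      by (intro sum_mono) (simp add: recompute_check_def)
  qed
  from edge_bounded_all_checks[OF this]
  have checks: "edge_bounded (d + 5) (\<lambda>G. all_checks True G (\<lambda>e. 2 + recompute_check d G e))"
    by (simp add: numeral_eq_Suc)
  show ?thesis
    unfolding recompute_steps_def[abs_def] sum.distrib
    using checks edge_bounded_requeue_cost[of True] edge_bounded_edges
    by (intro edge_bounded_add edge_bounded_cmult)
      (auto intro: edge_bounded_mono)
qed

lemma edge_bounded_recompute_steps_outer: "edge_bounded 4 (recompute_steps False 0)"
proof -
  have "edge_bounded 4 (\<lambda>G. \<Sum>e\<in>edges G. (1 + 2 * card (W G e)) * (2 + recompute_check 0 G e))"
  proof (rule edge_bounded_quadratic[where a = 6 and b = 16 and c = 8])
    fix G e assume "simple_graph G" "e \<in> edges G"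
    then have w: "card (W G e) \<le> min_degree G e" by (rule card_W_edge_le(1))
    have "(1 + 2 * card (W G e)) * (2 + recompute_check 0 G e) \<le>
        (1 + 2 * min_degree G e) * (6 + 4 * min_degree G e)"
      using w by (intro mult_le_mono) (auto simp: recompute_check_def)
    also have "\<dots> = 6 + 16 * min_degree G e + 8 * (min_degree G e)\<^sup>2"
      by (simp add: algebra_simps power2_eq_square)
    finally show "(1 + 2 * card (W G e)) * (2 + recompute_check 0 G e) \<le>
        6 + 16 * min_degree G e + 8 * (min_degree G e)\<^sup>2" .
  qed
  then have checks: "edge_bounded 4 (\<lambda>G. all_checks False G (\<lambda>e. 2 + recompute_check 0 G e))"
    by (rule edge_bounded_all_checks_outer)
  show ?thesis
    unfolding recompute_steps_def[abs_def] sum.distrib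
    using checks edge_bounded_requeue_cost[of False] edge_bounded_edges
    by (intro edge_bounded_add edge_bounded_cmult)
      (auto intro: edge_bounded_mono)
qed

definition dict_steps :: "bool \<Rightarrow> nat \<Rightarrow> graph \<Rightarrow> nat" where
  "dict_steps inner d G = 2 * card (edges G) +
     (\<Sum>e\<in>edges G. 3 + min_degree G e + card (W G e) + (d + 3) * edge_scan G (Suc d) e) +
     all_checks inner G (\<lambda>e. 2 + dict_check d G e) +
     (\<Sum>e\<in>edges G. requeue_cost inner G e + update_cost d G e + 1)"

lemma edge_bounded_build:
  "edge_bounded (d + 3) (\<lambda>G. \<Sum>e\<in>edges G. 3 + min_degree G e + card (W G e) + (d + 3) * edge_scan G (Suc d) e)"
proof -
  have "edge_bounded (d + 3) (\<lambda>G. \<Sum>e\<in>edges G. 3 + min_degree G e + card (W G e))"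
    by (rule edge_bounded_mono[OF edge_bounded_linear[where a = 3 and b = 2]])
      (use card_W_edge_le(1) in auto)
  moreover have "edge_bounded (d + 3) (\<lambda>G. (d + 3) * (\<Sum>e\<in>edges G. edge_scan G (Suc d) e))"
    using edge_bounded_scan_cost[of "Suc d"] by (intro edge_bounded_cmult) (simp add: numeral_eq_Suc)
  ultimately have "edge_bounded (d + 3) (\<lambda>G. (\<Sum>e\<in>edges G. 3 + min_degree G e + card (W G e)) +
      (d + 3) * (\<Sum>e\<in>edges G. edge_scan G (Suc d) e))"
    by (rule edge_bounded_add)
  then show ?thesis
    by (rule edge_bounded_le[rotated]) (simp add: sum.distrib sum_distrib_left)
qed

text \<open>
  When an edge is deleted, the dictionary entries to be removed hold up to \<open>m\<close> vertices each; there
  are few enough of them for this crude bound.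
\<close>

lemma edge_bounded_update_cost: "edge_bounded (d + 4) (\<lambda>G. \<Sum>e\<in>edges G. update_cost d G e)"
proof (rule edge_bounded_le)
  show "(\<Sum>e\<in>edges G. update_cost d G e) \<le> (\<Sum>e\<in>edges G. 2 + 2 * min_degree G e) +
      4 * (\<Sum>e\<in>edges G. edge_scan G (Suc d) e) +
      ((d + 6) * (\<Sum>e\<in>edges G. edge_scan G d e) +
        (\<Sum>e\<in>edges G. edge_scan G d e) * card (edges G))" if G: "simple_graph G" for G
  proof -
    have "update_cost d G e \<le> (2 + 2 * min_degree G e) + 4 * edge_scan G (Suc d) e +
        ((d + 6) * edge_scan G d e + edge_scan G d e * card (edges G))" if "e \<in> edges G" for e
    proof -
      have "card (W G e) * edge_scan G d e \<le> card (edges G) * edge_scan G d e"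
        using card_W_edge_le(2)[OF G that] by (rule mult_le_mono1)
      then show ?thesis by (simp add: update_cost_def algebra_simps)
    qed
    from sum_mono[OF this] show ?thesis
      by (simp only: sum.distrib sum_distrib_left sum_distrib_right)
  qed
  have "edge_bounded (d + 4) (\<lambda>G. \<Sum>e\<in>edges G. 2 + 2 * min_degree G e)"
    by (rule edge_bounded_mono[OF edge_bounded_linear[where a = 2 and b = 2]]) auto
  moreover have "edge_bounded (d + 4) (\<lambda>G. \<Sum>e\<in>edges G. edge_scan G (Suc d) e)"
    by (rule edge_bounded_mono[OF edge_bounded_scan_cost]) auto
  moreover have "edge_bounded (d + 4) (\<lambda>G. \<Sum>e\<in>edges G. edge_scan G d e)"
    by (rule edge_bounded_mono[OF edge_bounded_scan_cost]) auto
  moreover have "edge_bounded (d + 4) (\<lambda>G. (\<Sum>e\<in>edges G. edge_scan G d e) * card (edges G))"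
    using edge_bounded_mult[OF edge_bounded_scan_cost[of d] edge_bounded_edges] by (simp add: numeral_eq_Suc)
  ultimately show "edge_bounded (d + 4) (\<lambda>G. (\<Sum>e\<in>edges G. 2 + 2 * min_degree G e) +
      4 * (\<Sum>e\<in>edges G. edge_scan G (Suc d) e) +
      ((d + 6) * (\<Sum>e\<in>edges G. edge_scan G d e) +
        (\<Sum>e\<in>edges G. edge_scan G d e) * card (edges G)))"
    by (intro edge_bounded_add edge_bounded_cmult)
qed

lemma edge_bounded_dict_steps: "edge_bounded (d + 4) (dict_steps True d)"
proof -
  have "edge_bounded (d + 2) (\<lambda>G. \<Sum>e\<in>edges G. 2 + dict_check d G e)"
  proof (cases "d = 0")
    case True
    show ?thesis
      unfolding True add_0
      by (rule edge_bounded_le[rotated, OF edge_bounded_cmult[OF edge_bounded_edges, of 4]])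
        (simp add: dict_check_def)
  next
    case False
    then have "edge_bounded (d + 2) (\<lambda>G. \<Sum>e\<in>edges G. 3 + min_degree G e)"
      by (intro edge_bounded_mono[OF edge_bounded_linear[where a = 3 and b = 1]]) auto
    then have "edge_bounded (d + 2) (\<lambda>G. (\<Sum>e\<in>edges G. 3 + min_degree G e) +
        4 * (\<Sum>e\<in>edges G. edge_scan G d e))"
      using edge_bounded_scan_cost[of d] by (intro edge_bounded_add edge_bounded_cmult)
    then show ?thesis
    proof (rule edge_bounded_le[rotated])
      show "(\<Sum>e\<in>edges G. 2 + dict_check d G e) \<le> (\<Sum>e\<in>edges G. 3 + min_degree G e) +
          4 * (\<Sum>e\<in>edges G. edge_scan G d e)" for G
        unfolding sum_distrib_left sum.distrib[symmetric]
        by (intro sum_mono) (simp add: False dict_check_def)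
    qed
  qed
  from edge_bounded_all_checks[OF this]
  have checks: "edge_bounded (d + 4) (\<lambda>G. all_checks True G (\<lambda>e. 2 + dict_check d G e))"
    by (simp add: numeral_eq_Suc)
  have "edge_bounded (d + 4) (\<lambda>G. \<Sum>e\<in>edges G. requeue_cost True G e)"
    using edge_bounded_requeue_cost[of True] by (auto intro: edge_bounded_mono)
  moreover have "edge_bounded (d + 4) (\<lambda>G. \<Sum>e\<in>edges G. 1)"
    using edge_bounded_edges by (auto intro: edge_bounded_mono)
  moreover have "edge_bounded (d + 4) (\<lambda>G. card (edges G))"
    by (rule edge_bounded_mono[OF edge_bounded_edges]) auto
  ultimately show ?thesis
    unfolding dict_steps_def[abs_def] sum.distrib[of "\<lambda>e. _ e + update_cost d _ e"]
      sum.distrib[of "requeue_cost _ _"]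
    using checks edge_bounded_update_cost[of d]
    by (intro edge_bounded_add edge_bounded_cmult edge_bounded_mono[OF edge_bounded_build[of d]]) auto
qed

lemma edge_bounded_dict_steps_outer: "edge_bounded 3 (dict_steps False 0)"
proof -
  have "edge_bounded 3 (\<lambda>G. \<Sum>e\<in>edges G. (1 + 2 * card (W G e)) * (2 + dict_check 0 G e))"
    using card_W_edge_le(1)
    by (intro edge_bounded_linear[where a = 4 and b = 8]) (auto simp: dict_check_def)
  then have checks: "edge_bounded 3 (\<lambda>G. all_checks False G (\<lambda>e. 2 + dict_check 0 G e))"
    by (rule edge_bounded_all_checks_outer)
  have delete: "edge_bounded 3 (\<lambda>G. \<Sum>e\<in>edges G. requeue_cost False G e + update_cost 0 G e + 1)"
  proof (rule edge_bounded_linear[where a = 14 and b = 11])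
    fix G e assume "simple_graph G" "e \<in> edges G"
    from card_W_edge_le(1)[OF this]
    show "requeue_cost False G e + update_cost 0 G e + 1 \<le> 14 + 11 * min_degree G e"
      by (simp add: requeue_cost_def update_cost_def)
  qed
  show ?thesis
    unfolding dict_steps_def[abs_def]
    using checks delete edge_bounded_build[of 0]
    by (intro edge_bounded_add edge_bounded_cmult edge_bounded_mono[OF edge_bounded_edges]) auto
qed

lemma edge_bounded_dict_size: "edge_bounded (d + 3) (dict_size d)"
proof -
  have "edge_bounded (d + 3) (\<lambda>G. (d + 3) * (\<Sum>e\<in>edges G. edge_scan G (Suc d) e))"
    using edge_bounded_scan_cost[of "Suc d"] by (intro edge_bounded_cmult) (simp add: numeral_eq_Suc)
  then show ?thesis by (simp add: dict_size_def[abs_def] sum_distrib_left)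
qed

section \<open>Correctness and resource bounds\<close>

lemma root_edges_power:
  assumes "0 < j"
  shows "root_edges G ^ j = real (card (edges G)) powr (real j / 2)"
proof (cases "card (edges G) = 0")
  case True
  then show ?thesis using assms by (simp add: root_edges_def power_0_left)
next
  case False
  then show ?thesis
    by (simp add: root_edges_def powr_half_sqrt[symmetric] powr_realpow[symmetric] powr_powr)
qed

lemma root_edges_powr:
  "root_edges G ^ (d + 4) = real (card (edges G)) powr ((real d + 4) / 2)"
  "root_edges G ^ (d + 3) = real (card (edges G)) powr ((real d + 3) / 2)"
  "root_edges G ^ 3 = real (card (edges G)) powr (3 / 2)"
  using root_edges_power[of "d + 4" G] root_edges_power[of "d + 3" G] root_edges_power[of 3 G]
  by (simp_all add: add.commute)

text \<open>The additive constant 1 of the step count is absorbed by \<open>n\<close>, as there is a vertex.\<close>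

lemma time_bound:
  assumes S: "edge_bounded i S" and K: "edge_bounded j K"
  shows "\<exists>C>0. \<forall>G tr w. simple_graph G \<longrightarrow> 1 \<le> card (verts G) \<longrightarrow>
    step_count tr \<le> card (verts G) + 1 + S G \<longrightarrow> call_count tr \<le> K G \<longrightarrow> amortized_call_time w tr \<longrightarrow>
    real (time tr) \<le> C * (real (card (verts G)) + root_edges G ^ i + w * root_edges G ^ j)"
proof -
  obtain C where C: "0 \<le> C" "\<And>G. simple_graph G \<Longrightarrow> real (S G) \<le> C * root_edges G ^ i"
    using S by (rule edge_boundedE) blast
  obtain C' where C': "0 \<le> C'" "\<And>G. simple_graph G \<Longrightarrow> real (K G) \<le> C' * root_edges G ^ j"
    using K by (rule edge_boundedE) blast
  have "real (time tr) \<le> (2 + C + C') * (real (card (verts G)) + root_edges G ^ i + w * root_edges G ^ j)"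
    if G: "simple_graph G" and n: "1 \<le> card (verts G)" and s: "step_count tr \<le> card (verts G) + 1 + S G"
      and k: "call_count tr \<le> K G" and w: "amortized_call_time w tr" for G tr w
  proof -
    let ?s = "root_edges G" and ?n = "real (card (verts G))"
    have w1: "1 \<le> w" and "real (sum_list (map fst (calls tr))) \<le> w * real (call_count tr)"
      using w by (auto simp: amortized_call_time_def call_count_def)
    moreover have "w * real (call_count tr) \<le> w * (C' * ?s ^ j)"
      using w1 k C'(2)[OF G] by (intro mult_left_mono) auto
    moreover have "real (step_count tr) \<le> 2 * ?n + C * ?s ^ i" using s n C(2)[OF G] by linarith
    ultimately have "real (time tr) \<le> 2 * ?n + C * ?s ^ i + w * (C' * ?s ^ j)"
      unfolding time_eq of_nat_add by linarith
    also have "\<dots> \<le> (2 + C + C') * ?n + (2 + C + C') * ?s ^ i + (2 + C + C') * (w * ?s ^ j)"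
    proof -
      have "w * (C' * ?s ^ j) = C' * (w * ?s ^ j)" by simp
      moreover have "C' * (w * ?s ^ j) \<le> (2 + C + C') * (w * ?s ^ j)"
        using C(1) w1 by (intro mult_right_mono) auto
      moreover have "C * ?s ^ i \<le> (2 + C + C') * ?s ^ i" "2 * ?n \<le> (2 + C + C') * ?n"
        using C(1) C'(1) by (auto intro!: mult_right_mono)
      ultimately show ?thesis by linarith
    qed
    finally show ?thesis by (simp add: distrib_left)
  qed
  then show ?thesis using C(1) C'(1) by (intro exI[of _ "2 + C + C'"]) auto
qed

lemma recompute_execution:
  assumes G: "simple_graph G"
  shows "always_terminates (init_recompute G) (body_recompute k d \<omega>u)"
    and "(G', tr) \<in> outcomes (truss_recompute k d \<omega>u G) \<Longrightarrow> truss_output k d \<omega>u G G' \<and>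
      step_count tr \<le> card (verts G) + 1 + recompute_steps (0 < d \<or> edge_sensitive \<omega>u) d G \<and>
      call_count tr \<le> all_checks (0 < d \<or> edge_sensitive \<omega>u) G (edge_scan G d) \<and>
      high 0 tr \<le> recompute_space d G"
      (is "_ \<Longrightarrow> ?R")
proof -
  note E = peeling_implementation.execute_outcome[OF recompute_implementation[OF G] exec_init_recompute]
  show "always_terminates (init_recompute G) (body_recompute k d \<omega>u)" by (rule E(1))
  assume "(G', tr) \<in> outcomes (truss_recompute k d \<omega>u G)"
  from E(2)[OF this[unfolded truss_recompute_def]]
  show ?R
    unfolding recompute_steps_def all_checks_def by linarith
qed

lemma dict_execution:
  assumes G: "simple_graph G"
  shows "always_terminates (init_dict d G) (body_dict k d \<omega>u)"
    and "(G', tr) \<in> outcomes (truss_dict k d \<omega>u G) \<Longrightarrow> truss_output k d \<omega>u G G' \<and>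
      step_count tr \<le> card (verts G) + 1 + dict_steps (0 < d \<or> edge_sensitive \<omega>u) d G \<and>
      call_count tr \<le> all_checks (0 < d \<or> edge_sensitive \<omega>u) G (edge_scan G d) \<and>
      high 0 tr \<le> dict_space d G"
      (is "_ \<Longrightarrow> ?R")
proof -
  note E = peeling_implementation.execute_outcome[OF dict_implementation[OF G] exec_init_dict[OF G]]
  show "always_terminates (init_dict d G) (body_dict k d \<omega>u)" by (rule E(1))
  assume "(G', tr) \<in> outcomes (truss_dict k d \<omega>u G)"
  from E(2)[OF this[unfolded truss_dict_def]]
  show ?R
    unfolding dict_steps_def all_checks_def by linarith
qed

text \<open>The exponents \<open>i\<close> and \<open>j\<close> belong to the two rules for putting edges back.\<close>

definition time_within ::
    "real \<Rightarrow> nat \<Rightarrow> nat \<Rightarrow> nat \<Rightarrow> (nat \<Rightarrow> (graph \<Rightarrow> nat) \<Rightarrow> graph \<Rightarrow> graph prog) \<Rightarrow> bool" where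
  "time_within C d i j prog \<longleftrightarrow> (\<forall>k \<omega>u G G' tr w. simple_graph G \<and> 1 \<le> card (verts G) \<and>
     (G', tr) \<in> outcomes (prog k \<omega>u G) \<and> amortized_call_time w tr \<longrightarrow>
     (0 < d \<or> edge_sensitive \<omega>u \<longrightarrow>
       real (time tr) \<le> C * (real (card (verts G)) + root_edges G ^ i + w * root_edges G ^ (d + 4))) \<and>
     (d = 0 \<and> \<not> edge_sensitive \<omega>u \<longrightarrow>
       real (time tr) \<le> C * (real (card (verts G)) + root_edges G ^ j + w * root_edges G ^ 3)))"

text \<open>
  The time of either implementation, given its number of steps apart from a contribution of \<open>n\<close>
  vertices and one final test. Both perform the same calls.
\<close>

lemma peeling_time:
  fixes prog :: "nat \<Rightarrow> (graph \<Rightarrow> nat) \<Rightarrow> graph \<Rightarrow> graph prog"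
  assumes run: "\<And>k \<omega>u G G' tr. simple_graph G \<Longrightarrow> (G', tr) \<in> outcomes (prog k \<omega>u G) \<Longrightarrow>
      step_count tr \<le> card (verts G) + 1 + S (0 < d \<or> edge_sensitive \<omega>u) d G \<and>
      call_count tr \<le> all_checks (0 < d \<or> edge_sensitive \<omega>u) G (edge_scan G d)"
    and inner: "edge_bounded i (S True d)" and outer: "edge_bounded j (S False 0)"
  shows "\<exists>C>0. time_within C d i j prog"
proof -
  obtain C1 where C1: "0 < C1" and time1: "\<And>G tr w. simple_graph G \<Longrightarrow> 1 \<le> card (verts G) \<Longrightarrow>
      step_count tr \<le> card (verts G) + 1 + S True d G \<Longrightarrow>
      call_count tr \<le> all_checks True G (edge_scan G d) \<Longrightarrow> amortized_call_time w tr \<Longrightarrow>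
      real (time tr) \<le> C1 * (real (card (verts G)) + root_edges G ^ i + w * root_edges G ^ (d + 4))"
    using time_bound[OF inner edge_bounded_num_calls] by blast
  obtain C2 where C2: "0 < C2" and time2: "\<And>G tr w. simple_graph G \<Longrightarrow> 1 \<le> card (verts G) \<Longrightarrow>
      step_count tr \<le> card (verts G) + 1 + S False 0 G \<Longrightarrow>
      call_count tr \<le> all_checks False G (edge_scan G 0) \<Longrightarrow> amortized_call_time w tr \<Longrightarrow>
      real (time tr) \<le> C2 * (real (card (verts G)) + root_edges G ^ j + w * root_edges G ^ 3)"
    using time_bound[OF outer edge_bounded_num_calls_outer] by blast
  have grow: "t \<le> max C1 C2 * x" if "t \<le> B * x" "B \<le> max C1 C2" "0 \<le> x" for t B x :: real
    using that mult_right_mono order_trans by blast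
  have "time_within (max C1 C2) d i j prog"
    unfolding time_within_def
  proof (intro allI impI, elim conjE, intro conjI impI)
    fix k \<omega>u G G' tr w
    assume G: "simple_graph G" "1 \<le> card (verts G)" and out: "(G', tr) \<in> outcomes (prog k \<omega>u G)"
      and w: "amortized_call_time w tr"
    note E = run[OF G(1) out]
    have w0: "0 \<le> w" using w by (simp add: amortized_call_time_def)
    show "real (time tr) \<le>
        max C1 C2 * (real (card (verts G)) + root_edges G ^ i + w * root_edges G ^ (d + 4))"
      if "0 < d \<or> edge_sensitive \<omega>u"
      by (rule grow[OF time1[OF G _ _ w]]) (use E that w0 in auto)
    show "real (time tr) \<le>
        max C1 C2 * (real (card (verts G)) + root_edges G ^ j + w * root_edges G ^ 3)"
      if "d = 0 \<and> \<not> edge_sensitive \<omega>u"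
      by (rule grow[OF time2[OF G _ _ w]]) (use E that w0 in auto)
  qed
  then show ?thesis using C1 by (intro exI[of _ "max C1 C2"]) simp
qed

lemma recompute_space_bound:
  assumes G: "simple_graph G" "1 \<le> card (verts G)" and ws: "call_space ws tr"
    and out: "(G', tr) \<in> outcomes (truss_recompute k d \<omega>u G)"
  shows "real (space tr) \<le> real (2 * d + 8) * (real (card (verts G)) + real (card (edges G)) + real ws)"
proof -
  have "high 0 tr \<le> recompute_space d G" using recompute_execution(2)[OF G(1) out] by blast
  then have "space tr \<le> recompute_space d G + ws"
    using peak_le[OF ws, of 0] by (simp add: space_def)
  also have "\<dots> \<le> (2 * d + 8) * (card (verts G) + card (edges G) + ws)"
  proof -
    have "(d + 4) * 1 \<le> (d + 4) * card (verts G)" using G(2) by (rule mult_le_mono2)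
    moreover have "1 * ws \<le> (2 * d + 8) * ws" by (rule mult_le_mono1) simp
    ultimately show ?thesis by (simp add: recompute_space_def algebra_simps)
  qed
  finally have "real (space tr) \<le> real ((2 * d + 8) * (card (verts G) + card (edges G) + ws))"
    by (rule of_nat_mono)
  then show ?thesis by (simp only: of_nat_mult of_nat_add)
qed

lemma dict_space_bound:
  "\<exists>C>0. \<forall>k \<omega>u G G' tr ws. simple_graph G \<longrightarrow> 1 \<le> card (verts G) \<longrightarrow>
     (G', tr) \<in> outcomes (truss_dict k d \<omega>u G) \<longrightarrow> call_space ws tr \<longrightarrow>
     real (space tr) \<le> C * (real (card (verts G)) + root_edges G ^ (d + 3) + real ws)"
proof -
  have "edge_bounded (d + 3) (\<lambda>G. dict_size d G + (2 * d + 8) * card (edges G))"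
    by (intro edge_bounded_add edge_bounded_dict_size edge_bounded_cmult
        edge_bounded_mono[OF edge_bounded_edges]) auto
  then obtain C where C: "0 \<le> C" "\<And>G. simple_graph G \<Longrightarrow>
      real (dict_size d G + (2 * d + 8) * card (edges G)) \<le> C * root_edges G ^ (d + 3)"
    by (rule edge_boundedE) blast
  let ?C = "real (d + 5) + C"
  have "real (space tr) \<le> ?C * (real (card (verts G)) + root_edges G ^ (d + 3) + real ws)"
    if G: "simple_graph G" "1 \<le> card (verts G)" and ws: "call_space ws tr"
      and out: "(G', tr) \<in> outcomes (truss_dict k d \<omega>u G)" for k \<omega>u G G' tr ws
  proof -
    let ?n = "real (card (verts G))" and ?x = "root_edges G ^ (d + 3)"
    have "high 0 tr \<le> dict_space d G" using dict_execution(2)[OF G(1) out] by blast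
    then have "space tr \<le> dict_space d G + ws"
      using peak_le[OF ws, of 0] by (simp add: space_def)
    moreover have "(d + 4) * 1 \<le> (d + 4) * card (verts G)" using G(2) by (rule mult_le_mono2)
    ultimately have "space tr \<le> (d + 5) * card (verts G) +
        (dict_size d G + (2 * d + 8) * card (edges G)) + ws"
      by (simp add: dict_space_def algebra_simps)
    then have "real (space tr) \<le> real ((d + 5) * card (verts G) +
        (dict_size d G + (2 * d + 8) * card (edges G)) + ws)" by (rule of_nat_mono)
    then have "real (space tr) \<le> real (d + 5) * ?n +
        real (dict_size d G + (2 * d + 8) * card (edges G)) + real ws"
      by (simp only: of_nat_add of_nat_mult)
    also have "\<dots> \<le> real (d + 5) * ?n + C * ?x + real ws" using C(2)[OF G(1)] by simp
    also have "\<dots> \<le> ?C * ?n + ?C * ?x + ?C * real ws"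
    proof (intro add_mono)
      show "real (d + 5) * ?n \<le> ?C * ?n" "C * ?x \<le> ?C * ?x"
        using C(1) by (auto intro!: mult_right_mono)
      show "real ws \<le> ?C * real ws" using C(1) mult_right_mono[of 1 ?C "real ws"] by simp
    qed
    finally show ?thesis by (simp only: distrib_left)
  qed
  then show ?thesis using C(1) by (intro exI[of _ ?C]) auto
qed

theorem proposition19:
  fixes d :: nat
  shows
    "(\<forall>k \<omega>u G. d \<le> k \<and> MCP_upper_bound \<omega>u \<and> simple_graph G \<longrightarrow>
        terminates (truss_step k d \<omega>u) (\<lambda>(H, Q). Q = {}) (G, edges G) \<and>
        (increasing \<omega>u \<longrightarrow>
          (\<forall>G'. truss_output k d \<omega>u G G' \<longrightarrow>
             is_truss k d \<omega>u G G' \<and> (\<forall>H. is_truss k d \<omega>u G H \<longrightarrow> H = G')))) \<and>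
     (\<forall>k \<omega>u G. d \<le> k \<and> MCP_upper_bound \<omega>u \<and> simple_graph G \<longrightarrow>
        always_terminates (init_recompute G) (body_recompute k d \<omega>u) \<and>
        (\<forall>(G', tr)\<in>outcomes (truss_recompute k d \<omega>u G). truss_output k d \<omega>u G G')) \<and>
     (\<exists>C::real. 0 < C \<and>
        (\<forall>k \<omega>u G n m w ws. d \<le> k \<and> MCP_upper_bound \<omega>u \<and> simple_graph G \<and>
           n = real (card (verts G)) \<and> m = real (card (edges G)) \<and> 1 \<le> n \<longrightarrow>
           (\<forall>(G', tr)\<in>outcomes (truss_recompute k d \<omega>u G).
              amortized_call_time w tr \<and> call_space ws tr \<longrightarrow>
              real (space tr) \<le> C * (n + m + real ws) \<and>
              (0 < d \<or> edge_sensitive \<omega>u \<longrightarrow>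
                 real (time tr) \<le> C * (n + (sqrt m + w) * m powr ((real d + 4) / 2))) \<and>
              (d = 0 \<and> \<not> edge_sensitive \<omega>u \<longrightarrow>
                 real (time tr) \<le> C * (n + (sqrt m + w) * m powr (3 / 2)))))) \<and>
     (\<forall>k \<omega>u G. d \<le> k \<and> MCP_upper_bound \<omega>u \<and> simple_graph G \<longrightarrow>
        always_terminates (init_dict d G) (body_dict k d \<omega>u) \<and>
        (\<forall>(G', tr)\<in>outcomes (truss_dict k d \<omega>u G). truss_output k d \<omega>u G G')) \<and>
     (\<exists>C::real. 0 < C \<and>
        (\<forall>k \<omega>u G n m w ws. d \<le> k \<and> MCP_upper_bound \<omega>u \<and> simple_graph G \<and>
           n = real (card (verts G)) \<and> m = real (card (edges G)) \<and> 1 \<le> n \<longrightarrow>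
           (\<forall>(G', tr)\<in>outcomes (truss_dict k d \<omega>u G).
              amortized_call_time w tr \<and> call_space ws tr \<longrightarrow>
              real (space tr) \<le> C * (n + m powr ((real d + 3) / 2) + real ws) \<and>
              (0 < d \<or> edge_sensitive \<omega>u \<longrightarrow>
                 real (time tr) \<le> C * (n + w * m powr ((real d + 4) / 2))) \<and>
              (d = 0 \<and> \<not> edge_sensitive \<omega>u \<longrightarrow>
                 real (time tr) \<le> C * (n + w * m powr (3 / 2))))))"
proof (intro conjI, goal_cases)
  case 1
  show ?case
    using peeling_terminates peeling_output_is_the_truss by (auto simp: peeling_invariant_def)
next
  case 2
  show ?case using recompute_execution by fast
next
  case 3
  have "\<exists>C>0. time_within C d (d + 5) 4 (\<lambda>k. truss_recompute k d)"
    by (rule peeling_time[where S = recompute_steps, OF _ edge_bounded_recompute_steps edge_bounded_recompute_steps_outer])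
      (use recompute_execution(2) in blast)
  then obtain C where C: "0 < C" and T: "time_within C d (d + 5) 4 (\<lambda>k. truss_recompute k d)" by blast
  let ?C = "max C (real (2 * d + 8))"
  have split: "root_edges G ^ (d + 5) + w * root_edges G ^ (d + 4) =
        (sqrt (real (card (edges G))) + w) * real (card (edges G)) powr ((real d + 4) / 2)"
      "root_edges G ^ 4 + w * root_edges G ^ 3 =
        (sqrt (real (card (edges G))) + w) * real (card (edges G)) powr (3 / 2)" for G w
    unfolding root_edges_powr[symmetric] by (simp_all add: root_edges_def distrib_right numeral_eq_Suc)
  have grow: "x \<le> ?C * y" if "x \<le> B * y" "0 \<le> y" "B \<le> ?C" for x y B
    using that mult_right_mono order_trans by blast
  show ?case
  proof (rule exI[of _ ?C], intro conjI allI impI ballI, use C in simp, clarify, intro conjI impI)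
    fix k \<omega>u G w ws G' tr
    assume G: "simple_graph G" and n: "1 \<le> real (card (verts G))"
      and out: "(G', tr) \<in> outcomes (truss_recompute k d \<omega>u G)"
      and w: "amortized_call_time w tr" and ws: "call_space ws tr"
    have n1: "1 \<le> card (verts G)" and w0: "0 \<le> w" using n w by (simp_all add: amortized_call_time_def)
    note time = T[unfolded time_within_def, rule_format, OF conjI[OF G conjI[OF n1 conjI[OF out w]]]]
    show "real (space tr) \<le> ?C * (real (card (verts G)) + real (card (edges G)) + real ws)"
      by (rule grow[OF recompute_space_bound[OF G n1 ws out]]) auto
    show "real (time tr) \<le> ?C * (real (card (verts G)) +
        (sqrt (real (card (edges G))) + w) * real (card (edges G)) powr ((real d + 4) / 2))"
      if "0 < d \<or> edge_sensitive \<omega>u"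
      by (rule grow[OF mp[OF conjunct1[OF time] that, unfolded add.assoc split]]) (use w0 in auto)
    show "real (time tr) \<le> ?C * (real (card (verts G)) +
        (sqrt (real (card (edges G))) + w) * real (card (edges G)) powr (3 / 2))"
      if "d = 0 \<and> \<not> edge_sensitive \<omega>u"
      by (rule grow[OF mp[OF conjunct2[OF time] that, unfolded add.assoc split]]) (use w0 in auto)
  qed
next
  case 4
  show ?case using dict_execution by fast
next
  case 5
  have "\<exists>C>0. time_within C d (d + 4) 3 (\<lambda>k. truss_dict k d)"
    by (rule peeling_time[where S = dict_steps, OF _ edge_bounded_dict_steps edge_bounded_dict_steps_outer])
      (use dict_execution(2) in blast)
  then obtain C where C: "0 < C" and T: "time_within C d (d + 4) 3 (\<lambda>k. truss_dict k d)" by blast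
  obtain C' where C': "0 < C'" and space: "\<And>k \<omega>u G G' tr ws. simple_graph G \<Longrightarrow> 1 \<le> card (verts G) \<Longrightarrow>
     (G', tr) \<in> outcomes (truss_dict k d \<omega>u G) \<Longrightarrow> call_space ws tr \<Longrightarrow>
     real (space tr) \<le> C' * (real (card (verts G)) + root_edges G ^ (d + 3) + real ws)"
    using dict_space_bound[of d] by blast
  let ?C = "max (2 * C) C'"
  have grow: "x \<le> ?C * y" if "x \<le> B * y" "0 \<le> y" "B \<le> ?C" for x y B
    using that mult_right_mono order_trans by blast
  (* Since a call takes at least one step, the elementary steps are absorbed by the calls. *)
  have absorb: "C * (n + x + w * x) \<le> 2 * C * (n + w * x)"
    if "0 \<le> n" "0 \<le> x" "1 \<le> w" for n x w :: real
  proof -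
    have "x \<le> w * x" using mult_right_mono[OF that(3,2)] by simp
    then have "C * (n + x + w * x) \<le> C * (2 * (n + w * x))"
      using that C by (intro mult_left_mono) auto
    also have "\<dots> = 2 * C * (n + w * x)" by (simp only: mult.assoc mult.left_commute)
    finally show ?thesis .
  qed
  show ?case
  proof (rule exI[of _ ?C], intro conjI allI impI ballI, use C in simp, clarify, intro conjI impI)
    fix k \<omega>u G w ws G' tr
    assume G: "simple_graph G" and n: "1 \<le> real (card (verts G))"
      and out: "(G', tr) \<in> outcomes (truss_dict k d \<omega>u G)"
      and w: "amortized_call_time w tr" and ws: "call_space ws tr"
    have n1: "1 \<le> card (verts G)" and w1: "1 \<le> w" using n w by (simp_all add: amortized_call_time_def)
    note time = T[unfolded time_within_def, rule_format, OF conjI[OF G conjI[OF n1 conjI[OF out w]]]]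
    show "real (space tr) \<le> ?C * (real (card (verts G)) +
        real (card (edges G)) powr ((real d + 3) / 2) + real ws)"
      by (rule grow[OF space[OF G n1 out ws, unfolded root_edges_powr]]) auto
    show "real (time tr) \<le> ?C * (real (card (verts G)) +
        w * real (card (edges G)) powr ((real d + 4) / 2))" if "0 < d \<or> edge_sensitive \<omega>u"
      by (rule grow[OF order_trans[OF mp[OF conjunct1[OF time] that] absorb], unfolded root_edges_powr])
        (use w1 in auto)
    show "real (time tr) \<le> ?C * (real (card (verts G)) +
        w * real (card (edges G)) powr (3 / 2))" if "d = 0 \<and> \<not> edge_sensitive \<omega>u"
      by (rule grow[OF order_trans[OF mp[OF conjunct2[OF time] that] absorb], unfolded root_edges_powr])
        (use w1 in auto)
  qed
qed

end
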